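(* Let $1<q<\infty$, let $T$ be a Calderón–Zygmund operator on $\mathbb{R}^n$, and let $\overline{T}_q$ be its vector-valued extension. Then there are constants $\alpha,c>0$ such that for every cube $Q$ and every vector function $f=\{f_j\}_{j=1}^\infty$ with $f_j\in L^\infty_c(\mathbb{R}^n)$ and $\operatorname{supp}f_j\subseteq Q$ for all $j$, $$|\{x\in Q: \overline{T}_qf(x)>t\,M(|f|_q)(x)\}|\le c\,e^{-\alpha t}|Q|,\qquad t>0.$$
   Context: Cubes have sides parallel to the axes; $L^\infty_c(\mathbb{R}^n)$ is the space of bounded compactly supported functions. For $f=\{f_j\}_{j=1}^\infty$, $|f(x)|_q=\big(\sum_{j=1}^\infty|f_j(x)|^q\big)^{1/q}$ and $\overline{T}_qf(x)=\big(\sum_{j=1}^\infty|Tf_j(x)|^q\big)^{1/q}$. The Hardy–Littlewood maximal operator is $Mg(x)=\sup_{Q\ni x}\frac1{|Q|}\int_Q|g(y)|\,dy$, the supremum over all cubes containing $x$. A Calderón–Zygmund operator is a linear operator $T:C_c^\infty(\mathbb{R}^n)\to L^1_{loc}(\mathbb{R}^n)$ that extends to a bounded operator on $L^2(\mathbb{R}^n)$ and for which there is a kernel $K$, a locally integrable function defined off the diagonal $x=y$ in $\mathbb{R}^n\times\mathbb{R}^n$, such that $|K(x,y)|\le \frac{c}{|x-y|^n}$ and, for some $\varepsilon>0$, $|K(x,y)-K(z,y)|+|K(y,x)-K(y,z)|\le c\frac{|x-z|^\varepsilon}{|x-y|^{n+\varepsilon}}$ whenever $2|x-z|<|x-y|$,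 and $Tf(x)=\int_{\mathbb{R}^n}K(x,y)f(y)\,dy$ for $f\in C_c^\infty(\mathbb{R}^n)$ and $x\notin\operatorname{supp}(f)$. *)

theory Defs
  imports "HOL-Analysis.Analysis"
begin

text \<open>Functions are complex valued and represented by Lebesgue measurable representatives, so the
  identities between values of an operator are required only almost everywhere. An operator is a
  total function on representatives, of which only the values on the indicated function class
  (\<open>C_c_infinity\<close> or \<open>L2\<close>) matter.\<close>

definition cube :: "(real ^ 'n) set \<Rightarrow> bool" where
  "cube Q \<longleftrightarrow> (\<exists>a l. 0 < l \<and> Q = cbox a (a + l *\<^sub>R One))"

subsection \<open>Function spaces\<close>

primrec C_k :: "nat \<Rightarrow> ('a::real_normed_vector \<Rightarrow> 'b::real_normed_vector) \<Rightarrow> bool" where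
  "C_k 0 f \<longleftrightarrow> continuous_on UNIV f"
| "C_k (Suc k) f \<longleftrightarrow>
     (\<forall>x. f differentiable (at x)) \<and> (\<forall>v. C_k k (\<lambda>x. frechet_derivative f (at x) v))"

definition supp :: "('a::topological_space \<Rightarrow> 'b::zero) \<Rightarrow> 'a set" where
  "supp f = closure {x. f x \<noteq> 0}"

definition C_c_infinity :: "(real ^ 'n \<Rightarrow> complex) set" where
  "C_c_infinity = {f. (\<forall>k. C_k k f) \<and> compact (supp f)}"

definition L1_loc :: "(real ^ 'n \<Rightarrow> complex) set" where
  "L1_loc = {f. f \<in> borel_measurable lebesgue \<and> (\<forall>C. compact C \<longrightarrow> set_integrable lebesgue C f)}"

definition L2 :: "(real ^ 'n \<Rightarrow> complex) set" where
  "L2 = {f. f \<in> borel_measurable lebesgue \<and> integrable lebesgue (\<lambda>x. (norm (f x))\<^sup>2)}"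

definition L2_norm :: "(real ^ 'n \<Rightarrow> complex) \<Rightarrow> real" where
  "L2_norm f = sqrt (LINT x|lebesgue. (norm (f x))\<^sup>2)"

text \<open>The support of an element of \<open>L\<^sup>\<infinity>\<close> does not depend on the representative: it is the complement
  of the largest open set on which the function vanishes almost everywhere.\<close>

definition ess_supp :: "(real ^ 'n \<Rightarrow> complex) \<Rightarrow> (real ^ 'n) set" where
  "ess_supp f = - \<Union>{U. open U \<and> (AE x in lebesgue. x \<in> U \<longrightarrow> f x = 0)}"

definition L_infinity_c :: "(real ^ 'n \<Rightarrow> complex) set" where
  "L_infinity_c = {f. f \<in> borel_measurable lebesgue \<and>
     (\<exists>B. AE x in lebesgue. norm (f x) \<le> B) \<and> compact (ess_supp f)}"

subsection \<open>Calderon--Zygmund operators\<close>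

definition linear_operator_on ::
  "(real ^ 'n \<Rightarrow> complex) set \<Rightarrow> ((real ^ 'n \<Rightarrow> complex) \<Rightarrow> real ^ 'n \<Rightarrow> complex) \<Rightarrow> bool" where
  "linear_operator_on D T \<longleftrightarrow> (\<forall>f\<in>D. \<forall>g\<in>D. \<forall>a b.
     AE x in lebesgue. T (\<lambda>y. a * f y + b * g y) x = a * T f x + b * T g x)"

definition L2_bounded_operator ::
  "((real ^ 'n \<Rightarrow> complex) \<Rightarrow> real ^ 'n \<Rightarrow> complex) \<Rightarrow> bool" where
  "L2_bounded_operator T \<longleftrightarrow> linear_operator_on L2 T \<and> (\<forall>f\<in>L2. T f \<in> L2) \<and>
     (\<exists>C. \<forall>f\<in>L2. L2_norm (T f) \<le> C * L2_norm f)"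

definition L2_extension ::
  "((real ^ 'n \<Rightarrow> complex) \<Rightarrow> real ^ 'n \<Rightarrow> complex) \<Rightarrow>
   ((real ^ 'n \<Rightarrow> complex) \<Rightarrow> real ^ 'n \<Rightarrow> complex) \<Rightarrow> bool" where
  "L2_extension T T' \<longleftrightarrow> L2_bounded_operator T' \<and>
     (\<forall>f\<in>C_c_infinity. AE x in lebesgue. T' f x = T f x)"

text \<open>The values of \<open>K\<close> on the diagonal are irrelevant.\<close>

definition CZ_kernel :: "(real ^ 'n \<Rightarrow> real ^ 'n \<Rightarrow> complex) \<Rightarrow> bool" where
  "CZ_kernel K \<longleftrightarrow>
     (\<forall>C. compact C \<and> C \<subseteq> {(x, y). x \<noteq> y} \<longrightarrow> set_integrable lebesgue C (\<lambda>(x, y). K x y)) \<and>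
     (\<exists>c. (\<forall>x y. x \<noteq> y \<longrightarrow> norm (K x y) \<le> c / norm (x - y) ^ CARD('n)) \<and>
       (\<exists>\<epsilon>>0. \<forall>x y z. 2 * norm (x - z) < norm (x - y) \<longrightarrow>
          norm (K x y - K z y) + norm (K y x - K y z)
            \<le> c * (norm (x - z) powr \<epsilon> / norm (x - y) powr (real CARD('n) + \<epsilon>))))"

definition calderon_zygmund ::
  "((real ^ 'n \<Rightarrow> complex) \<Rightarrow> real ^ 'n \<Rightarrow> complex) \<Rightarrow> bool" where
  "calderon_zygmund T \<longleftrightarrow>
     linear_operator_on C_c_infinity T \<and> (\<forall>f\<in>C_c_infinity. T f \<in> L1_loc) \<and>
     (\<exists>T'. L2_extension T T') \<and>
     (\<exists>K. CZ_kernel K \<and> (\<forall>f\<in>C_c_infinity. AE x in lebesgue.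
        x \<notin> supp f \<longrightarrow> T f x = (LINT y|lebesgue. K x y * f y)))"

subsection \<open>Vector-valued functions and the maximal operator\<close>

text \<open>The sum may diverge, so the \<open>\<ell>\<^sup>q\<close> norm and the maximal function take values in \<open>[0, \<infinity>]\<close>.\<close>

definition lq_norm :: "real \<Rightarrow> (nat \<Rightarrow> complex) \<Rightarrow> ennreal" where
  "lq_norm q a = (let s = (\<Sum>j. ennreal (norm (a j) powr q))
     in if s = \<infinity> then \<infinity> else ennreal (enn2real s powr (1 / q)))"

definition vector_extension ::
  "real \<Rightarrow> ((real ^ 'n \<Rightarrow> complex) \<Rightarrow> real ^ 'n \<Rightarrow> complex) \<Rightarrow>
   (nat \<Rightarrow> real ^ 'n \<Rightarrow> complex) \<Rightarrow> real ^ 'n \<Rightarrow> ennreal" where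
  "vector_extension q T f x = lq_norm q (\<lambda>j. T (f j) x)"

definition maximal_function :: "(real ^ 'n \<Rightarrow> ennreal) \<Rightarrow> real ^ 'n \<Rightarrow> ennreal" where
  "maximal_function g x =
     (SUP Q \<in> {Q. cube Q \<and> x \<in> Q}. (\<integral>\<^sup>+ y \<in> Q. g y \<partial>lebesgue) / emeasure lebesgue Q)"

end

theory Submission
  imports Defs
begin

text \<open>
  Fix a cube \<open>P\<close>, split each \<open>f\<^sub>j\<close> into its parts near \<open>P\<close> and away from \<open>P\<close>, and let \<open>c\<^sub>P\<close> be the
  \<open>\<ell>\<^sup>q\<close> norm at a fixed point of \<open>P\<close> of the kernel integrals of the far parts. The weak type \<open>(1,1)\<close>
  inequality for the near part and the smoothness of the kernel for the far part show that
  \<open>g = |T f|\<^sub>q\<close> differs from \<open>c\<^sub>P\<close> by at most \<open>A inf\<^bsub>P\<^esub> M(|f|\<^sub>q)\<close> off a small proportion of \<open>P\<close>.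
  Covering the exceptional set by maximal dyadic subcubes in which it still occupies a fixed
  proportion and iterating, the set where \<open>|g - c\<^sub>P| > 2 k A M(|f|\<^sub>q)\<close> has measure at most
  \<open>2\<^sup>-\<^sup>k |P|\<close>; if \<open>f\<close> is supported in \<open>P\<close>, then \<open>c\<^sub>P = 0\<close>, which is the claim.

  The weak type inequality follows by a Calderon--Zygmund decomposition from the strong type
  \<open>(q,q)\<close> inequality, which reduces to the scalar one. For the latter, the weak type inequality
  obtained from the \<open>L\<^sup>2\<close> bound gives the oscillation estimate above for a single function; it
  implies a good-\<open>\<lambda>\<close> inequality between \<open>T f\<close> and \<open>M f\<close>, and \<open>M\<close> is bounded on \<open>L\<^sup>q\<close>.
  All constants are independent of the number of components, so finite sequences suffice.
\<close>

section \<open>Smooth bump functions\<close>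

text \<open>The kernel formula is given only for test functions, off their support and almost
  everywhere, whereas stopping arguments cut functions off along cubes. Smooth density and an
  extension of the formula to bounded functions must therefore precede every estimate. The iteration
  compares the constants of nested cubes. It closes because one number, a multiple of the maximal
  function at \<open>x\<close>, dominates the oscillation bounds of all cubes through
  \<open>x\<close>. Each generation moves the constant by at most twice that number and halves the
  measure: a linear loss against a geometric gain, which is the exponential. The scalar
  \<open>(q,q)\<close> bound comes from a good-\<lambda> inequality rather than from interpolation
  and duality, so exponents below and above 2 are treated alike. For sequences, having the same
  \<open>q\<close> inside and outside lets sum and integral be exchanged, so that the scalar
  constant serves for every number of components.\<close>

lemma C_k_SucI:
  assumes "\<And>x. (f has_derivative f' x) (at x)" "\<And>v. C_k k (\<lambda>x. f' x v)"
  shows "C_k (Suc k) f"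
proof -
  have "frechet_derivative f (at x) = f' x" for x
    using frechet_derivative_at[OF assms(1)] by simp
  then show ?thesis using assms by (auto simp: differentiable_def)
qed

lemma C_k_SucE:
  assumes "C_k (Suc k) f"
  obtains f' where "\<And>x. (f has_derivative f' x) (at x)" "\<And>v. C_k k (\<lambda>x. f' x v)"
  using assms that[of "\<lambda>x. frechet_derivative f (at x)"] by (auto simp: frechet_derivative_works)

lemma C_k_Suc_imp: "C_k (Suc k) f \<Longrightarrow> C_k k f"
proof (induction k arbitrary: f)
  case 0
  then show ?case
    by (auto intro!: continuous_at_imp_continuous_on differentiable_imp_continuous_within)
next
  case (Suc k)
  from Suc.prems obtain f' where f': "\<And>x. (f has_derivative f' x) (at x)"
    "\<And>v. C_k (Suc k) (\<lambda>x. f' x v)" by (rule C_k_SucE) blast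
  show ?case by (rule C_k_SucI[OF f'(1)]) (rule Suc.IH[OF f'(2)])
qed

lemma C_k_const: "C_k k (\<lambda>x. c)"
proof (induction k arbitrary: c)
  case (Suc k)
  show ?case by (rule C_k_SucI[where f'="\<lambda>x v. 0"]) (auto intro: Suc)
qed simp

lemma C_k_bounded_linear:
  assumes "bounded_linear L"
  shows "C_k k L"
proof (cases k)
  case 0
  then show ?thesis using assms by (simp add: linear_continuous_on)
next
  case (Suc m)
  show ?thesis unfolding Suc
    by (rule C_k_SucI[where f'="\<lambda>x. L"]) (use assms in \<open>auto intro: C_k_const bounded_linear_imp_has_derivative\<close>)
qed

lemma C_k_add: "C_k k f \<Longrightarrow> C_k k g \<Longrightarrow> C_k k (\<lambda>x. f x + g x)"
proof (induction k arbitrary: f g)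
  case 0
  then show ?case by (auto intro: continuous_on_add)
next
  case (Suc k)
  from Suc.prems obtain f' g' where
    "\<And>x. (f has_derivative f' x) (at x)" "\<And>v. C_k k (\<lambda>x. f' x v)"
    "\<And>x. (g has_derivative g' x) (at x)" "\<And>v. C_k k (\<lambda>x. g' x v)"
    by (elim C_k_SucE) blast
  then show ?case
    by (intro C_k_SucI[where f'="\<lambda>x v. f' x v + g' x v"]) (auto intro: Suc.IH has_derivative_add)
qed

lemma C_k_linear_comp:
  assumes "bounded_linear L"
  shows "C_k k f \<Longrightarrow> C_k k (\<lambda>x. L (f x))"
proof (induction k arbitrary: f)
  case 0
  then show ?case using assms by (auto intro: bounded_linear.continuous_on)
next
  case (Suc k)
  from Suc.prems obtain f' where
    "\<And>x. (f has_derivative f' x) (at x)" "\<And>v. C_k k (\<lambda>x. f' x v)"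
    by (elim C_k_SucE) blast
  then show ?case
    by (intro C_k_SucI[where f'="\<lambda>x v. L (f' x v)"])
      (auto intro: Suc.IH bounded_linear.has_derivative[OF assms])
qed

lemma C_k_mult:
  fixes f g :: "'a::real_normed_vector \<Rightarrow> 'b::real_normed_algebra"
  shows "C_k k f \<Longrightarrow> C_k k g \<Longrightarrow> C_k k (\<lambda>x. f x * g x)"
proof (induction k arbitrary: f g)
  case 0
  then show ?case by (auto intro: continuous_on_mult)
next
  case (Suc k)
  from Suc.prems obtain f' g' where d:
    "\<And>x. (f has_derivative f' x) (at x)" "\<And>v. C_k k (\<lambda>x. f' x v)"
    "\<And>x. (g has_derivative g' x) (at x)" "\<And>v. C_k k (\<lambda>x. g' x v)"
    by (elim C_k_SucE) blast
  note Suc.prems[THEN C_k_Suc_imp]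
  with d show ?case
    by (intro C_k_SucI[where f'="\<lambda>x v. f x * g' x v + f' x v * g x"])
      (auto intro!: Suc.IH C_k_add intro: has_derivative_mult)
qed

lemma C_k_prod:
  fixes f :: "'i \<Rightarrow> 'a::real_normed_vector \<Rightarrow> 'b::{real_normed_algebra,comm_ring_1}"
  assumes "finite I" "\<And>i. i \<in> I \<Longrightarrow> C_k k (f i)"
  shows "C_k k (\<lambda>x. \<Prod>i\<in>I. f i x)"
  using assms by (induction I rule: finite_induct) (auto intro: C_k_const C_k_mult)

lemma C_k_sum:
  assumes "finite I" "\<And>i. i \<in> I \<Longrightarrow> C_k k (f i)"
  shows "C_k k (\<lambda>x. \<Sum>i\<in>I. f i x)"
  using assms by (induction I rule: finite_induct) (auto intro: C_k_const C_k_add)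

text \<open>By linearity \<open>h' (f x) (f' x v)\<close> is the product
  \<open>h' (f x) 1 * f' x v\<close>. The chain rule thus reduces to \<open>C_k_mult\<close> and to
  the induction hypothesis for the scalar function \<open>\<lambda>y. h' y 1\<close>.\<close>

lemma C_k_compose_real:
  fixes h :: "real \<Rightarrow> real" and f :: "'a::real_normed_vector \<Rightarrow> real"
  shows "C_k k h \<Longrightarrow> C_k k f \<Longrightarrow> C_k k (\<lambda>x. h (f x))"
proof (induction k arbitrary: h)
  case 0
  then show ?case by (auto intro: continuous_on_compose2)
next
  case (Suc k)
  from Suc.prems obtain f' h' where d:
    "\<And>x. (f has_derivative f' x) (at x)" "\<And>v. C_k k (\<lambda>x. f' x v)"
    "\<And>x. (h has_derivative h' x) (at x)" "\<And>v. C_k k (\<lambda>x. h' x v)"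
    by (elim C_k_SucE) blast
  have *: "h' (f x) (f' x v) = h' (f x) 1 * f' x v" for x v
    using linear_cmul[OF bounded_linear.linear[OF has_derivative_bounded_linear[OF d(3)]], of "f x" "f' x v" 1]
    by (simp add: mult.commute)
  show ?case
  proof (rule C_k_SucI[where f'="\<lambda>x v. h' (f x) (f' x v)"])
    show "((\<lambda>x. h (f x)) has_derivative (\<lambda>v. h' (f x) (f' x v))) (at x)" for x
      using has_derivative_compose[OF d(1) d(3)] .
    show "C_k k (\<lambda>x. h' (f x) (f' x v))" for v
      unfolding * by (intro C_k_mult d Suc.IH[where h="\<lambda>y. h' y 1"] C_k_Suc_imp[OF Suc.prems(2)])
  qed
qed

lemma C_k_exp: "C_k k (exp :: real \<Rightarrow> real)"
proof (induction k)
  case 0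
  then show ?case by (simp add: continuous_on_exp)
next
  case (Suc k)
  show ?case
    by (rule C_k_SucI[where f'="\<lambda>x v. exp x * v"])
      (auto intro!: C_k_mult Suc C_k_const simp: has_field_derivative_def[symmetric] DERIV_exp)
qed

text \<open>The classical \<open>exp (- 1 / t)\<close> extended by 0, multiplied by a power of
  \<open>1 / t\<close>. The powers are carried along because derivatives of members are linear
  combinations of members, so that one induction proves all of them smooth.\<close>

definition flat :: "nat \<Rightarrow> real \<Rightarrow> real" where
  "flat m t = (if 0 < t then exp (- inverse t) * inverse t ^ m else 0)"

lemma flat_tendsto_0: "(flat m \<longlongrightarrow> 0) (at 0)"
proof -
  have "((\<lambda>s. s ^ m / exp s) \<longlongrightarrow> 0) (at_top :: real filter)"
    by (rule tendsto_power_div_exp_0)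
  then have "((\<lambda>t. inverse t ^ m / exp (inverse t)) \<longlongrightarrow> 0) (at_right (0::real))"
    by (rule filterlim_compose[OF _ filterlim_inverse_at_top_right])
  moreover have "\<forall>\<^sub>F t in at_right 0. flat m t = inverse t ^ m / exp (inverse t)"
    by (auto simp: eventually_at_filter flat_def exp_minus field_simps intro!: always_eventually)
  ultimately have r: "(flat m \<longlongrightarrow> 0) (at_right 0)" by (simp cong: tendsto_cong)
  have "\<forall>\<^sub>F t in at_left 0. flat m t = 0"
    by (auto simp: eventually_at_filter flat_def intro!: always_eventually)
  then have "(flat m \<longlongrightarrow> 0) (at_left 0)" by (simp add: tendsto_eventually)
  with r show ?thesis by (simp add: filterlim_split_at)
qed

lemma flat_has_real_derivative:
  "(flat m has_real_derivative - real m * flat (Suc m) t + flat (m + 2) t) (at t)"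
proof -
  consider "0 < t" | "t < 0" | "t = 0" by linarith
  then show ?thesis
  proof cases
    case 1
    have "((\<lambda>t. exp (- inverse t) * inverse t ^ m) has_real_derivative
        - real m * flat (Suc m) t + flat (m + 2) t) (at t)"
    proof (cases m)
      case 0
      then show ?thesis
        using 1 by (auto intro!: derivative_eq_intros simp: flat_def power2_eq_square)
    next
      case (Suc p)
      have "((\<lambda>t. exp (- inverse t) * inverse t ^ m) has_real_derivative
        exp (- inverse t) * (inverse t * inverse t) * inverse t ^ m
          + exp (- inverse t) * (real m * inverse t ^ p * - (inverse t * inverse t))) (at t)"
        using 1 unfolding Suc
        by (auto intro!: derivative_eq_intros simp: power2_eq_square) (cases p; simp add: algebra_simps)
      then show ?thesis using 1 by (simp add: flat_def Suc algebra_simps)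
    qed
    then show ?thesis
      by (rule has_field_derivative_transform_within_open[where S="{0<..}"]) (use 1 in \<open>auto simp: flat_def\<close>)
  next
    case 2
    have "((\<lambda>t. 0) has_real_derivative - real m * flat (Suc m) t + flat (m + 2) t) (at t)"
      using 2 by (simp add: flat_def)
    then show ?thesis
      by (rule has_field_derivative_transform_within_open[where S="{..<0}"]) (use 2 in \<open>auto simp: flat_def\<close>)
  next
    case 3
    \<comment> \<open>At the origin the difference quotient is the next member of the family, whose
      limit at 0 is already known to be 0.\<close>
    have "(flat m y - flat m 0) / (y - 0) = flat (Suc m) y" for y
      by (auto simp: flat_def divide_inverse)
    then show ?thesis
      using flat_tendsto_0[of "Suc m"] 3
      by (simp add: has_field_derivative_iff flat_def[of _ 0])
  qed
qed

lemma C_k_flat: "C_k k (flat m)"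
proof (induction k arbitrary: m)
  case 0
  show ?case
    by (auto intro!: continuous_at_imp_continuous_on DERIV_isCont[OF flat_has_real_derivative])
next
  case (Suc k)
  show ?case
  proof (rule C_k_SucI[where f'="\<lambda>x v. (- real m * flat (Suc m) x + flat (m + 2) x) * v"])
    show "(flat m has_derivative (\<lambda>v. (- real m * flat (Suc m) x + flat (m + 2) x) * v)) (at x)" for x
      using flat_has_real_derivative[of m x] unfolding has_field_derivative_def .
    show "C_k k (\<lambda>x. (- real m * flat (Suc m) x + flat (m + 2) x) * v)" for v
      by (intro C_k_mult C_k_add C_k_const Suc)
  qed
qed

lemma flat_nonneg: "0 \<le> flat m t" and flat_pos_iff: "0 < flat m t \<longleftrightarrow> 0 < t"
  by (auto simp: flat_def)

section \<open>Smooth functions positive exactly on an open box\<close>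

definition bump :: "real ^ 'n \<Rightarrow> real ^ 'n \<Rightarrow> real ^ 'n \<Rightarrow> real" where
  "bump a b x = (\<Prod>i\<in>UNIV. flat 0 (x $ i - a $ i) * flat 0 (b $ i - x $ i))"

lemma C_k_bump:
  fixes a b :: "real ^ 'n"
  shows "C_k k (bump a b)"
proof -
  have "C_k k (\<lambda>x::real^'n. flat 0 (x $ i - a $ i) * flat 0 (b $ i - x $ i))" for i
  proof -
    have l: "C_k k (\<lambda>x::real^'n. x $ i)" by (rule C_k_bounded_linear) (rule bounded_linear_vec_nth)
    have 1: "C_k k (\<lambda>x::real^'n. x $ i - a $ i)"
      using C_k_add[OF l C_k_const[of k "- a $ i"]] by simp
    have 2: "C_k k (\<lambda>x::real^'n. b $ i - x $ i)"
      using C_k_add[OF C_k_linear_comp[OF bounded_linear_minus[OF bounded_linear_ident] l] C_k_const[of k "b $ i"]]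
      by simp
    show ?thesis by (intro C_k_mult C_k_compose_real[OF C_k_flat 1] C_k_compose_real[OF C_k_flat 2])
  qed
  then show ?thesis unfolding bump_def by (intro C_k_prod) auto
qed

lemma bump_nonneg: "0 \<le> bump a b x"
  unfolding bump_def by (intro prod_nonneg) (auto intro: mult_nonneg_nonneg flat_nonneg)

lemma bump_pos_iff: "0 < bump a b x \<longleftrightarrow> x \<in> box a b"
proof -
  have "flat 0 s * flat 0 t > 0 \<longleftrightarrow> s > 0 \<and> t > 0" for s t
    using flat_nonneg[of 0 s] flat_nonneg[of 0 t] flat_pos_iff[of 0 s] flat_pos_iff[of 0 t]
    by (auto simp: zero_less_mult_iff)
  moreover have "0 < bump a b x \<longleftrightarrow> (\<forall>i. 0 < flat 0 (x $ i - a $ i) * flat 0 (b $ i - x $ i))"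
  proof
    assume "0 < bump a b x"
    then have "(\<Prod>i\<in>UNIV. flat 0 (x $ i - a $ i) * flat 0 (b $ i - x $ i)) \<noteq> 0"
      unfolding bump_def by linarith
    then have "flat 0 (x $ i - a $ i) * flat 0 (b $ i - x $ i) \<noteq> 0" for i
      by (subst (asm) prod_zero_iff) auto
    then show "\<forall>i. 0 < flat 0 (x $ i - a $ i) * flat 0 (b $ i - x $ i)"
      by (metis flat_nonneg mult_nonneg_nonneg order_le_less)
  qed (auto simp: bump_def intro!: prod_pos)
  ultimately show ?thesis by (simp add: mem_box_cart)
qed

section \<open>Density of smooth functions\<close>

lemma C_c_infinity_iff:
  "f \<in> C_c_infinity \<longleftrightarrow> (\<forall>k. C_k k f) \<and> bounded {x. f x \<noteq> 0}"
  by (auto simp: C_c_infinity_def supp_def compact_closure)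

lemma C_c_infinity_measurable:
  assumes "f \<in> C_c_infinity"
  shows "f \<in> borel_measurable lebesgue"
proof -
  have "C_k 0 f" using assms by (simp add: C_c_infinity_iff del: C_k.simps)
  then show ?thesis
    by (auto intro!: measurable_completion borel_measurable_continuous_onI)
qed

lemma C_c_infinity_add:
  assumes "f \<in> C_c_infinity" "g \<in> C_c_infinity"
  shows "(\<lambda>x. f x + g x) \<in> C_c_infinity"
proof -
  have "{x. f x + g x \<noteq> 0} \<subseteq> {x. f x \<noteq> 0} \<union> {x. g x \<noteq> 0}" by auto
  moreover have "bounded ({x. f x \<noteq> 0} \<union> {x. g x \<noteq> 0})"
    using assms by (simp add: C_c_infinity_iff)
  ultimately have "bounded {x. f x + g x \<noteq> 0}" by (rule bounded_subset[rotated])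
  then show ?thesis using assms by (simp add: C_c_infinity_iff C_k_add)
qed

lemma C_c_infinity_cmult:
  assumes "f \<in> C_c_infinity"
  shows "(\<lambda>x. c * f x) \<in> C_c_infinity"
proof -
  have "{x. c * f x \<noteq> 0} \<subseteq> {x. f x \<noteq> 0}" by auto
  moreover have "bounded {x. f x \<noteq> 0}" using assms by (simp add: C_c_infinity_iff)
  ultimately have "bounded {x. c * f x \<noteq> 0}" by (rule bounded_subset[rotated])
  then show ?thesis using assms by (simp add: C_c_infinity_iff C_k_mult C_k_const)
qed

lemma norm_add_sq: "(norm (a + b :: 'a::real_normed_vector))\<^sup>2 \<le> 2 * (norm a)\<^sup>2 + 2 * (norm b)\<^sup>2"
proof -
  have "(norm (a + b))\<^sup>2 \<le> (norm a + norm b)\<^sup>2"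
    by (intro power_mono norm_triangle_ineq) auto
  also have "\<dots> \<le> 2 * (norm a)\<^sup>2 + 2 * (norm b)\<^sup>2"
    using zero_le_power2[of "norm a - norm b"] by (simp add: power2_eq_square algebra_simps)
  finally show ?thesis .
qed

lemma nn_integral_norm_add_sq:
  fixes f g :: "'a \<Rightarrow> complex"
  assumes [measurable]: "f \<in> borel_measurable M" "g \<in> borel_measurable M"
  shows "(\<integral>\<^sup>+x. (norm (f x + g x))\<^sup>2 \<partial>M) \<le> 2 * (\<integral>\<^sup>+x. (norm (f x))\<^sup>2 \<partial>M) + 2 * (\<integral>\<^sup>+x. (norm (g x))\<^sup>2 \<partial>M)"
proof -
  have "(\<integral>\<^sup>+x. (norm (f x + g x))\<^sup>2 \<partial>M) \<le> (\<integral>\<^sup>+x. 2 * ennreal ((norm (f x))\<^sup>2) + 2 * ennreal ((norm (g x))\<^sup>2) \<partial>M)"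
    using norm_add_sq
    by (intro nn_integral_mono)
      (auto simp: ennreal_plus[symmetric] ennreal_mult' [symmetric] ennreal_numeral[symmetric] intro!: ennreal_leI simp del: ennreal_plus ennreal_numeral)
  also have "\<dots> = 2 * (\<integral>\<^sup>+x. (norm (f x))\<^sup>2 \<partial>M) + 2 * (\<integral>\<^sup>+x. (norm (g x))\<^sup>2 \<partial>M)"
    by (simp add: nn_integral_add nn_integral_cmult)
  finally show ?thesis .
qed

text \<open>The approximants have to vanish off a prescribed set \<open>U\<close>: this keeps them
  close to the support of \<open>f\<close>, so that their kernel formula is available at all points
  a positive distance away from \<open>U\<close>. The squared error is a
  \<open>[0, \<infinity>]\<close>-valued integral, which spares integrability side
  conditions.\<close>

definition smoothly_approximable :: "(real ^ 'n) set \<Rightarrow> (real ^ 'n \<Rightarrow> complex) \<Rightarrow> bool" where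
  "smoothly_approximable U f \<longleftrightarrow> f \<in> borel_measurable lebesgue \<and>
     (\<forall>e>0. \<exists>\<phi>\<in>C_c_infinity. (\<forall>x. x \<notin> U \<longrightarrow> \<phi> x = 0) \<and>
        (\<integral>\<^sup>+x. (norm (f x - \<phi> x))\<^sup>2 \<partial>lebesgue) < ennreal e)"

lemma smoothly_approximable_limit:
  assumes f: "f \<in> borel_measurable lebesgue"
    and "\<And>e. 0 < e \<Longrightarrow> \<exists>g. smoothly_approximable U g \<and> (\<integral>\<^sup>+x. (norm (f x - g x))\<^sup>2 \<partial>lebesgue) < ennreal e"
  shows "smoothly_approximable U f"
  unfolding smoothly_approximable_def
proof (intro conjI f allI impI)
  fix e :: real assume "0 < e"
  then obtain g where g: "smoothly_approximable U g" "(\<integral>\<^sup>+x. (norm (f x - g x))\<^sup>2 \<partial>lebesgue) < ennreal (e/4)"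
    using assms(2)[of "e/4"] by auto
  then obtain \<phi> where \<phi>: "\<phi> \<in> C_c_infinity" "\<forall>x. x \<notin> U \<longrightarrow> \<phi> x = 0"
    "(\<integral>\<^sup>+x. (norm (g x - \<phi> x))\<^sup>2 \<partial>lebesgue) < ennreal (e/4)"
    using \<open>0 < e\<close> unfolding smoothly_approximable_def by (meson divide_pos_pos zero_less_numeral)
  have [measurable]: "f \<in> borel_measurable lebesgue" "g \<in> borel_measurable lebesgue" "\<phi> \<in> borel_measurable lebesgue"
    using f g(1) C_c_infinity_measurable[OF \<phi>(1)] by (auto simp: smoothly_approximable_def)
  have "(\<integral>\<^sup>+x. (norm (f x - \<phi> x))\<^sup>2 \<partial>lebesgue) = (\<integral>\<^sup>+x. (norm ((f x - g x) + (g x - \<phi> x)))\<^sup>2 \<partial>lebesgue)"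
    by simp
  also have "\<dots> \<le> 2 * (\<integral>\<^sup>+x. (norm (f x - g x))\<^sup>2 \<partial>lebesgue) + 2 * (\<integral>\<^sup>+x. (norm (g x - \<phi> x))\<^sup>2 \<partial>lebesgue)"
    by (intro nn_integral_norm_add_sq) auto
  also have "\<dots> < 2 * ennreal (e/4) + 2 * ennreal (e/4)"
    using g(2) \<phi>(3) by (intro add_strict_mono ennreal_mult_strict_left_mono) auto
  also have "\<dots> = ennreal e"
    using \<open>0 < e\<close> by (simp add: ennreal_plus[symmetric] ennreal_mult'[symmetric] ennreal_numeral[symmetric] del: ennreal_plus ennreal_numeral)
  finally show "\<exists>\<phi>\<in>C_c_infinity. (\<forall>x. x \<notin> U \<longrightarrow> \<phi> x = 0) \<and> (\<integral>\<^sup>+x. (norm (f x - \<phi> x))\<^sup>2 \<partial>lebesgue) < ennreal e"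
    using \<phi>(1,2) by blast
qed

lemma smoothly_approximable_zero: "smoothly_approximable U (\<lambda>x. 0)"
proof -
  have "(\<lambda>x. 0) \<in> C_c_infinity" by (simp add: C_c_infinity_iff C_k_const)
  then show ?thesis
    unfolding smoothly_approximable_def by (intro conjI allI impI bexI[where x="\<lambda>x. 0"]) auto
qed

lemma smoothly_approximable_add:
  assumes f: "smoothly_approximable U f" and g: "smoothly_approximable U g"
  shows "smoothly_approximable U (\<lambda>x. f x + g x)"
  unfolding smoothly_approximable_def
proof (intro conjI allI impI)
  show "(\<lambda>x. f x + g x) \<in> borel_measurable lebesgue"
    using f g by (auto simp: smoothly_approximable_def)
  fix e :: real assume e: "0 < e"
  then have "0 < e/4" by simp
  with f g obtain \<phi> \<psi> where \<phi>: "\<phi> \<in> C_c_infinity" "\<forall>x. x \<notin> U \<longrightarrow> \<phi> x = 0"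
    "(\<integral>\<^sup>+x. (norm (f x - \<phi> x))\<^sup>2 \<partial>lebesgue) < ennreal (e/4)"
    and \<psi>: "\<psi> \<in> C_c_infinity" "\<forall>x. x \<notin> U \<longrightarrow> \<psi> x = 0"
    "(\<integral>\<^sup>+x. (norm (g x - \<psi> x))\<^sup>2 \<partial>lebesgue) < ennreal (e/4)"
    unfolding smoothly_approximable_def by meson
  have [measurable]: "f \<in> borel_measurable lebesgue" "g \<in> borel_measurable lebesgue"
    "\<phi> \<in> borel_measurable lebesgue" "\<psi> \<in> borel_measurable lebesgue"
    using f g C_c_infinity_measurable[OF \<phi>(1)] C_c_infinity_measurable[OF \<psi>(1)]
    by (auto simp: smoothly_approximable_def)
  have "(\<integral>\<^sup>+x. (norm (f x + g x - (\<phi> x + \<psi> x)))\<^sup>2 \<partial>lebesgue) = (\<integral>\<^sup>+x. (norm ((f x - \<phi> x) + (g x - \<psi> x)))\<^sup>2 \<partial>lebesgue)"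
    by (simp add: algebra_simps)
  also have "\<dots> \<le> 2 * (\<integral>\<^sup>+x. (norm (f x - \<phi> x))\<^sup>2 \<partial>lebesgue) + 2 * (\<integral>\<^sup>+x. (norm (g x - \<psi> x))\<^sup>2 \<partial>lebesgue)"
    by (intro nn_integral_norm_add_sq) auto
  also have "\<dots> < 2 * ennreal (e/4) + 2 * ennreal (e/4)"
    using \<phi>(3) \<psi>(3) by (intro add_strict_mono ennreal_mult_strict_left_mono) auto
  also have "\<dots> = ennreal e"
    using e by (simp add: ennreal_plus[symmetric] ennreal_mult'[symmetric] ennreal_numeral[symmetric] del: ennreal_plus ennreal_numeral)
  finally show "\<exists>\<phi>\<in>C_c_infinity. (\<forall>x. x \<notin> U \<longrightarrow> \<phi> x = 0) \<and> (\<integral>\<^sup>+x. (norm (f x + g x - \<phi> x))\<^sup>2 \<partial>lebesgue) < ennreal e"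
    using \<phi>(1,2) \<psi>(1,2) by (intro bexI[where x="\<lambda>x. \<phi> x + \<psi> x"]) (auto intro: C_c_infinity_add)
qed

lemma smoothly_approximable_cmult:
  assumes f: "smoothly_approximable U f"
  shows "smoothly_approximable U (\<lambda>x. c * f x)"
proof (cases "c = 0")
  case True
  then show ?thesis by (simp add: smoothly_approximable_zero)
next
  case False
  show ?thesis
    unfolding smoothly_approximable_def
  proof (intro conjI allI impI)
    show "(\<lambda>x. c * f x) \<in> borel_measurable lebesgue"
      using f by (auto simp: smoothly_approximable_def)
    fix e :: real assume e: "0 < e"
    then have "0 < e/(norm c)\<^sup>2" using False by simp
    with f obtain \<phi> where \<phi>: "\<phi> \<in> C_c_infinity" "\<forall>x. x \<notin> U \<longrightarrow> \<phi> x = 0"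
      "(\<integral>\<^sup>+x. (norm (f x - \<phi> x))\<^sup>2 \<partial>lebesgue) < ennreal (e/(norm c)\<^sup>2)"
      unfolding smoothly_approximable_def by meson
    have [measurable]: "f \<in> borel_measurable lebesgue" "\<phi> \<in> borel_measurable lebesgue"
      using f C_c_infinity_measurable[OF \<phi>(1)] by (auto simp: smoothly_approximable_def)
    have "(\<integral>\<^sup>+x. (norm (c * f x - c * \<phi> x))\<^sup>2 \<partial>lebesgue) = (\<integral>\<^sup>+x. ennreal ((norm c)\<^sup>2) * (norm (f x - \<phi> x))\<^sup>2 \<partial>lebesgue)"
      by (intro nn_integral_cong)
        (simp add: right_diff_distrib[symmetric] norm_mult power_mult_distrib ennreal_mult')
    also have "\<dots> = ennreal ((norm c)\<^sup>2) * (\<integral>\<^sup>+x. (norm (f x - \<phi> x))\<^sup>2 \<partial>lebesgue)"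
      by (intro nn_integral_cmult) auto
    also have "\<dots> < ennreal ((norm c)\<^sup>2) * ennreal (e/(norm c)\<^sup>2)"
      using \<phi>(3) False by (intro ennreal_mult_strict_left_mono) auto
    also have "\<dots> = ennreal e"
      using False e by (simp add: ennreal_mult'[symmetric])
    finally show "\<exists>\<phi>\<in>C_c_infinity. (\<forall>x. x \<notin> U \<longrightarrow> \<phi> x = 0) \<and> (\<integral>\<^sup>+x. (norm (c * f x - \<phi> x))\<^sup>2 \<partial>lebesgue) < ennreal e"
      using \<phi>(1,2) by (intro bexI[where x="\<lambda>x. c * \<phi> x"]) (auto intro: C_c_infinity_cmult)
  qed
qed

lemma smoothly_approximable_sum:
  assumes "finite I" "\<And>i. i \<in> I \<Longrightarrow> smoothly_approximable U (f i)"
  shows "smoothly_approximable U (\<lambda>x. \<Sum>i\<in>I. f i x)"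
  using assms
  by (induction I rule: finite_induct) (auto intro: smoothly_approximable_zero smoothly_approximable_add)

text \<open>Write \<open>G\<close> as a countable union of open boxes and let \<open>u N\<close> be
  the sum of the first \<open>N\<close> bumps. The functions \<open>1 - exp (- N * u N)\<close>
  vanish off \<open>G\<close>, lie between 0 and 1, and tend to 1 at each point of \<open>G\<close>,
  because \<open>u N\<close> is eventually bounded below there by one positive bump. Dominated
  convergence concludes.\<close>

lemma smoothly_approximable_indicator_open:
  fixes G :: "(real ^ 'n) set"
  assumes "open G" "bounded G" "G \<subseteq> U"
  shows "smoothly_approximable U (\<lambda>x. of_real (indicator G x))"
  unfolding smoothly_approximable_def
proof (intro conjI allI impI)
  have [measurable]: "G \<in> sets lebesgue" using assms by auto
  show "(\<lambda>x. complex_of_real (indicator G x)) \<in> borel_measurable lebesgue" by simp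
  fix e :: real assume "0 < e"
  obtain \<D> where D: "countable \<D>" "\<D> \<subseteq> Pow G" "\<And>X. X \<in> \<D> \<Longrightarrow> \<exists>a b. X = box a b" "\<Union>\<D> = G"
    using open_countable_Union_open_box[OF \<open>open G\<close>] by metis
  \<comment> \<open>The empty set is added so that \<open>from_nat_into\<close> enumerates a
    nonempty family even if \<open>G\<close> is empty; it is itself a degenerate box.\<close>
  define B where "B = (\<lambda>i. from_nat_into (insert {} \<D>) i)"
  have B: "range B = insert {} \<D>" unfolding B_def using D(1) by (intro range_from_nat_into) auto
  have "\<exists>a b. B i = box a b" for i
  proof -
    have "B i \<in> insert {} \<D>" using B by blast
    moreover have "x \<notin> box 0 0" for x :: "real ^ 'n"
      unfolding mem_box_cart using less_asym by blast
    then have "\<exists>a b :: real ^ 'n. {} = box a b" by blast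
    ultimately show ?thesis using D(3) by blast
  qed
  then obtain a b where ab: "\<And>i. B i = box (a i) (b i)" by metis
  have UB: "(\<Union>i. box (a i) (b i)) = G"
  proof -
    have "(\<Union>i. box (a i) (b i)) = \<Union>(range B)" using ab by simp
    also have "\<dots> = G" unfolding B using D(4) by simp
    finally show ?thesis .
  qed
  define u where "u = (\<lambda>N x. \<Sum>i<N. bump (a i) (b i) x)"
  define \<phi> where "\<phi> = (\<lambda>N x. complex_of_real (1 - exp (- (real N * u N x))))"
  have u_nonneg: "0 \<le> u N x" for N x unfolding u_def by (intro sum_nonneg bump_nonneg)
  have \<phi>0: "\<phi> N x = 0" if "x \<notin> G" for N x
  proof -
    have "bump (a i) (b i) x = 0" for i
      using that UB bump_pos_iff[of "a i" "b i" x] bump_nonneg[of "a i" "b i" x] by force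
    then show ?thesis by (simp add: \<phi>_def u_def)
  qed
  have Ck: "C_k k (\<phi> N)" for k N
  proof -
    have "C_k k (\<lambda>x. - (real N * u N x))"
      using C_k_mult[OF C_k_const[of k "- real N"], of "u N"] C_k_sum[of "{..<N}" k "\<lambda>i. bump (a i) (b i)"]
      by (simp add: u_def C_k_bump)
    then have "C_k k (\<lambda>x. exp (- (real N * u N x)))" by (rule C_k_compose_real[OF C_k_exp])
    then have "C_k k (\<lambda>x. 1 + (- 1) * exp (- (real N * u N x)))"
      by (intro C_k_add C_k_mult C_k_const)
    then have "C_k k (\<lambda>x. complex_of_real (1 + (- 1) * exp (- (real N * u N x))))"
      by (rule C_k_linear_comp[OF bounded_linear_of_real])
    then show ?thesis by (simp add: \<phi>_def)
  qed
  have \<phi>C: "\<phi> N \<in> C_c_infinity" for N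
  proof -
    have "{x. \<phi> N x \<noteq> 0} \<subseteq> G" using \<phi>0 by blast
    then show ?thesis using Ck bounded_subset[OF \<open>bounded G\<close>] by (auto simp: C_c_infinity_iff)
  qed
  note [measurable] = C_c_infinity_measurable[OF \<phi>C]
  have val: "(norm (complex_of_real (indicator G x) - \<phi> N x))\<^sup>2 = indicator G x * (exp (- (real N * u N x)))\<^sup>2" for N x
    using \<phi>0 by (auto simp: \<phi>_def indicator_def simp flip: of_real_diff)
  have lim: "(\<lambda>N. ennreal ((norm (complex_of_real (indicator G x) - \<phi> N x))\<^sup>2)) \<longlonglongrightarrow> 0" for x
  proof (cases "x \<in> G")
    case True
    then obtain i where i: "x \<in> box (a i) (b i)" using UB by blast
    have "0 < bump (a i) (b i) x" using i bump_pos_iff by blast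
    have "(\<lambda>N. (exp (- (real N * u N x)))\<^sup>2) \<longlonglongrightarrow> 0"
    proof (rule tendsto_sandwich)
      show "\<forall>\<^sub>F N in sequentially. 0 \<le> (exp (- (real N * u N x)))\<^sup>2" by simp
      show "\<forall>\<^sub>F N in sequentially. (exp (- (real N * u N x)))\<^sup>2 \<le> (exp (- (real N * bump (a i) (b i) x)))\<^sup>2"
      proof (intro eventually_sequentiallyI[of "Suc i"])
        fix N assume "Suc i \<le> N"
        then have "bump (a i) (b i) x \<le> u N x"
          unfolding u_def by (intro member_le_sum bump_nonneg) auto
        then show "(exp (- (real N * u N x)))\<^sup>2 \<le> (exp (- (real N * bump (a i) (b i) x)))\<^sup>2"
          by (intro power_mono) (auto intro: mult_left_mono)
      qed
      show "(\<lambda>N. (exp (- (real N * bump (a i) (b i) x)))\<^sup>2) \<longlonglongrightarrow> 0"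
      proof -
        have "(\<lambda>N. exp (- bump (a i) (b i) x) ^ N) \<longlonglongrightarrow> 0"
          using \<open>0 < bump (a i) (b i) x\<close> by (intro LIMSEQ_realpow_zero) auto
        then have "(\<lambda>N. exp (- (real N * bump (a i) (b i) x))) \<longlonglongrightarrow> 0"
          using exp_of_nat_mult[where 'a=real, of _ "- bump (a i) (b i) x"] by simp
        from tendsto_power[OF this, of 2] show ?thesis by simp
      qed
    qed simp
    from tendsto_ennrealI[OF this] show ?thesis unfolding val using True by simp
  qed (simp add: \<phi>0)
  have "(\<lambda>N. \<integral>\<^sup>+x. (norm (complex_of_real (indicator G x) - \<phi> N x))\<^sup>2 \<partial>lebesgue) \<longlonglongrightarrow> (\<integral>\<^sup>+(x::real^'n). 0 \<partial>lebesgue)"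
  proof (rule nn_integral_dominated_convergence[where w="indicator G"])
    show "AE x in lebesgue. ennreal ((norm (complex_of_real (indicator G x) - \<phi> N x))\<^sup>2) \<le> indicator G x" for N
      unfolding val using u_nonneg by (auto simp: indicator_def power_le_one ennreal_le_1)
    show "(\<integral>\<^sup>+ x. indicator G x \<partial>lebesgue) < \<infinity>"
      using lmeasurable_open[OF \<open>bounded G\<close> \<open>open G\<close>] by (simp add: fmeasurable_def)
  qed (use lim in auto)
  then have "\<forall>\<^sub>F N in sequentially. (\<integral>\<^sup>+x. (norm (complex_of_real (indicator G x) - \<phi> N x))\<^sup>2 \<partial>lebesgue) < ennreal e"
    using \<open>0 < e\<close> by (intro order_tendstoD) auto
  then obtain N where "(\<integral>\<^sup>+x. (norm (complex_of_real (indicator G x) - \<phi> N x))\<^sup>2 \<partial>lebesgue) < ennreal e"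
    by (blast dest: eventually_happens'[OF sequentially_bot])
  then show "\<exists>\<phi>\<in>C_c_infinity. (\<forall>x. x \<notin> U \<longrightarrow> \<phi> x = 0) \<and>
      (\<integral>\<^sup>+x. (norm (complex_of_real (indicator G x) - \<phi> x))\<^sup>2 \<partial>lebesgue) < ennreal e"
    using \<phi>0 \<phi>C assms(3) by blast
qed

text \<open>Outer regularity gives an open set of nearly the same measure around \<open>E\<close>;
  it is intersected with \<open>U\<close> so that the approximants still vanish off
  \<open>U\<close>.\<close>

lemma smoothly_approximable_indicator:
  fixes E :: "(real ^ 'n) set"
  assumes "E \<in> sets lebesgue" "E \<subseteq> U" "open U" "bounded U"
  shows "smoothly_approximable U (\<lambda>x. of_real (indicator E x))"
proof (rule smoothly_approximable_limit)
  have [measurable]: "E \<in> sets lebesgue" by fact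
  show "(\<lambda>x. complex_of_real (indicator E x)) \<in> borel_measurable lebesgue" by simp
  fix e :: real assume "0 < e"
  obtain T where T: "open T" "E \<subseteq> T" "(T - E) \<in> lmeasurable" "emeasure lebesgue (T - E) < ennreal e"
    using sets_lebesgue_outer_open[OF assms(1) \<open>0 < e\<close>] .
  have "(\<integral>\<^sup>+x. (norm (complex_of_real (indicator E x) - of_real (indicator (T \<inter> U) x)))\<^sup>2 \<partial>lebesgue)
    \<le> (\<integral>\<^sup>+x. indicator (T - E) x \<partial>lebesgue)"
    using T(2) assms(2) by (intro nn_integral_mono) (auto simp: indicator_def)
  also have "\<dots> = emeasure lebesgue (T - E)"
    using T(3) by (intro nn_integral_indicator) (simp add: fmeasurableD)
  also note T(4)
  finally show "\<exists>g. smoothly_approximable U g \<and>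
      (\<integral>\<^sup>+x. (norm (complex_of_real (indicator E x) - g x))\<^sup>2 \<partial>lebesgue) < ennreal e"
    using T(1) assms by (intro exI[where x="\<lambda>x. of_real (indicator (T \<inter> U) x)"])
      (auto intro!: smoothly_approximable_indicator_open intro: bounded_subset)
qed

text \<open>Simple functions dominated by \<open>2 * norm (f x)\<close> vanish wherever
  \<open>f\<close> does, so their nonzero level sets lie in \<open>U\<close>. Their distance to
  \<open>f\<close> is at most \<open>3 * B\<close>, and \<open>U\<close> has finite measure, which
  gives dominated convergence of the squared errors.\<close>

lemma smoothly_approximable_bounded:
  fixes f :: "real ^ 'n \<Rightarrow> complex"
  assumes f: "f \<in> borel_measurable lebesgue" and B: "\<And>x. norm (f x) \<le> B"
    and U: "\<And>x. x \<notin> U \<Longrightarrow> f x = 0" "open U" "bounded U"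
  shows "smoothly_approximable U f"
proof (rule smoothly_approximable_limit[OF f])
  fix e :: real assume "0 < e"
  have [measurable]: "f \<in> borel_measurable lebesgue" "U \<in> sets lebesgue" using f U(2) by auto
  obtain s where s: "\<And>i. simple_function lebesgue (s i)" "\<And>x. (\<lambda>i. s i x) \<longlonglongrightarrow> f x"
    "\<And>i x. norm (s i x) \<le> 2 * norm (f x)"
    using borel_measurable_implies_sequence_metric[OF f, of 0] by (auto simp: dist_norm)
  have [measurable]: "s i \<in> borel_measurable lebesgue" for i
    using s(1) by (rule borel_measurable_simple_function)
  have sU: "s i x = 0" if "x \<notin> U" for i x using s(3)[of i x] U(1)[OF that] by simp
  have approx: "smoothly_approximable U (s i)" for i
  proof -
    have "s i x = (\<Sum>y\<in>range (s i) - {0}. y * of_real (indicator (s i -` {y}) x))" for x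
    proof -
      have "(\<Sum>y\<in>range (s i) - {0}. y * of_real (indicator (s i -` {y}) x)) = (\<Sum>y\<in>range (s i) - {0}. if y = s i x then y else 0)"
        by (intro sum.cong) (auto simp: indicator_def)
      also have "\<dots> = s i x"
        using s(1)[of i] by (subst sum.delta) (auto simp: simple_function_def)
      finally show ?thesis by simp
    qed
    moreover have "smoothly_approximable U (\<lambda>x. \<Sum>y\<in>range (s i) - {0}. y * of_real (indicator (s i -` {y}) x))"
    proof (intro smoothly_approximable_sum smoothly_approximable_cmult smoothly_approximable_indicator U)
      show "finite (range (s i) - {0})" using s(1)[of i] by (auto simp: simple_function_def)
      show "s i -` {y} \<in> sets lebesgue" if "y \<in> range (s i) - {0}" for y
        using s(1)[of i] that by (auto simp: simple_function_def)
      show "s i -` {y} \<subseteq> U" if "y \<in> range (s i) - {0}" for y using sU that by auto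
    qed
    ultimately show ?thesis by (metis (no_types, lifting) ext)
  qed
  have "(\<lambda>i. \<integral>\<^sup>+x. (norm (f x - s i x))\<^sup>2 \<partial>lebesgue) \<longlonglongrightarrow> (\<integral>\<^sup>+(x::real^'n). 0 \<partial>lebesgue)"
  proof (rule nn_integral_dominated_convergence[where u="\<lambda>i x. ennreal ((norm (f x - s i x))\<^sup>2)" and u'="\<lambda>x. 0" and w="\<lambda>x. ennreal ((3 * B)\<^sup>2) * indicator U x"])
    have "norm (f x - s i x) \<le> 3 * B" for i x
      using norm_triangle_ineq4[of "f x" "s i x"] s(3)[of i x] B[of x] by linarith
    then have "(norm (f x - s i x))\<^sup>2 \<le> (3 * B)\<^sup>2" for i x by (intro power_mono) auto
    then show "AE x in lebesgue. ennreal ((norm (f x - s i x))\<^sup>2) \<le> ennreal ((3 * B)\<^sup>2) * indicator U x" for i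
      using sU U(1) by (intro AE_I2) (auto simp: indicator_def intro!: ennreal_leI)
    show "(\<integral>\<^sup>+ x. ennreal ((3 * B)\<^sup>2) * indicator U x \<partial>lebesgue) < \<infinity>"
      using lmeasurable_open[OF \<open>bounded U\<close> \<open>open U\<close>]
      by (subst nn_integral_cmult_indicator) (auto simp: fmeasurable_def ennreal_mult_less_top)
    show "AE x in lebesgue. (\<lambda>i. ennreal ((norm (f x - s i x))\<^sup>2)) \<longlonglongrightarrow> 0"
    proof (intro AE_I2)
      fix x
      have "(\<lambda>i. (norm (f x - s i x))\<^sup>2) \<longlonglongrightarrow> (norm (f x - f x))\<^sup>2" by (intro tendsto_intros s(2))
      then show "(\<lambda>i. ennreal ((norm (f x - s i x))\<^sup>2)) \<longlonglongrightarrow> 0" by (metis diff_self ennreal_0 norm_zero tendsto_ennrealI zero_power2)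
    qed
  qed auto
  then have "\<forall>\<^sub>F i in sequentially. (\<integral>\<^sup>+x. (norm (f x - s i x))\<^sup>2 \<partial>lebesgue) < ennreal e"
    using \<open>0 < e\<close> by (intro order_tendstoD) auto
  then show "\<exists>g. smoothly_approximable U g \<and> (\<integral>\<^sup>+x. (norm (f x - g x))\<^sup>2 \<partial>lebesgue) < ennreal e"
    using approx by (blast dest: eventually_happens'[OF sequentially_bot])
qed

section \<open>Calderon--Zygmund operators on bounded functions of bounded support\<close>

text \<open>Boundedness and vanishing are required of the representative at every point, so that
  cut-offs, sums and pointwise kernel estimates involve no null sets. Elements of
  \<open>L_infinity_c\<close> are brought into this class at the end by a change on a null
  set.\<close>

definition Bc :: "(real ^ 'n \<Rightarrow> complex) set" where
  "Bc = {f. f \<in> borel_measurable lebesgue \<and> (\<exists>B. \<forall>x. norm (f x) \<le> B) \<and> bounded {x. f x \<noteq> 0}}"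

lemma Bc_measurable: "f \<in> Bc \<Longrightarrow> f \<in> borel_measurable lebesgue"
  by (simp add: Bc_def)

lemma BcE:
  assumes "f \<in> Bc"
  obtains B where "0 \<le> B" "\<And>x. norm (f x) \<le> B"
  using assms unfolding Bc_def by (smt (verit) mem_Collect_eq norm_ge_zero)

lemma Bc_add:
  assumes "f \<in> Bc" "g \<in> Bc"
  shows "(\<lambda>x. f x + g x) \<in> Bc"
proof -
  obtain A B where "\<And>x. norm (f x) \<le> A" "\<And>x. norm (g x) \<le> B"
    using assms by (elim BcE) blast
  then have "norm (f x + g x) \<le> A + B" for x by (meson add_mono norm_triangle_le)
  moreover have "bounded ({x. f x \<noteq> 0} \<union> {x. g x \<noteq> 0})" using assms by (simp add: Bc_def)
  then have "bounded {x. f x + g x \<noteq> 0}" by (rule bounded_subset) auto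
  ultimately show ?thesis using assms by (auto simp: Bc_def)
qed

lemma Bc_mult:
  assumes f: "f \<in> Bc" and g: "g \<in> borel_measurable lebesgue" "\<And>x. norm (g x) \<le> A"
  shows "(\<lambda>x. g x * f x) \<in> Bc"
proof -
  obtain B where B: "\<And>x. norm (f x) \<le> B" "0 \<le> B" using f by (elim BcE) blast
  have "norm (g x * f x) \<le> A * B" for x
    using B(1)[of x] g(2)[of x] B(2) by (simp add: norm_mult mult_mono')
  moreover have "bounded {x. f x \<noteq> 0}" using f by (simp add: Bc_def)
  then have "bounded {x. g x * f x \<noteq> 0}" by (rule bounded_subset) auto
  ultimately show ?thesis using f g(1) by (auto simp: Bc_def)
qed

lemma Bc_cmult: "f \<in> Bc \<Longrightarrow> (\<lambda>x. c * f x) \<in> Bc"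
  by (rule Bc_mult[where A="norm c"]) auto

lemma Bc_diff: "f \<in> Bc \<Longrightarrow> g \<in> Bc \<Longrightarrow> (\<lambda>x. f x - g x) \<in> Bc"
  using Bc_add[of f "\<lambda>x. (-1) * g x"] Bc_cmult[of g "-1"] by simp

lemma Bc_indicator: "f \<in> Bc \<Longrightarrow> E \<in> sets lebesgue \<Longrightarrow> (\<lambda>x. of_real (indicator E x) * f x) \<in> Bc"
  by (rule Bc_mult[where A=1]) (auto simp: indicator_def)

lemma Bc_zero: "(\<lambda>x. 0) \<in> Bc"
  by (auto simp: Bc_def)

lemma Bc_sum: "finite I \<Longrightarrow> (\<And>i. i \<in> I \<Longrightarrow> f i \<in> Bc) \<Longrightarrow> (\<lambda>x. \<Sum>i\<in>I. f i x) \<in> Bc"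
  by (induction I rule: finite_induct) (auto intro: Bc_zero Bc_add)

lemma bounded_support_lmeasurable:
  assumes "bounded S"
  obtains V :: "(real ^ 'n) set" where "V \<in> lmeasurable" "S \<subseteq> V"
  using assms bounded_subset_cball by (metis lmeasurable_cball)

lemma integrable_bounded_support:
  fixes f :: "real ^ 'n \<Rightarrow> 'b::{banach,second_countable_topology}"
  assumes f: "f \<in> borel_measurable lebesgue" "\<And>x. norm (f x) \<le> B" "bounded {x. f x \<noteq> 0}"
  shows "integrable lebesgue f"
proof -
  obtain V where V: "V \<in> lmeasurable" "{x. f x \<noteq> 0} \<subseteq> V"
    using bounded_support_lmeasurable[OF f(3)] by auto
  have "integrable lebesgue (\<lambda>x. B * indicator V x)"
    using V(1) by (intro integrable_mult_right) (simp add: lmeasurable_iff_integrable)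
  then show ?thesis
    by (rule Bochner_Integration.integrable_bound)
      (use f(1,3) V order_trans[OF f(2) abs_ge_self[of B]] in \<open>auto simp: indicator_def\<close>)
qed

lemma Bc_integrable: "f \<in> Bc \<Longrightarrow> integrable lebesgue f"
  by (auto simp: Bc_def intro: integrable_bounded_support)

lemma Bc_L2:
  assumes "f \<in> Bc"
  shows "f \<in> L2"
proof -
  obtain B where B: "\<And>x. norm (f x) \<le> B" "0 \<le> B" using assms by (elim BcE) blast
  have "integrable lebesgue (\<lambda>x. (norm (f x))\<^sup>2)"
    using assms B by (intro integrable_bounded_support[where B="B\<^sup>2"]) (auto simp: Bc_def power_mono)
  then show ?thesis using assms by (simp add: L2_def Bc_def)
qed

lemma C_c_infinity_Bc:
  assumes "f \<in> C_c_infinity"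
  shows "f \<in> Bc"
proof -
  have cont: "continuous_on UNIV f" and comp: "compact (supp f)"
    using assms unfolding C_c_infinity_def by (auto dest: spec[of _ 0])
  have "bounded (f ` supp f)"
    using compact_continuous_image[OF continuous_on_subset[OF cont] comp] compact_imp_bounded by auto
  then obtain B where B: "\<And>x. x \<in> supp f \<Longrightarrow> norm (f x) \<le> B" by (auto simp: bounded_iff)
  have "norm (f x) \<le> max B 0" for x
  proof (cases "x \<in> supp f")
    case False
    then have "f x = 0" using closure_subset[of "{x. f x \<noteq> 0}"] by (auto simp: supp_def)
    then show ?thesis by simp
  qed (use B in force)
  then show ?thesis
    using assms C_c_infinity_measurable[OF assms] by (auto simp: Bc_def C_c_infinity_iff)
qed

text \<open>\<open>T\<close> stands for the extension to \<open>L2\<close>, not for the operator on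
  test functions, and \<open>A\<close> bounds the square of its norm. The joint smoothness condition
  is split by variable: \<open>K_smooth2\<close> is used against mean-zero atoms,
  \<open>K_smooth1\<close> to compare far parts at two points.\<close>

locale cz_operator =
  fixes T :: "(real ^ 'n \<Rightarrow> complex) \<Rightarrow> real ^ 'n \<Rightarrow> complex"
    and K :: "real ^ 'n \<Rightarrow> real ^ 'n \<Rightarrow> complex" and c \<epsilon> A :: real
  assumes linear: "linear_operator_on L2 T" and T_L2: "f \<in> L2 \<Longrightarrow> T f \<in> L2"
    and T_bound: "f \<in> L2 \<Longrightarrow> (\<integral>\<^sup>+x. (norm (T f x))\<^sup>2 \<partial>lebesgue) \<le> ennreal A * (\<integral>\<^sup>+x. (norm (f x))\<^sup>2 \<partial>lebesgue)"
    and A_nonneg: "0 \<le> A" and c_nonneg: "0 \<le> c" and eps_pos: "0 < \<epsilon>"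
    and K_size: "x \<noteq> y \<Longrightarrow> norm (K x y) \<le> c / norm (x - y) ^ CARD('n)"
    and K_smooth1: "2 * norm (x - z) < norm (x - y) \<Longrightarrow>
      norm (K x y - K z y) \<le> c * (norm (x - z) powr \<epsilon> / norm (x - y) powr (real CARD('n) + \<epsilon>))"
    and K_smooth2: "2 * norm (x - z) < norm (x - y) \<Longrightarrow>
      norm (K y x - K y z) \<le> c * (norm (x - z) powr \<epsilon> / norm (x - y) powr (real CARD('n) + \<epsilon>))"
    and T_kernel_smooth: "f \<in> C_c_infinity \<Longrightarrow>
      AE x in lebesgue. x \<notin> supp f \<longrightarrow> T f x = (LINT y|lebesgue. K x y * f y)"
begin

lemma T_measurable: "f \<in> Bc \<Longrightarrow> T f \<in> borel_measurable lebesgue"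
  using T_L2[OF Bc_L2] by (simp add: L2_def)

lemma T_add: "f \<in> Bc \<Longrightarrow> g \<in> Bc \<Longrightarrow> AE x in lebesgue. T (\<lambda>x. f x + g x) x = T f x + T g x"
  using linear[unfolded linear_operator_on_def, rule_format, OF Bc_L2 Bc_L2, of f g 1 1] by simp

lemma T_diff: "f \<in> Bc \<Longrightarrow> g \<in> Bc \<Longrightarrow> AE x in lebesgue. T (\<lambda>x. f x - g x) x = T f x - T g x"
  using linear[unfolded linear_operator_on_def, rule_format, OF Bc_L2 Bc_L2, of f g 1 "-1"] by simp

lemma T_zero: "AE x in lebesgue. T (\<lambda>x. 0) x = 0"
  using linear[unfolded linear_operator_on_def, rule_format, OF Bc_L2 Bc_L2, OF Bc_zero Bc_zero, of 0 0] by simp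

lemma T_sum:
  assumes "finite I" "\<And>i. i \<in> I \<Longrightarrow> f i \<in> Bc"
  shows "AE x in lebesgue. T (\<lambda>x. \<Sum>i\<in>I. f i x) x = (\<Sum>i\<in>I. T (f i) x)"
  using assms
proof (induction I rule: finite_induct)
  case empty
  then show ?case using T_zero by simp
next
  case (insert i I)
  then have "AE x in lebesgue. T (\<lambda>x. \<Sum>i\<in>I. f i x) x = (\<Sum>i\<in>I. T (f i) x)" by simp
  moreover have "AE x in lebesgue. T (\<lambda>x. f i x + (\<Sum>i\<in>I. f i x)) x = T (f i) x + T (\<lambda>x. \<Sum>i\<in>I. f i x) x"
    using insert by (intro T_add Bc_sum) auto
  ultimately show ?case unfolding sum.insert[OF insert.hyps] by eventually_elim simp
qed

text \<open>An operator on representatives does not respect null sets by definition. Here it does,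
  because linearity and the \<open>L^2\<close> bound send \<open>f - g\<close>, a function of norm
  zero, to a function of norm zero.\<close>

lemma T_cong_AE:
  assumes f: "f \<in> L2" "g \<in> L2" and fg: "AE x in lebesgue. f x = g x"
  shows "AE x in lebesgue. T f x = T g x"
proof -
  let ?h = "\<lambda>x. 1 * f x + (-1) * g x"
  have "AE x in lebesgue. (norm (?h x))\<^sup>2 = 0" using fg by eventually_elim simp
  moreover have "(\<lambda>x. (norm (?h x))\<^sup>2) \<in> borel_measurable lebesgue"
    using f by (auto simp: L2_def)
  ultimately have "integrable lebesgue (\<lambda>x. (norm (?h x))\<^sup>2) \<longleftrightarrow> integrable lebesgue (\<lambda>x::real^'n. 0::real)"
    by (intro integrable_cong_AE) auto
  moreover have "?h \<in> borel_measurable lebesgue"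
    using f by (auto simp: L2_def)
  ultimately have "?h \<in> L2" by (simp add: L2_def)
  have "(\<integral>\<^sup>+x. (norm (?h x))\<^sup>2 \<partial>lebesgue) = (\<integral>\<^sup>+(x::real^'n). 0 \<partial>lebesgue)"
    using fg by (intro nn_integral_cong_AE) auto
  then have "(\<integral>\<^sup>+x. (norm (T ?h x))\<^sup>2 \<partial>lebesgue) = 0"
    using T_bound[OF \<open>?h \<in> L2\<close>] by simp
  then have "AE x in lebesgue. T ?h x = 0"
    using T_L2[OF \<open>?h \<in> L2\<close>] by (subst (asm) nn_integral_0_iff_AE) (auto simp: L2_def)
  moreover have "AE x in lebesgue. T ?h x = 1 * T f x + (-1) * T g x"
    using linear f unfolding linear_operator_on_def by blast
  ultimately show ?thesis by eventually_elim auto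
qed

text \<open>Regularity in the second variable forces continuity away from the pole. Its purpose is
  the measurability of \<open>K x\<close> for each individual \<open>x\<close>, which the kernel
  integrals at a fixed point require.\<close>

lemma K_continuous: "continuous_on (- {x}) (K x)"
proof (intro continuous_at_imp_continuous_on ballI)
  fix y assume "y \<in> - {x}"
  then have d: "0 < norm (y - x)" by auto
  have "((\<lambda>z. c * (norm (y - z) powr \<epsilon> / norm (y - x) powr (real CARD('n) + \<epsilon>))) \<longlongrightarrow>
      c * (norm (y - y) powr \<epsilon> / norm (y - x) powr (real CARD('n) + \<epsilon>))) (at y)"
    using eps_pos d by (intro tendsto_intros) auto
  then have lim: "((\<lambda>z. c * (norm (y - z) powr \<epsilon> / norm (y - x) powr (real CARD('n) + \<epsilon>))) \<longlongrightarrow> 0) (at y)"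
    by simp
  have "\<forall>\<^sub>F z in at y. norm (K x z - K x y) \<le> c * (norm (y - z) powr \<epsilon> / norm (y - x) powr (real CARD('n) + \<epsilon>))"
    unfolding eventually_at
    by (rule exI[where x="norm (y - x) / 2"])
      (use d K_smooth2[of y _ x] in \<open>auto simp: dist_norm norm_minus_commute\<close>)
  then have "((\<lambda>z. K x z - K x y) \<longlongrightarrow> 0) (at y)"
    by (rule Lim_null_comparison[OF _ lim])
  then show "isCont (K x) y"
    unfolding isCont_def using LIM_zero_iff by blast
qed

lemma K_away_bound:
  assumes "0 < r" "r \<le> dist x y"
  shows "norm (K x y) \<le> c / r ^ CARD('n)"
proof -
  have "norm (K x y) \<le> c / norm (x - y) ^ CARD('n)" using assms by (intro K_size) auto
  also have "\<dots> \<le> c / r ^ CARD('n)"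
    using assms c_nonneg by (intro divide_left_mono power_mono mult_pos_pos zero_less_power) (auto simp: dist_norm)
  finally show ?thesis .
qed

lemma K_integrable:
  assumes f: "f \<in> Bc" and r: "0 < r" "\<And>y. f y \<noteq> 0 \<Longrightarrow> r \<le> dist x y"
  shows "integrable lebesgue (\<lambda>y. K x y * f y)"
proof -
  obtain B where B: "\<And>x. norm (f x) \<le> B" "0 \<le> B" using f by (elim BcE) blast
  have "(\<lambda>y. indicator (- {x}) y *\<^sub>R K x y) \<in> borel_measurable borel"
    by (intro borel_measurable_continuous_on_indicator K_continuous) auto
  then have "(\<lambda>y. indicator (- {x}) y *\<^sub>R K x y) \<in> borel_measurable lebesgue"
    by (intro measurable_completion) simp
  moreover have "f \<in> borel_measurable lebesgue" using f by (rule Bc_measurable)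
  ultimately have "(\<lambda>y. (indicator (- {x}) y *\<^sub>R K x y) * f y) \<in> borel_measurable lebesgue" by measurable
  moreover have "(\<lambda>y. (indicator (- {x}) y *\<^sub>R K x y) * f y) = (\<lambda>y. K x y * f y)"
    using r by (force simp: indicator_def)
  ultimately have "(\<lambda>y. K x y * f y) \<in> borel_measurable lebesgue" by simp
  then show ?thesis
  proof (rule integrable_bounded_support[where B="(c / r ^ CARD('n)) * B"])
    have "bounded {x. f x \<noteq> 0}" using f by (simp add: Bc_def)
    then show "bounded {y. K x y * f y \<noteq> 0}" by (rule bounded_subset) auto
    show "norm (K x y * f y) \<le> (c / r ^ CARD('n)) * B" for y
    proof (cases "f y = 0")
      case False
      show ?thesis unfolding norm_mult
        using K_away_bound[OF r(1) r(2)[OF False]] B c_nonneg r(1) by (intro mult_mono) auto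
    qed (use B c_nonneg r(1) in simp)
  qed
qed

text \<open>Fix \<open>d\<close> and consider points at distance at least \<open>d\<close> from
  \<open>S\<close>; for these the kernel is bounded on the \<open>d/2\<close>-neighbourhood
  \<open>U\<close> of \<open>S\<close>. Test functions vanishing off \<open>U\<close> and tending to
  \<open>f\<close> in \<open>L^2\<close> make both sides converge: the operator side almost
  everywhere, the kernel side at every such point. Countably many values of \<open>d\<close> exhaust
  the complement of \<open>S\<close>.\<close>

lemma kernel_representation:
  assumes f: "f \<in> Bc" and S: "compact S" "\<And>x. x \<notin> S \<Longrightarrow> f x = 0"
  shows "AE x in lebesgue. x \<notin> S \<longrightarrow> T f x = (LINT y|lebesgue. K x y * f y)"
proof -
  have far: "AE x in lebesgue. (\<forall>y\<in>S. d \<le> dist x y) \<longrightarrow> T f x = (LINT y|lebesgue. K x y * f y)"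
    if d: "0 < d" for d
  proof -
    define U where "U = (\<Union>y\<in>S. ball y (d/2))"
    have U: "open U" "S \<subseteq> U" unfolding U_def using d by auto
    have bU: "bounded U"
    proof -
      obtain R where R: "\<And>y. y \<in> S \<Longrightarrow> norm y \<le> R"
        using compact_imp_bounded[OF S(1)] by (auto simp: bounded_iff)
      show ?thesis
        unfolding bounded_iff
      proof (intro exI[where x="R + d/2"] ballI)
        fix x assume "x \<in> U"
        then obtain y where y: "y \<in> S" "dist y x < d/2" unfolding U_def UN_iff mem_ball by blast
        then show "norm x \<le> R + d/2"
          using R[OF y(1)] norm_triangle_ineq2[of x y] by (simp add: dist_norm norm_minus_commute)
      qed
    qed
    obtain B where B: "\<And>x. norm (f x) \<le> B" "0 \<le> B" using f by (elim BcE) blast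
    have "smoothly_approximable U f"
      using f B(1) U bU S(2) by (intro smoothly_approximable_bounded) (auto simp: Bc_measurable)
    \<comment> \<open>The squared errors \<open>(1/4)^k\<close> are summable, so
      \<open>T (h k)\<close> tends to 0 almost everywhere along the whole sequence, without passing
      to a subsequence.\<close>
    then have "\<exists>\<phi>\<in>C_c_infinity. (\<forall>x. x \<notin> U \<longrightarrow> \<phi> x = 0) \<and> (\<integral>\<^sup>+x. (norm (f x - \<phi> x))\<^sup>2 \<partial>lebesgue) < ennreal ((1/4)^k)" for k
      unfolding smoothly_approximable_def by simp
    then obtain \<phi> where \<phi>: "\<And>k. \<phi> k \<in> C_c_infinity" "\<And>k x. x \<notin> U \<Longrightarrow> \<phi> k x = 0"
      "\<And>k. (\<integral>\<^sup>+x. (norm (f x - \<phi> k x))\<^sup>2 \<partial>lebesgue) < ennreal ((1/4)^k)" by metis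
    note \<phi>Bc = C_c_infinity_Bc[OF \<phi>(1)]
    define h where "h = (\<lambda>k x. f x - \<phi> k x)"
    have h: "h k \<in> Bc" for k unfolding h_def by (intro Bc_diff f \<phi>Bc)
    note [measurable] = Bc_measurable[OF h] T_measurable[OF h]
    have hU: "h k x = 0" if "x \<notin> U" for k x
      using that \<phi>(2)[of x k] S(2)[of x] U(2) by (auto simp: h_def)
    have hint: "(\<integral>\<^sup>+x. (norm (h k x))\<^sup>2 \<partial>lebesgue) \<le> ennreal ((1/4)^k)" for k
      using \<phi>(3)[of k] by (simp add: h_def)
    have "(\<integral>\<^sup>+x. (\<Sum>k. ennreal ((norm (T (h k) x))\<^sup>2)) \<partial>lebesgue) = (\<Sum>k. \<integral>\<^sup>+x. (norm (T (h k) x))\<^sup>2 \<partial>lebesgue)"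
      by (intro nn_integral_suminf) auto
    also have "\<dots> \<le> (\<Sum>k. ennreal (A * (1/4)^k))"
    proof (intro suminf_le allI)
      show "(\<integral>\<^sup>+x. (norm (T (h k) x))\<^sup>2 \<partial>lebesgue) \<le> ennreal (A * (1/4)^k)" for k
        using T_bound[OF Bc_L2[OF h], of k] mult_left_mono[OF hint[of k], of "ennreal A"] A_nonneg
        by (simp add: ennreal_mult')
    qed auto
    also have "\<dots> < \<infinity>"
      using A_nonneg by (subst suminf_ennreal2) (auto intro!: summable_mult summable_geometric)
    finally have ae1: "AE x in lebesgue. (\<Sum>k. ennreal ((norm (T (h k) x))\<^sup>2)) \<noteq> \<infinity>"
      by (intro nn_integral_noteq_infinite) auto
    have ae2: "AE x in lebesgue. \<forall>k. x \<notin> supp (\<phi> k) \<longrightarrow> T (\<phi> k) x = (LINT y|lebesgue. K x y * \<phi> k y)"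
      unfolding AE_all_countable by (rule allI, rule T_kernel_smooth, rule \<phi>(1))
    have ae3: "AE x in lebesgue. \<forall>k. T (h k) x = T f x - T (\<phi> k) x"
      unfolding AE_all_countable h_def by (rule allI, rule T_diff, rule f, rule \<phi>Bc)
    show ?thesis
    proof (rule eventually_mono[OF eventually_conj[OF ae1 eventually_conj[OF ae2 ae3]]], elim conjE)
      fix x assume x: "(\<Sum>k. ennreal ((norm (T (h k) x))\<^sup>2)) \<noteq> \<infinity>"
        "\<forall>k. x \<notin> supp (\<phi> k) \<longrightarrow> T (\<phi> k) x = (LINT y|lebesgue. K x y * \<phi> k y)"
        "\<forall>k. T (h k) x = T f x - T (\<phi> k) x"
      show "(\<forall>y\<in>S. d \<le> dist x y) \<longrightarrow> T f x = (LINT y|lebesgue. K x y * f y)"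
      proof
        assume far: "\<forall>y\<in>S. d \<le> dist x y"
        have farU: "d/2 \<le> dist x y" if yU: "y \<in> U" for y
        proof -
          obtain z where z: "z \<in> S" "dist z y < d/2" using yU unfolding U_def UN_iff mem_ball by blast
          then have "d \<le> dist x z" using far by blast
          then show ?thesis using z(2) dist_triangle[of x z y] by (simp add: dist_commute)
        qed
        have nsupp: "x \<notin> supp (\<phi> k)" for k
        proof
          assume "x \<in> supp (\<phi> k)"
          then have "\<exists>y\<in>{x. \<phi> k x \<noteq> 0}. dist y x < d/2"
            unfolding supp_def closure_approachable using half_gt_zero[OF d] by blast
          then obtain y where y: "\<phi> k y \<noteq> 0" "dist y x < d/2" by blast
          then have "y \<in> U" using \<phi>(2) by blast
          then show False using farU[of y] y(2) by (simp add: dist_commute)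
        qed
        have int: "integrable lebesgue (\<lambda>y. K x y * g y)" if "g \<in> Bc" "\<And>y. y \<notin> U \<Longrightarrow> g y = 0" for g
          using that farU d by (intro K_integrable[where r="d/2"]) auto
        define C where "C = c / (d/2) ^ CARD('n)"
        define m where "m = measure lebesgue U"
        have C: "0 \<le> C" unfolding C_def using c_nonneg d by simp
        have Uf: "U \<in> lmeasurable" using U(1) bU lmeasurable_open by blast
        have close: "norm ((LINT y|lebesgue. K x y * f y) - (LINT y|lebesgue. K x y * \<phi> k y)) \<le> C * ((1/2)^k * (m + 1))" for k
        proof -
          have L2h: "integrable lebesgue (\<lambda>y. (norm (h k y))\<^sup>2)" using Bc_L2[OF h, of k] by (simp add: L2_def)
          have "ennreal (LINT y|lebesgue. (norm (h k y))\<^sup>2) \<le> ennreal ((1/4)^k)"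
            using hint[of k] by (subst nn_integral_eq_integral[symmetric, OF L2h]) auto
          then have L2: "(LINT y|lebesgue. (norm (h k y))\<^sup>2) \<le> (1/4)^k"
            by (subst (asm) ennreal_le_iff) auto
          \<comment> \<open>This is \<open>s \<le> 1 + s^2\<close> for
            \<open>s = 2^k * norm (h k y)\<close>. It plays the role of the Cauchy-Schwarz
            inequality: the squared \<open>L^2\<close> error \<open>(1/4)^k\<close> becomes an
            \<open>L^1\<close> error of order \<open>(1/2)^k\<close>.\<close>
          have pt: "norm (h k y) \<le> (1/2)^k * indicator U y + 2^k * (norm (h k y))\<^sup>2" for y
          proof (cases "y \<in> U")
            case True
            define s where "s = (2::real)^k * norm (h k y)"
            have "s \<le> 1 + s\<^sup>2"
              using zero_le_power2[of "s - 1/2"] by (simp add: power2_eq_square algebra_simps)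
            then have "(1/2)^k * s \<le> (1/2)^k * (1 + s\<^sup>2)" by (intro mult_left_mono) auto
            moreover have "(1/2::real)^k * 2^k = 1" by (simp add: power_mult_distrib[symmetric])
            ultimately show ?thesis using True
              unfolding s_def by (simp add: algebra_simps power2_eq_square)
          qed (use hU in simp)
          have "(LINT y|lebesgue. K x y * f y) - (LINT y|lebesgue. K x y * \<phi> k y) = (LINT y|lebesgue. K x y * h k y)"
            using int[OF f] int[OF \<phi>Bc[of k]] S(2) U(2) \<phi>(2)
            by (subst Bochner_Integration.integral_diff[symmetric]) (auto simp: h_def right_diff_distrib)
          also have "norm \<dots> \<le> (LINT y|lebesgue. norm (K x y * h k y))"
            by (rule integral_norm_bound)
          also have "\<dots> \<le> (LINT y|lebesgue. C * ((1/2)^k * indicator U y + 2^k * (norm (h k y))\<^sup>2))"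
          proof (rule integral_mono)
            show "integrable lebesgue (\<lambda>y. norm (K x y * h k y))"
              using int[OF h hU] by (rule integrable_norm)
            show "integrable lebesgue (\<lambda>y. C * ((1/2)^k * indicator U y + 2^k * (norm (h k y))\<^sup>2))"
              using L2h Uf by (intro integrable_mult_right Bochner_Integration.integrable_add) (auto simp: lmeasurable_iff_integrable)
            show "norm (K x y * h k y) \<le> C * ((1/2)^k * indicator U y + 2^k * (norm (h k y))\<^sup>2)" for y
            proof (cases "y \<in> U")
              case True
              have "norm (K x y) \<le> C" unfolding C_def using farU[OF True] d by (intro K_away_bound) auto
              then show ?thesis unfolding norm_mult using pt C by (intro mult_mono) auto
            qed (use hU C in simp)
          qed
          also have "\<dots> = C * ((1/2)^k * m + 2^k * (LINT y|lebesgue. (norm (h k y))\<^sup>2))"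
          proof -
            have Ui: "integrable lebesgue (\<lambda>y. indicator U y :: real)" using Uf lmeasurable_iff_integrable by blast
            have "(LINT y|lebesgue. (1/2)^k * indicator U y + 2^k * (norm (h k y))\<^sup>2)
              = (LINT y|lebesgue. (1/2)^k * indicator U y) + (LINT y|lebesgue. 2^k * (norm (h k y))\<^sup>2)"
              by (intro Bochner_Integration.integral_add integrable_mult_right Ui L2h)
            then show ?thesis by (simp add: m_def)
          qed
          also have "\<dots> \<le> C * ((1/2)^k * m + 2^k * (1/4)^k)"
            using L2 C by (intro mult_left_mono add_left_mono) auto
          also have "2^k * (1/4)^k = ((1/2)^k :: real)" by (simp add: power_mult_distrib[symmetric])
          finally show ?thesis by (simp add: algebra_simps)
        qed
        have "(\<lambda>k. C * ((1/2)^k * (m + 1))) \<longlonglongrightarrow> C * (0 * (m + 1))"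
          by (intro tendsto_intros LIMSEQ_realpow_zero) auto
        then have lim0: "(\<lambda>k. C * ((1/2)^k * (m + 1))) \<longlonglongrightarrow> 0" by simp
        have "(\<lambda>k. (LINT y|lebesgue. K x y * f y) - (LINT y|lebesgue. K x y * \<phi> k y)) \<longlonglongrightarrow> 0"
          by (rule Lim_null_comparison[OF always_eventually[OF allI[OF close]] lim0])
        moreover have "(\<lambda>k. T f x - (LINT y|lebesgue. K x y * \<phi> k y)) \<longlonglongrightarrow> 0"
        proof -
          have "summable (\<lambda>k. (norm (T (h k) x))\<^sup>2)"
            using x(1) by (intro summable_suminf_not_top) auto
          then have "(\<lambda>k. (norm (T (h k) x))\<^sup>2) \<longlonglongrightarrow> 0" by (rule summable_LIMSEQ_zero)
          from tendsto_real_sqrt[OF this] have "(\<lambda>k. norm (T (h k) x)) \<longlonglongrightarrow> 0" by simp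
          then have "(\<lambda>k. T (h k) x) \<longlonglongrightarrow> 0" by (rule tendsto_norm_zero_cancel)
          then show ?thesis using x(2,3) nsupp by simp
        qed
        ultimately have "(\<lambda>k. (T f x - (LINT y|lebesgue. K x y * \<phi> k y)) - ((LINT y|lebesgue. K x y * f y) - (LINT y|lebesgue. K x y * \<phi> k y))) \<longlonglongrightarrow> 0 - 0"
          by (rule tendsto_diff[rotated])
        then have "(\<lambda>k::nat. T f x - (LINT y|lebesgue. K x y * f y)) \<longlonglongrightarrow> 0" by simp
        then show "T f x = (LINT y|lebesgue. K x y * f y)" by (simp add: LIMSEQ_const_iff)
      qed
    qed
  qed
  have ae: "AE x in lebesgue. \<forall>k::nat. (\<forall>y\<in>S. inverse (real (Suc k)) \<le> dist x y) \<longrightarrow> T f x = (LINT y|lebesgue. K x y * f y)"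
    unfolding AE_all_countable by (intro allI far) simp
  show ?thesis
  proof (rule eventually_mono[OF ae])
    fix x assume x: "\<forall>k::nat. (\<forall>y\<in>S. inverse (real (Suc k)) \<le> dist x y) \<longrightarrow> T f x = (LINT y|lebesgue. K x y * f y)"
    show "x \<notin> S \<longrightarrow> T f x = (LINT y|lebesgue. K x y * f y)"
    proof
      assume "x \<notin> S"
      then obtain d where d: "0 < d" "\<And>y. y \<in> S \<Longrightarrow> d \<le> dist x y"
        using separate_point_closed[OF compact_imp_closed[OF S(1)]] by blast
      obtain k where "inverse (real (Suc k)) < d" using reals_Archimedean[OF d(1)] by blast
      then show "T f x = (LINT y|lebesgue. K x y * f y)" using x d(2) by (meson less_imp_le order_trans)
    qed
  qed
qed

end

lemma cz_operator_L2_extension: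
  assumes "calderon_zygmund T" "L2_extension T T'"
  shows "\<exists>K c \<epsilon> A. cz_operator T' K c \<epsilon> A"
proof -
  obtain K where K: "CZ_kernel K" "\<forall>f\<in>C_c_infinity. AE x in lebesgue.
        x \<notin> supp f \<longrightarrow> T f x = (LINT y|lebesgue. K x y * f y)"
    using assms(1) unfolding calderon_zygmund_def by blast
  obtain c \<epsilon> where c: "\<And>x y. x \<noteq> y \<Longrightarrow> norm (K x y) \<le> c / norm (x - y) ^ CARD('a)" and "\<epsilon> > 0"
    and sm: "\<And>x y z. 2 * norm (x - z) < norm (x - y) \<Longrightarrow>
          norm (K x y - K z y) + norm (K y x - K y z)
            \<le> c * (norm (x - z) powr \<epsilon> / norm (x - y) powr (real CARD('a) + \<epsilon>))"
    using K(1) unfolding CZ_kernel_def by blast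
  \<comment> \<open>The kernel conditions do not state the sign of \<open>c\<close>; the size bound
    at a unit vector and the origin supplies it.\<close>
  have "0 \<le> c"
  proof -
    define e :: "real ^ 'a" where "e = axis undefined 1"
    have "norm e = 1" by (simp add: e_def norm_axis_1)
    then have "norm (K e 0) \<le> c" using c[of e 0] by force
    then show ?thesis by (meson norm_ge_zero order_trans)
  qed
  obtain C where C: "\<And>f. f \<in> L2 \<Longrightarrow> L2_norm (T' f) \<le> C * L2_norm f" and
    T': "linear_operator_on L2 T'" "\<And>f. f \<in> L2 \<Longrightarrow> T' f \<in> L2"
    "\<And>f. f \<in> C_c_infinity \<Longrightarrow> AE x in lebesgue. T' f x = T f x"
    using assms(2) unfolding L2_extension_def L2_bounded_operator_def by blast
  have sq: "ennreal ((L2_norm f)\<^sup>2) = (\<integral>\<^sup>+x. (norm (f x))\<^sup>2 \<partial>lebesgue)" if "f \<in> L2" for f :: "real ^ 'a \<Rightarrow> complex"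
    using that unfolding L2_norm_def L2_def
    by (subst nn_integral_eq_integral) (auto simp: integral_nonneg_AE)
  have "cz_operator T' K c \<epsilon> (C\<^sup>2)"
  proof
    show "(\<integral>\<^sup>+x. (norm (T' f x))\<^sup>2 \<partial>lebesgue) \<le> ennreal (C\<^sup>2) * (\<integral>\<^sup>+x. (norm (f x))\<^sup>2 \<partial>lebesgue)" if "f \<in> L2" for f
    proof -
      have "0 \<le> L2_norm (T' f)" unfolding L2_norm_def by (simp add: integral_nonneg_AE)
      then have "(L2_norm (T' f))\<^sup>2 \<le> (C * L2_norm f)\<^sup>2" using C[OF that] by (intro power_mono) auto
      then show ?thesis
        unfolding sq[OF that, symmetric] sq[OF T'(2)[OF that], symmetric]
        by (simp add: ennreal_mult'[symmetric] power_mult_distrib ennreal_leI)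
    qed
    show "AE x in lebesgue. x \<notin> supp f \<longrightarrow> T' f x = (LINT y|lebesgue. K x y * f y)" if "f \<in> C_c_infinity" for f
      using T'(3)[OF that] K(2)[rule_format, OF that] by eventually_elim auto
    show "norm (K x y - K z y) \<le> c * (norm (x - z) powr \<epsilon> / norm (x - y) powr (real CARD('a) + \<epsilon>))"
      if "2 * norm (x - z) < norm (x - y)" for x y z
      using sm[OF that] norm_ge_zero[of "K y x - K y z"] by linarith
    show "norm (K y x - K y z) \<le> c * (norm (x - z) powr \<epsilon> / norm (x - y) powr (real CARD('a) + \<epsilon>))"
      if "2 * norm (x - z) < norm (x - y)" for x y z
      using sm[OF that] norm_ge_zero[of "K x y - K z y"] by linarith
  qed (use \<open>\<epsilon> > 0\<close> \<open>0 \<le> c\<close> c T' in auto)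
  then show ?thesis by blast
qed

section \<open>Finite sequence norms\<close>

text \<open>Restriction to finitely many entries keeps the norm a real number; the infinite norm is
  recovered as the supremum over \<open>N\<close>.\<close>

definition lqn :: "real \<Rightarrow> nat \<Rightarrow> (nat \<Rightarrow> complex) \<Rightarrow> real" where
  "lqn q N a = (\<Sum>j<N. norm (a j) powr q) powr (1 / q)"

lemma lqn_nonneg [simp]: "0 \<le> lqn q N a"
  by (simp add: lqn_def)

lemma lqn_powr:
  assumes "1 < q"
  shows "lqn q N a powr q = (\<Sum>j<N. norm (a j) powr q)"
  using assms by (simp add: lqn_def powr_powr sum_nonneg)

lemma lqn_cong: "(\<And>j. j < N \<Longrightarrow> norm (a j) = norm (b j)) \<Longrightarrow> lqn q N a = lqn q N b"
  by (simp add: lqn_def cong: sum.cong_simp)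

lemma lqn_mono:
  assumes "1 < q" "\<And>j. j < N \<Longrightarrow> norm (a j) \<le> norm (b j)"
  shows "lqn q N a \<le> lqn q N b"
  unfolding lqn_def using assms by (intro powr_mono2 sum_mono sum_nonneg) auto

lemma lqn_mono_N:
  assumes "1 < q" "N \<le> M"
  shows "lqn q N a \<le> lqn q M a"
  unfolding lqn_def using assms by (intro powr_mono2 sum_mono2 sum_nonneg) auto

lemma lqn_component:
  assumes "1 < q" "j < N"
  shows "norm (a j) \<le> lqn q N a"
proof -
  have "norm (a j) powr q \<le> (\<Sum>j<N. norm (a j) powr q)"
    using assms by (intro member_le_sum) auto
  then have "(norm (a j) powr q) powr (1 / q) \<le> lqn q N a"
    unfolding lqn_def using assms by (intro powr_mono2) auto
  then show ?thesis using assms by (simp add: powr_powr)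
qed

lemma lqn_scale:
  assumes "1 < q"
  shows "lqn q N (\<lambda>j. c * a j) = norm c * lqn q N a"
  using assms
  by (simp add: lqn_def norm_mult powr_mult sum_distrib_left[symmetric] powr_powr sum_nonneg)

lemma lqn_zero: "1 < q \<Longrightarrow> (\<And>j. j < N \<Longrightarrow> a j = 0) \<Longrightarrow> lqn q N a = 0"
  by (simp add: lqn_def)

lemma lqn_one: "1 < q \<Longrightarrow> lqn q (Suc 0) a = norm (a 0)"
  by (simp add: lqn_def powr_powr)

text \<open>The \<open>\<beta>\<close> below is the norming functional of \<open>a\<close>.\<close>

lemma lqn_norming:
  assumes q: "1 < q"
  obtains \<beta> where "(\<Sum>j<N. a j * \<beta> j) = of_real (lqn q N a)"
    "\<And>v. norm (\<Sum>j<N. v j * \<beta> j) \<le> lqn q N v"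
proof (cases "lqn q N a = 0")
  case True
  show ?thesis by (rule that[of "\<lambda>_. 0"]) (simp_all add: True)
next
  case False
  define s where "s = lqn q N a"
  have s: "0 < s" using False lqn_nonneg[of q N a] unfolding s_def by linarith
  \<comment> \<open>The conjugate phases make each product \<open>a j * \<beta> j\<close>
    nonnegative. The exponent \<open>q - 1\<close> is the one for which Hoelder's inequality is an
    equality at \<open>a\<close>, and division by \<open>s\<close> normalizes the functional to norm
    at most 1.\<close>
  define \<beta> where "\<beta> = (\<lambda>j. cnj (sgn (a j)) * of_real ((norm (a j) / s) powr (q - 1)))"
  have nb: "norm (\<beta> j) \<le> (norm (a j) / s) powr (q - 1)" for j
    by (simp add: \<beta>_def norm_mult norm_sgn)
  have term_eq: "a j * \<beta> j = of_real (norm (a j) powr q / s powr (q - 1))" for j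
  proof (cases "a j = 0")
    case False
    have "a j * cnj (sgn (a j)) = of_real (norm (a j))"
      using False complex_norm_square[of "a j"]
      by (simp add: sgn_div_norm scaleR_conv_of_real divide_simps power2_eq_square)
    moreover have "norm (a j) * (norm (a j) / s) powr (q - 1) = norm (a j) powr q / s powr (q - 1)"
      using False s by (simp add: powr_divide powr_mult_base)
    ultimately show ?thesis
      unfolding \<beta>_def by (metis (no_types, lifting) mult.assoc of_real_mult)
  qed (use q in \<open>simp add: \<beta>_def\<close>)
  show ?thesis
  proof (rule that[of \<beta>])
    have "(\<Sum>j<N. norm (a j) powr q / s powr (q - 1)) = s powr q / s powr (q - 1)"
      unfolding s_def lqn_powr[OF q] by (simp add: sum_divide_distrib)
    also have "\<dots> = s" using s by (simp add: powr_diff[symmetric])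
    finally show "(\<Sum>j<N. a j * \<beta> j) = of_real (lqn q N a)"
      unfolding term_eq s_def by (metis of_real_sum)
    fix v
    show "norm (\<Sum>j<N. v j * \<beta> j) \<le> lqn q N v"
    proof (cases "lqn q N v = 0")
      case True
      have "v j = 0" if "j < N" for j using lqn_component[OF q that, of v] True by simp
      then show ?thesis by (simp add: True)
    next
      case False
      define t where "t = lqn q N v"
      have t: "0 < t" using False lqn_nonneg[of q N v] unfolding t_def by linarith
      define p where "p = q / (q - 1)"
      have p: "1 < p" "1 / q + 1 / p = 1" "(q - 1) * p = q" using q by (auto simp: p_def field_simps)
      \<comment> \<open>Young's inequality for the normalized entries: summed over \<open>j\<close>,
        the two terms contribute \<open>1 / q\<close> and \<open>1 / p\<close>, hence 1 in
        total.\<close>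
      have young: "(norm (v j) / t) * (norm (a j) / s) powr (q - 1)
          \<le> norm (v j) powr q / t powr q / q + norm (a j) powr q / s powr q / p" for j
        using Youngs_inequality[OF q p(1,2), of "norm (v j) / t" "(norm (a j) / s) powr (q - 1)"] s t p(3)
        by (simp add: powr_powr powr_divide)
      have "norm (\<Sum>j<N. v j * \<beta> j) \<le> (\<Sum>j<N. norm (v j) * (norm (a j) / s) powr (q - 1))"
        by (intro sum_norm_le) (auto simp: norm_mult intro: mult_left_mono nb)
      also have "\<dots> = t * (\<Sum>j<N. (norm (v j) / t) * (norm (a j) / s) powr (q - 1))"
        using t by (simp add: sum_distrib_left)
      also have "\<dots> \<le> t * (\<Sum>j<N. norm (v j) powr q / t powr q / q + norm (a j) powr q / s powr q / p)"
        using t by (intro mult_left_mono sum_mono young) auto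
      also have "(\<Sum>j<N. norm (v j) powr q / t powr q / q + norm (a j) powr q / s powr q / p)
          = (\<Sum>j<N. norm (v j) powr q) / t powr q / q + (\<Sum>j<N. norm (a j) powr q) / s powr q / p"
        by (simp add: sum.distrib sum_divide_distrib)
      also have "\<dots> = 1"
        unfolding lqn_powr[OF q, symmetric] s_def[symmetric] t_def[symmetric] using s t p by simp
      finally show ?thesis by (simp add: t_def)
    qed
  qed
qed

text \<open>Minkowski's inequality by duality: the functional norming the sum is linear, and it is
  bounded by the norm on each summand.\<close>

lemma lqn_triangle:
  assumes q: "1 < q"
  shows "lqn q N (\<lambda>j. a j + b j) \<le> lqn q N a + lqn q N b"
proof -
  obtain \<beta> where \<beta>: "(\<Sum>j<N. (a j + b j) * \<beta> j) = of_real (lqn q N (\<lambda>j. a j + b j))"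
    "\<And>v. norm (\<Sum>j<N. v j * \<beta> j) \<le> lqn q N v"
    using lqn_norming[OF q, where N=N and a="\<lambda>j. a j + b j"] by blast
  have "lqn q N (\<lambda>j. a j + b j) = norm (\<Sum>j<N. (a j + b j) * \<beta> j)"
    unfolding \<beta>(1) by simp
  also have "\<dots> = norm ((\<Sum>j<N. a j * \<beta> j) + (\<Sum>j<N. b j * \<beta> j))"
    by (simp add: distrib_right sum.distrib)
  also have "\<dots> \<le> lqn q N a + lqn q N b"
    using \<beta>(2)[of a] \<beta>(2)[of b] norm_triangle_ineq by (meson add_mono order_trans)
  finally show ?thesis .
qed

lemma lqn_triangle_diff:
  assumes q: "1 < q"
  shows "\<bar>lqn q N a - lqn q N b\<bar> \<le> lqn q N (\<lambda>j. a j - b j)"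
proof -
  have "lqn q N a \<le> lqn q N b + lqn q N (\<lambda>j. a j - b j)"
    using lqn_triangle[OF q, of N b "\<lambda>j. a j - b j"] by simp
  moreover have "lqn q N b \<le> lqn q N a + lqn q N (\<lambda>j. b j - a j)"
    using lqn_triangle[OF q, of N a "\<lambda>j. b j - a j"] by simp
  moreover have "lqn q N (\<lambda>j. b j - a j) = lqn q N (\<lambda>j. a j - b j)"
    by (intro lqn_cong) (simp add: norm_minus_commute)
  ultimately show ?thesis by linarith
qed

lemma lqn_sum:
  assumes q: "1 < q" and "finite I"
  shows "lqn q N (\<lambda>j. \<Sum>i\<in>I. a i j) \<le> (\<Sum>i\<in>I. lqn q N (a i))"
  using assms(2)
proof (induction I rule: finite_induct)
  case empty
  then show ?case using q by (simp add: lqn_zero)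
next
  case (insert i I)
  then show ?case using lqn_triangle[OF q, of N "a i" "\<lambda>j. \<Sum>i\<in>I. a i j"] by simp
qed

lemma lqn_le_sum:
  assumes q: "1 < q"
  shows "lqn q N a \<le> (\<Sum>j<N. norm (a j))"
proof -
  have "lqn q N a = lqn q N (\<lambda>j. \<Sum>i<N. if j = i then a i else 0)"
    by (intro lqn_cong) simp
  also have "\<dots> \<le> (\<Sum>i<N. lqn q N (\<lambda>j. if j = i then a i else 0))"
    by (intro lqn_sum[OF q]) auto
  also have "\<dots> = (\<Sum>i<N. norm (a i))"
  proof (intro sum.cong refl)
    fix i assume i: "i \<in> {..<N}"
    have "(\<Sum>j<N. norm (if j = i then a i else 0) powr q) = (\<Sum>j<N. if j = i then norm (a i) powr q else 0)"
      using q by (intro sum.cong) auto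
    also have "\<dots> = norm (a i) powr q" using i by simp
    finally show "lqn q N (\<lambda>j. if j = i then a i else 0) = norm (a i)"
      using q by (simp add: lqn_def powr_powr)
  qed
  finally show ?thesis .
qed

section \<open>Measurability and integration of finite sequence norms\<close>

lemma lqn_measurable [measurable (raw)]:
  assumes "\<And>j. j < N \<Longrightarrow> (\<lambda>x. f j x) \<in> borel_measurable M"
  shows "(\<lambda>x. lqn q N (\<lambda>j. f j x)) \<in> borel_measurable M"
  unfolding lqn_def using assms
  by (intro powr_real_measurable borel_measurable_sum borel_measurable_norm borel_measurable_const) auto

lemma lqn_integrable:
  assumes q: "1 < q" and v: "\<And>j. j < N \<Longrightarrow> integrable M (v j)"
  shows "integrable M (\<lambda>y. lqn q N (\<lambda>j. v j y))"
proof (rule Bochner_Integration.integrable_bound)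
  show "integrable M (\<lambda>y. \<Sum>j<N. norm (v j y))" using v by (intro Bochner_Integration.integrable_sum) auto
  show "(\<lambda>y. lqn q N (\<lambda>j. v j y)) \<in> borel_measurable M"
    using v by (intro lqn_measurable) auto
  show "AE y in M. norm (lqn q N (\<lambda>j. v j y)) \<le> norm (\<Sum>j<N. norm (v j y))"
    using lqn_le_sum[OF q] by (auto simp: sum_nonneg)
qed

text \<open>Minkowski's integral inequality: the functional norming the vector of integrals is a
  finite linear combination, so it moves under the integral sign, where it is bounded pointwise by
  the norm.\<close>

lemma lqn_integral:
  assumes q: "1 < q" and v: "\<And>j. j < N \<Longrightarrow> integrable M (v j)"
  shows "lqn q N (\<lambda>j. LINT y|M. v j y) \<le> (LINT y|M. lqn q N (\<lambda>j. v j y))"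
proof -
  obtain \<beta> where \<beta>: "(\<Sum>j<N. (LINT y|M. v j y) * \<beta> j) = of_real (lqn q N (\<lambda>j. LINT y|M. v j y))"
    "\<And>v. norm (\<Sum>j<N. v j * \<beta> j) \<le> lqn q N v"
    using lqn_norming[OF q, where N=N and a="\<lambda>j. LINT y|M. v j y"] by blast
  have int: "integrable M (\<lambda>y. \<Sum>j<N. v j y * \<beta> j)"
    using v by (intro Bochner_Integration.integrable_sum integrable_mult_left) auto
  have "lqn q N (\<lambda>j. LINT y|M. v j y) = norm (\<Sum>j<N. (LINT y|M. v j y) * \<beta> j)"
    unfolding \<beta>(1) by simp
  also have "(\<Sum>j<N. (LINT y|M. v j y) * \<beta> j) = (LINT y|M. (\<Sum>j<N. v j y * \<beta> j))"
    using v by (subst Bochner_Integration.integral_sum) (auto intro!: integrable_mult_left sum.cong)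
  also have "norm \<dots> \<le> (LINT y|M. norm (\<Sum>j<N. v j y * \<beta> j))" by (rule integral_norm_bound)
  also have "\<dots> \<le> (LINT y|M. lqn q N (\<lambda>j. v j y))"
    using \<beta>(2) int by (intro integral_mono lqn_integrable[OF q] v) auto
  finally show ?thesis .
qed

text \<open>A supremum exceeds \<open>t\<close> exactly when one of its terms does, so with the
  strict inequality the superlevel sets of the infinite norm are unions of those of the truncations.
  The comparison is made for \<open>q\<close>-th powers, whose partial sums have the series as
  supremum.\<close>

lemma lq_norm_less_iff:
  assumes q: "1 < q"
  shows "t < lq_norm q a \<longleftrightarrow> (\<exists>N. t < ennreal (lqn q N a))"
proof -
  define s where "s = (\<Sum>j. ennreal (norm (a j) powr q))"
  have part: "ennreal (lqn q N a powr q) = (\<Sum>j<N. ennreal (norm (a j) powr q))" for N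
    unfolding lqn_powr[OF q] by (simp add: sum_ennreal)
  have S: "s = (SUP N. ennreal (lqn q N a powr q))"
    unfolding s_def part by (rule suminf_eq_SUP)
  have root: "lqn q N a = (lqn q N a powr q) powr (1 / q)" for N using q by (simp add: powr_powr)
  have less_iff: "ennreal r < lq_norm q a \<longleftrightarrow> ennreal (r powr q) < s" if r: "0 \<le> r" for r
  proof (cases "s = \<infinity>")
    case True
    then show ?thesis by (simp add: lq_norm_def Let_def s_def[symmetric])
  next
    case False
    define u where "u = enn2real s"
    have u: "s = ennreal u" "0 \<le> u" using False unfolding u_def by (auto simp: less_top)
    have "r < u powr (1 / q) \<longleftrightarrow> r powr q < u"
    proof -
      have "r = (r powr q) powr (1 / q)" "u = (u powr (1 / q)) powr q" using q r u by (simp_all add: powr_powr)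
      then show ?thesis
        using powr_less_mono2[of "1 / q" "r powr q" u] powr_less_mono2[of q r "u powr (1 / q)"] q r u(2) by auto
    qed
    then show ?thesis using False r u
      by (simp add: lq_norm_def Let_def s_def[symmetric] ennreal_less_iff)
  qed
  show ?thesis
  proof (cases "t = \<infinity>")
    case True
    then show ?thesis by simp
  next
    case False
    then obtain r where r: "t = ennreal r" "0 \<le> r" by (cases t) auto
    have "ennreal (r powr q) < s \<longleftrightarrow> (\<exists>N. ennreal (r powr q) < ennreal (lqn q N a powr q))"
      unfolding S less_SUP_iff by auto
    also have "\<dots> \<longleftrightarrow> (\<exists>N. r < lqn q N a)"
    proof -
      have "r powr q < lqn q N a powr q \<longleftrightarrow> r < lqn q N a" for N
        using q r(2) powr_less_mono2[of q r "lqn q N a"] powr_mono2[of q "lqn q N a" r]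
        by (meson lqn_nonneg not_less order_less_trans zero_less_one less_imp_le)
      then show ?thesis by (simp add: ennreal_less_iff)
    qed
    finally show ?thesis using less_iff[OF r(2)] r by (simp add: ennreal_less_iff)
  qed
qed

lemma lq_norm_eq_SUP:
  assumes "1 < q"
  shows "lq_norm q a = (SUP N. ennreal (lqn q N a))"
proof (rule antisym)
  show "lq_norm q a \<le> (SUP N. ennreal (lqn q N a))"
    using lq_norm_less_iff[OF assms] less_SUP_iff by (metis (no_types, lifting) UNIV_I linorder_not_less order_less_irrefl)
  show "(SUP N. ennreal (lqn q N a)) \<le> lq_norm q a"
    using lq_norm_less_iff[OF assms] by (intro SUP_least) (metis linorder_not_less order_less_irrefl)
qed

section \<open>Dyadic cubes and stopping times\<close>

lemma vec_nth_One [simp]: "(One :: real ^ 'n) $ i = 1"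
proof -
  have b: "axis i (1::real) \<in> (Basis :: (real ^ 'n) set)" by (simp add: axis_in_Basis_iff)
  have "One \<bullet> e = 1" if "e \<in> Basis" for e :: "real ^ 'n" using that by simp
  from this[OF b] have "(One :: real ^ 'n) \<bullet> axis i 1 = 1" .
  then show ?thesis unfolding inner_axis by simp
qed

lemma sum_Basis_nth [simp]: "(\<Sum>x\<in>(Basis :: (real ^ 'n) set). x $ i) = 1"
  using vec_nth_One[of i] unfolding sum_component .

lemma two_power_ennreal: "(2::ennreal) ^ m = ennreal (2 ^ m)"
  by (simp add: ennreal_power[symmetric])

text \<open>Half-open, so that the dyadic cubes of one generation partition the space; the closed
  cube on the same data differs by a null set.\<close>

definition hcube :: "real ^ 'n \<Rightarrow> real \<Rightarrow> (real ^ 'n) set" where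
  "hcube a l = {x. \<forall>i. a $ i \<le> x $ i \<and> x $ i < a $ i + l}"

lemma mem_cube_iff: "x \<in> cbox a (a + l *\<^sub>R One) \<longleftrightarrow> (\<forall>i. a $ i \<le> x $ i \<and> x $ i \<le> a $ i + l)" for x :: "real ^ 'n"
  by (simp add: mem_box_cart)

lemma hcube_subset_cbox: "hcube a l \<subseteq> cbox a (a + l *\<^sub>R One)"
  by (auto simp: hcube_def mem_cube_iff less_imp_le)

lemma hcube_sets [measurable]: "hcube a l \<in> sets borel"
  unfolding hcube_def by measurable

lemma hcube_sets_lebesgue [measurable]: "hcube a l \<in> sets lebesgue"
  using hcube_sets by (simp add: sets_completionI_sets)

lemma emeasure_cube:
  fixes a :: "real ^ 'n"
  assumes "0 \<le> l"
  shows "emeasure lebesgue (cbox a (a + l *\<^sub>R One)) = ennreal (l ^ CARD('n))"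
proof -
  have "emeasure lborel (cbox a (a + l *\<^sub>R One)) = (\<Prod>b\<in>Basis. (a + l *\<^sub>R One - a) \<bullet> b)"
    using assms by (intro emeasure_lborel_cbox) (auto simp: inner_add_left)
  also have "\<dots> = (\<Prod>b\<in>(Basis::(real ^ 'n) set). l)"
    by (intro arg_cong[where f=ennreal] prod.cong) auto
  finally show ?thesis by simp
qed

lemma emeasure_hcube:
  fixes a :: "real ^ 'n"
  assumes "0 \<le> l"
  shows "emeasure lebesgue (hcube a l) = ennreal (l ^ CARD('n))"
proof (rule antisym)
  show "emeasure lebesgue (hcube a l) \<le> ennreal (l ^ CARD('n))"
    unfolding emeasure_cube[OF assms, symmetric, of a]
    by (intro emeasure_mono hcube_subset_cbox) auto
  have "emeasure lebesgue (box a (a + l *\<^sub>R One)) = emeasure lebesgue (cbox a (a + l *\<^sub>R One))"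
    by (simp add: emeasure_lborel_box_eq emeasure_lborel_cbox_eq)
  moreover have "emeasure lebesgue (box a (a + l *\<^sub>R One)) \<le> emeasure lebesgue (hcube a l)"
    by (intro emeasure_mono) (auto simp: hcube_def mem_box_cart less_imp_le)
  ultimately show "ennreal (l ^ CARD('n)) \<le> emeasure lebesgue (hcube a l)"
    unfolding emeasure_cube[OF assms, symmetric, of a] by simp
qed

lemma hcube_null_diff: "0 \<le> l \<Longrightarrow> cbox a (a + l *\<^sub>R One) - hcube a l \<in> null_sets lebesgue"
  by (intro null_setsI, subst emeasure_Diff)
    (use emeasure_hcube[of l a] emeasure_cube[of l a] hcube_subset_cbox[of a l] in \<open>auto simp del: emeasure_completion\<close>)

lemma norm_le_of_coords:
  fixes x :: "real ^ 'n"
  assumes "\<And>i. \<bar>x $ i\<bar> \<le> r"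
  shows "norm x \<le> real CARD('n) * r"
proof -
  have "norm x \<le> (\<Sum>i\<in>UNIV. \<bar>x $ i\<bar>)" by (rule norm_le_l1_cart)
  also have "\<dots> \<le> (\<Sum>i\<in>(UNIV :: 'n set). r)" by (intro sum_mono assms)
  finally show ?thesis by simp
qed

lemma hcube_dist:
  fixes x :: "real ^ 'n"
  assumes "x \<in> hcube a l" "y \<in> hcube a l"
  shows "norm (x - y) \<le> real CARD('n) * l"
proof (rule norm_le_of_coords)
  show "\<bar>(x - y) $ i\<bar> \<le> l" for i
    using assms unfolding hcube_def by (auto simp: abs_le_iff dest!: spec[of _ i])
qed

lemma bounded_hcube: "bounded (hcube a l)"
  using hcube_subset_cbox bounded_cbox bounded_subset by blast

section \<open>The dyadic grid anchored at a cube\<close>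

definition gidx :: "real ^ 'n \<Rightarrow> real \<Rightarrow> nat \<Rightarrow> real ^ 'n \<Rightarrow> 'n \<Rightarrow> int" where
  "gidx a l k x i = \<lfloor>2 ^ k * (x $ i - a $ i) / l\<rfloor>"

text \<open>A dyadic cube is named by any of its points instead of its integer index. The ancestors
  of \<open>dyadic a l k x\<close> are then simply \<open>dyadic a l j x\<close> with
  \<open>j < k\<close>. The grid continues over the whole space, beyond
  \<open>hcube a l\<close>.\<close>

definition dyadic :: "real ^ 'n \<Rightarrow> real \<Rightarrow> nat \<Rightarrow> real ^ 'n \<Rightarrow> (real ^ 'n) set" where
  "dyadic a l k x = {y. \<forall>i. gidx a l k y i = gidx a l k x i}"

lemma dyadic_self [simp]: "x \<in> dyadic a l k x"
  by (simp add: dyadic_def)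

lemma dyadic_eq: "y \<in> dyadic a l k x \<Longrightarrow> dyadic a l k y = dyadic a l k x"
  by (simp add: dyadic_def)

lemma dyadic_hcube:
  assumes "0 < l"
  obtains b where "dyadic a l k x = hcube b (l / 2 ^ k)"
proof
  have "\<lfloor>2 ^ k * (y $ i - a $ i) / l\<rfloor> = m \<longleftrightarrow>
      a $ i + l / 2 ^ k * real_of_int m \<le> y $ i \<and> y $ i < a $ i + l / 2 ^ k * real_of_int m + l / 2 ^ k" for y i m
    using assms by (simp add: floor_eq_iff field_simps)
  then show "dyadic a l k x = hcube (\<chi> i. a $ i + l / 2 ^ k * real_of_int (gidx a l k x i)) (l / 2 ^ k)"
    by (auto simp: dyadic_def gidx_def hcube_def)
qed

lemma dyadic_0:
  assumes "0 < l" "x \<in> hcube a l"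
  shows "dyadic a l 0 x = hcube a l"
proof -
  have *: "\<lfloor>(y $ i - a $ i) / l\<rfloor> = 0 \<longleftrightarrow> a $ i \<le> y $ i \<and> y $ i < a $ i + l" for y i
    using assms(1) by (simp add: floor_eq_iff field_simps)
  have 0: "\<lfloor>(x $ i - a $ i) / l\<rfloor> = 0" for i using assms(2) unfolding * by (simp add: hcube_def)
  show ?thesis by (simp only: dyadic_def gidx_def hcube_def power_0 mult_1 0 *)
qed

lemma gidx_Suc:
  assumes "0 < l"
  shows "gidx a l k x i = gidx a l (Suc k) x i div 2"
proof -
  have "2 ^ k * (x $ i - a $ i) / l = (2 ^ Suc k * (x $ i - a $ i) / l) / real_of_int 2" by simp
  then show ?thesis unfolding gidx_def by (metis floor_divide_real_eq_div zero_le_numeral)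
qed

lemma dyadic_antimono:
  assumes "0 < l" "j \<le> k"
  shows "dyadic a l k x \<subseteq> dyadic a l j x"
  using assms(2)
proof (induction k rule: dec_induct)
  case (step k)
  have "dyadic a l (Suc k) x \<subseteq> dyadic a l k x"
    by (auto simp: dyadic_def gidx_Suc[OF assms(1), of a k])
  with step show ?case by blast
qed simp

lemma dyadic_sets [measurable]: "0 < l \<Longrightarrow> dyadic a l k x \<in> sets lebesgue"
  by (metis dyadic_hcube hcube_sets_lebesgue)

lemma emeasure_dyadic:
  fixes a :: "real ^ 'n"
  assumes "0 < l"
  shows "emeasure lebesgue (dyadic a l k x) = ennreal ((l / 2 ^ k) ^ CARD('n))"
proof -
  obtain b where "dyadic a l k x = hcube b (l / 2 ^ k)" using dyadic_hcube[OF assms] by blast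
  then show ?thesis using emeasure_hcube[of "l / 2 ^ k" b] assms by (simp del: emeasure_completion)
qed

lemma emeasure_dyadic_Suc:
  fixes a :: "real ^ 'n"
  assumes "0 < l"
  shows "emeasure lebesgue (dyadic a l k x) = 2 ^ CARD('n) * emeasure lebesgue (dyadic a l (Suc k) x)"
proof -
  have "(l / 2 ^ k) ^ CARD('n) = 2 ^ CARD('n) * (l / 2 ^ Suc k) ^ CARD('n)"
    by (simp add: power_mult_distrib[symmetric])
  then show ?thesis unfolding emeasure_dyadic[OF assms] using assms
    by (simp add: ennreal_mult ennreal_power[symmetric])
qed

lemma dyadic_small:
  fixes G :: "(real ^ 'n) set"
  assumes "0 < l" "open G" "x \<in> G"
  obtains k where "dyadic a l k x \<subseteq> G"
proof -
  obtain e where e: "0 < e" "ball x e \<subseteq> G" using assms openE by blast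
  have "(\<lambda>k. real CARD('n) * l * (1/2) ^ k) \<longlonglongrightarrow> real CARD('n) * l * 0"
    by (intro tendsto_intros LIMSEQ_realpow_zero) auto
  then have "\<forall>\<^sub>F k in sequentially. real CARD('n) * l * (1/2) ^ k < e"
    using e(1) by (intro order_tendstoD) auto
  then obtain k where k: "real CARD('n) * l * (1/2) ^ k < e" by (blast dest: eventually_happens'[OF sequentially_bot])
  have "dyadic a l k x \<subseteq> ball x e"
  proof
    fix y assume y: "y \<in> dyadic a l k x"
    obtain b where b: "dyadic a l k x = hcube b (l / 2 ^ k)" using dyadic_hcube[OF assms(1)] by blast
    have "norm (x - y) \<le> real CARD('n) * (l / 2 ^ k)"
      using y dyadic_self[of x a l k] unfolding b by (intro hcube_dist)
    then show "y \<in> ball x e" using k by (simp add: dist_norm power_divide)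
  qed
  then show ?thesis using e(2) that by blast
qed

text \<open>Selection of the maximal bad cubes of a dyadic grid: each point is assigned the cube of the
  first level at which it lies in a bad one.\<close>

lemma dyadic_stopping:
  fixes a :: "real ^ 'n"
  assumes l: "0 < l"
  obtains S where "countable S" "disjoint S"
    "\<And>R. R \<in> S \<Longrightarrow> \<exists>k x. R = dyadic a l k x \<and> bad R \<and> (\<forall>j<k. \<not> bad (dyadic a l j x))"
    "\<And>k x. bad (dyadic a l k x) \<Longrightarrow> x \<in> \<Union>S"
proof
  define lev where "lev x = (LEAST k. bad (dyadic a l k x))" for x
  define B where "B = {x. \<exists>k. bad (dyadic a l k x)}"
  define S where "S = (\<lambda>x. dyadic a l (lev x) x) ` B"
  have lev: "bad (dyadic a l (lev x) x)" if "x \<in> B" for x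
    using that unfolding B_def lev_def by (auto intro: LeastI)
  have lev_min: "\<not> bad (dyadic a l j x)" if "j < lev x" for x j
    using that unfolding lev_def by (rule not_less_Least)
  \<comment> \<open>All points of a selected cube share its ancestors, hence the same first bad
    level. Two selected cubes that meet therefore coincide.\<close>
  have same: "dyadic a l (lev z) z = dyadic a l (lev x) x" if "x \<in> B" "z \<in> dyadic a l (lev x) x" for x z
  proof -
    have eq: "dyadic a l j z = dyadic a l j x" if "j \<le> lev x" for j
      using dyadic_antimono[OF l that, of a x] \<open>z \<in> dyadic a l (lev x) x\<close> by (intro dyadic_eq) blast
    have "lev z = lev x"
    proof (rule antisym)
      show "lev z \<le> lev x" using lev[OF that(1)] eq[of "lev x"] unfolding lev_def[of z] by (simp add: Least_le)
      show "lev x \<le> lev z"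
      proof (rule ccontr)
        assume "\<not> lev x \<le> lev z"
        then have *: "lev z < lev x" by simp
        have "bad (dyadic a l (lev x) z)" using lev[OF that(1)] eq[of "lev x"] by simp
        then have "bad (dyadic a l (lev z) z)" unfolding lev_def[of z] by (rule LeastI)
        then show False using eq[of "lev z"] lev_min[OF *] * by simp
      qed
    qed
    then show ?thesis using eq by simp
  qed
  show "disjoint S"
  proof (rule disjointI)
    fix R R' assume RR: "R \<in> S" "R' \<in> S" "R \<noteq> R'"
    show "R \<inter> R' = {}"
    proof (rule ccontr)
      assume "R \<inter> R' \<noteq> {}"
      then obtain z where "z \<in> R" "z \<in> R'" by blast
      then show False using RR same unfolding S_def by (metis (no_types, lifting) imageE)
    qed
  qed
  show "countable S"
  proof (rule countable_subset)
    have "dyadic a l k x = (\<lambda>(k, m :: int ^ 'n). {y. \<forall>i. gidx a l k y i = m $ i}) (k, \<chi> i. gidx a l k x i)" for k x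
      by (simp add: dyadic_def)
    then show "S \<subseteq> range (\<lambda>(k, m :: int ^ 'n). {y. \<forall>i. gidx a l k y i = m $ i})"
      unfolding S_def by blast
  qed simp
  show "\<exists>k x. R = dyadic a l k x \<and> bad R \<and> (\<forall>j<k. \<not> bad (dyadic a l j x))" if "R \<in> S" for R
    using that lev lev_min unfolding S_def by blast
  show "x \<in> \<Union>S" if "bad (dyadic a l k x)" for k x
    using that unfolding S_def B_def by (auto intro!: bexI[where x=x])
qed

lemma emeasure_disjoint_Union:
  assumes "countable S" "disjoint S" "\<And>R. R \<in> S \<Longrightarrow> X R \<in> sets M" "\<And>R. R \<in> S \<Longrightarrow> X R \<subseteq> R"
  shows "emeasure M (\<Union>R\<in>S. X R) = (\<integral>\<^sup>+R. emeasure M (X R) \<partial>count_space S)"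
proof (rule emeasure_UN_countable)
  show "disjoint_family_on X S"
    using assms(2,4) unfolding disjoint_family_on_def disjoint_def by blast
qed (use assms in auto)

text \<open>A cube is bad if \<open>G\<close> fills more than the proportion \<open>2^-(n+1)\<close>
  of it, \<open>n\<close> being the dimension. The parent of a selected cube is not bad and is
  \<open>2^n\<close> times as large, so \<open>G\<close> fills at most half of the selected cube.
  Openness puts a small dyadic cube, necessarily bad, around each point of \<open>G\<close>, and
  badness bounds the total volume of the selection by \<open>2^(n+1)\<close> times that of
  \<open>G\<close>.\<close>

lemma open_stopping:
  fixes a :: "real ^ 'n"
  assumes l: "0 < l" and G: "open G"
    and small: "2 ^ (CARD('n) + 1) * emeasure lebesgue (G \<inter> hcube a l) \<le> emeasure lebesgue (hcube a l)"
  obtains S where "countable S" "disjoint S"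
    "\<And>R. R \<in> S \<Longrightarrow> \<exists>b m. 0 < m \<and> R = hcube b m"
    "\<And>R. R \<in> S \<Longrightarrow> R \<subseteq> hcube a l"
    "\<And>R. R \<in> S \<Longrightarrow> 2 * emeasure lebesgue (G \<inter> R) \<le> emeasure lebesgue R"
    "G \<inter> hcube a l \<subseteq> \<Union>S"
    "(\<integral>\<^sup>+R. emeasure lebesgue R \<partial>count_space S) \<le> 2 ^ (CARD('n) + 1) * emeasure lebesgue (G \<inter> hcube a l)"
proof -
  define bad where "bad R \<longleftrightarrow> R \<subseteq> hcube a l \<and> emeasure lebesgue R < 2 ^ (CARD('n) + 1) * emeasure lebesgue (G \<inter> R)" for R
  have [measurable]: "G \<in> sets lebesgue" using G by simp
  obtain S where S: "countable S" "disjoint S"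
    "\<And>R. R \<in> S \<Longrightarrow> \<exists>k x. R = dyadic a l k x \<and> bad R \<and> (\<forall>j<k. \<not> bad (dyadic a l j x))"
    "\<And>k x. bad (dyadic a l k x) \<Longrightarrow> x \<in> \<Union>S"
    by (rule dyadic_stopping[OF l, of a bad]) blast
  have Ssets: "R \<in> sets lebesgue" if "R \<in> S" for R using S(3)[OF that] l by auto
  show ?thesis
  proof (rule that[OF S(1,2)])
    fix R assume R: "R \<in> S"
    then obtain k x where kx: "R = dyadic a l k x" "bad R" "\<forall>j<k. \<not> bad (dyadic a l j x)" using S(3) by blast
    show "\<exists>b m. 0 < m \<and> R = hcube b m"
      using l unfolding kx(1) by (metis dyadic_hcube zero_less_divide_iff zero_less_numeral zero_less_power)
    show "R \<subseteq> hcube a l" using kx(2) by (simp add: bad_def)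
    then have xP: "x \<in> hcube a l" using kx(1) by auto
    \<comment> \<open>The smallness hypothesis says that the top cube is not bad, so a selected cube
      has a dyadic parent within \<open>hcube a l\<close>.\<close>
    have "k \<noteq> 0"
    proof
      assume "k = 0"
      then have "R = hcube a l" using kx(1) dyadic_0[OF l xP] by simp
      then show False using kx(2) small by (simp add: bad_def)
    qed
    then obtain j where j: "k = Suc j" by (cases k) auto
    have "dyadic a l j x \<subseteq> hcube a l"
      using dyadic_antimono[OF l, of 0 j a x] dyadic_0[OF l xP] by simp
    moreover have "\<not> bad (dyadic a l j x)" using kx(3) j by simp
    ultimately have "2 ^ (CARD('n) + 1) * emeasure lebesgue (G \<inter> dyadic a l j x) \<le> emeasure lebesgue (dyadic a l j x)"
      by (simp add: bad_def not_less)
    also have "\<dots> = 2 ^ CARD('n) * emeasure lebesgue R"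
      unfolding kx(1) j by (rule emeasure_dyadic_Suc[OF l])
    finally have "2 ^ (CARD('n) + 1) * emeasure lebesgue (G \<inter> dyadic a l j x) \<le> 2 ^ CARD('n) * emeasure lebesgue R" .
    moreover have "emeasure lebesgue (G \<inter> R) \<le> emeasure lebesgue (G \<inter> dyadic a l j x)"
      unfolding kx(1) j using dyadic_antimono[OF l, of j "Suc j" a x] l by (intro emeasure_mono) auto
    then have "2 ^ (CARD('n) + 1) * emeasure lebesgue (G \<inter> R) \<le> 2 ^ (CARD('n) + 1) * emeasure lebesgue (G \<inter> dyadic a l j x)"
      by (rule mult_left_mono) simp
    ultimately have "2 ^ CARD('n) * (2 * emeasure lebesgue (G \<inter> R)) \<le> 2 ^ CARD('n) * emeasure lebesgue R"
      by (simp add: mult.assoc mult.left_commute)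
    then show "2 * emeasure lebesgue (G \<inter> R) \<le> emeasure lebesgue R"
      by (subst (asm) ennreal_mult_le_mult_iff) (auto simp: two_power_ennreal)
  next
    show "G \<inter> hcube a l \<subseteq> \<Union>S"
    proof
      fix x assume x: "x \<in> G \<inter> hcube a l"
      obtain k where k: "dyadic a l k x \<subseteq> G" using dyadic_small[OF l G] x by blast
      have "dyadic a l k x \<subseteq> hcube a l"
        using dyadic_antimono[OF l, of 0 k a x] dyadic_0[OF l, of x a] x by simp
      moreover have "emeasure lebesgue (dyadic a l k x) < 2 ^ (CARD('n) + 1) * emeasure lebesgue (dyadic a l k x)"
      proof -
        define e where "e = (l / 2 ^ k) ^ CARD('n)"
        have e: "0 < e" using l by (simp add: e_def)
        have "(1::real) < 2 ^ (CARD('n) + 1)" by (rule one_less_power) auto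
        then have "1 * e < 2 ^ (CARD('n) + 1) * e" using e by (rule mult_strict_right_mono)
        then have "ennreal e < ennreal (2 ^ (CARD('n) + 1) * e)" using e by (simp add: ennreal_less_iff)
        also have "\<dots> = 2 ^ (CARD('n) + 1) * ennreal e" using e by (simp add: ennreal_mult ennreal_power[symmetric])
        finally show ?thesis unfolding emeasure_dyadic[OF l] e_def .
      qed
      ultimately have "bad (dyadic a l k x)" using k by (simp add: bad_def Int_absorb1)
      then show "x \<in> \<Union>S" using S(4) by blast
    qed
    have "(\<integral>\<^sup>+R. emeasure lebesgue R \<partial>count_space S) \<le> (\<integral>\<^sup>+R. 2 ^ (CARD('n) + 1) * emeasure lebesgue (G \<inter> hcube a l \<inter> R) \<partial>count_space S)"
    proof (intro nn_integral_mono)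
      fix R assume "R \<in> space (count_space S)"
      then have "bad R" using S(3) by auto
      then show "emeasure lebesgue R \<le> 2 ^ (CARD('n) + 1) * emeasure lebesgue (G \<inter> hcube a l \<inter> R)"
        unfolding bad_def by (metis Int_absorb1 Int_assoc less_imp_le)
    qed
    also have "\<dots> = 2 ^ (CARD('n) + 1) * (\<integral>\<^sup>+R. emeasure lebesgue (G \<inter> hcube a l \<inter> R) \<partial>count_space S)"
      by (rule nn_integral_cmult) simp
    also have "(\<integral>\<^sup>+R. emeasure lebesgue (G \<inter> hcube a l \<inter> R) \<partial>count_space S) = emeasure lebesgue (\<Union>R\<in>S. G \<inter> hcube a l \<inter> R)"
      using S(1,2) Ssets by (intro emeasure_disjoint_Union[symmetric]) auto
    also have "2 ^ (CARD('n) + 1) * \<dots> \<le> 2 ^ (CARD('n) + 1) * emeasure lebesgue (G \<inter> hcube a l)"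
      by (intro mult_left_mono emeasure_mono) auto
    finally show "(\<integral>\<^sup>+R. emeasure lebesgue R \<partial>count_space S) \<le> 2 ^ (CARD('n) + 1) * emeasure lebesgue (G \<inter> hcube a l)" .
  qed
qed

section \<open>Exponential decay of local oscillations\<close>

lemma lebesgue_outer_open:
  fixes E :: "(real ^ 'n) set"
  assumes "E \<in> sets lebesgue" "0 < \<delta>"
  obtains G where "open G" "E \<subseteq> G" "emeasure lebesgue G \<le> emeasure lebesgue E + ennreal \<delta>"
proof -
  obtain G where G: "open G" "E \<subseteq> G" "(G - E) \<in> lmeasurable" "emeasure lebesgue (G - E) < ennreal \<delta>"
    using sets_lebesgue_outer_open[OF assms] .
  have "emeasure lebesgue G = emeasure lebesgue (E \<union> (G - E))" using G(2) by (simp add: Un_absorb1)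
  also have "\<dots> \<le> emeasure lebesgue E + emeasure lebesgue (G - E)"
    using assms(1) G(3) by (intro emeasure_subadditive) (auto dest: fmeasurableD)
  also have "\<dots> \<le> emeasure lebesgue E + ennreal \<delta>" using G(4) by (intro add_left_mono) simp
  finally show ?thesis using that G by blast
qed

text \<open>The covers \<open>H\<close> of the bad sets in the selected subcubes are glued; a point of \<open>G\<close> outside the
  result is a good point of the selected subcube that contains it.\<close>

lemma stopping_cover:
  fixes a :: "real ^ 'n"
  assumes l: "0 < l" and G: "open G"
    and small: "2 ^ (CARD('n) + 1) * emeasure lebesgue (G \<inter> hcube a l) \<le> emeasure lebesgue (hcube a l)"
    and cover: "\<And>b m. 0 < m \<Longrightarrow> \<exists>H\<in>sets lebesgue. {x \<in> hcube b m. \<Phi> b m x} \<subseteq> H \<and>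
      2 ^ k * emeasure lebesgue H \<le> emeasure lebesgue (hcube b m)"
  obtains H where "H \<in> sets lebesgue"
    "2 ^ k * emeasure lebesgue H \<le> 2 ^ (CARD('n) + 1) * emeasure lebesgue (G \<inter> hcube a l)"
    "\<And>x. x \<in> G \<inter> hcube a l \<Longrightarrow> x \<notin> H \<Longrightarrow> \<exists>b m. 0 < m \<and> x \<in> hcube b m \<and> hcube b m \<subseteq> hcube a l \<and>
      2 * emeasure lebesgue (G \<inter> hcube b m) \<le> emeasure lebesgue (hcube b m) \<and> \<not> \<Phi> b m x"
proof -
  obtain S where S: "countable S" "disjoint S"
    "\<And>R. R \<in> S \<Longrightarrow> \<exists>b m. 0 < m \<and> R = hcube b m"
    "\<And>R. R \<in> S \<Longrightarrow> R \<subseteq> hcube a l"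
    "\<And>R. R \<in> S \<Longrightarrow> 2 * emeasure lebesgue (G \<inter> R) \<le> emeasure lebesgue R"
    "G \<inter> hcube a l \<subseteq> \<Union>S"
    "(\<integral>\<^sup>+R. emeasure lebesgue R \<partial>count_space S) \<le> 2 ^ (CARD('n) + 1) * emeasure lebesgue (G \<inter> hcube a l)"
    using open_stopping[OF l G small] by metis
  have "\<forall>R\<in>S. \<exists>H. H \<in> sets lebesgue \<and> 2 ^ k * emeasure lebesgue H \<le> emeasure lebesgue R \<and>
      (\<exists>b m. 0 < m \<and> R = hcube b m \<and> {x \<in> hcube b m. \<Phi> b m x} \<subseteq> H)"
  proof
    fix R assume "R \<in> S"
    then obtain b m where bm: "0 < m" "R = hcube b m" using S(3) by blast
    from cover[OF bm(1), of b] show "\<exists>H. H \<in> sets lebesgue \<and> 2 ^ k * emeasure lebesgue H \<le> emeasure lebesgue R \<and>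
      (\<exists>b m. 0 < m \<and> R = hcube b m \<and> {x \<in> hcube b m. \<Phi> b m x} \<subseteq> H)"
      using bm by blast
  qed
  from bchoice[OF this] obtain HH where
    "\<forall>R\<in>S. HH R \<in> sets lebesgue \<and> 2 ^ k * emeasure lebesgue (HH R) \<le> emeasure lebesgue R \<and>
      (\<exists>b m. 0 < m \<and> R = hcube b m \<and> {x \<in> hcube b m. \<Phi> b m x} \<subseteq> HH R)" ..
  then have HH: "\<And>R. R \<in> S \<Longrightarrow> HH R \<in> sets lebesgue"
    "\<And>R. R \<in> S \<Longrightarrow> 2 ^ k * emeasure lebesgue (HH R) \<le> emeasure lebesgue R"
    "\<And>R. R \<in> S \<Longrightarrow> \<exists>b m. 0 < m \<and> R = hcube b m \<and> {x \<in> hcube b m. \<Phi> b m x} \<subseteq> HH R"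
    by blast+
  have Rs: "R \<in> sets lebesgue" if "R \<in> S" for R using S(3)[OF that] hcube_sets_lebesgue by blast
  define H where "H = (\<Union>R\<in>S. HH R \<inter> R)"
  show ?thesis
  proof (rule that[of H])
    show "H \<in> sets lebesgue" unfolding H_def using S(1) HH(1) Rs by (intro sets.countable_UN') auto
    have "2 ^ k * emeasure lebesgue H = 2 ^ k * (\<integral>\<^sup>+R. emeasure lebesgue (HH R \<inter> R) \<partial>count_space S)"
      unfolding H_def using S(1,2) HH(1) Rs by (subst emeasure_disjoint_Union) auto
    also have "\<dots> = (\<integral>\<^sup>+R. 2 ^ k * emeasure lebesgue (HH R \<inter> R) \<partial>count_space S)"
      by (rule nn_integral_cmult[symmetric]) simp
    also have "\<dots> \<le> (\<integral>\<^sup>+R. emeasure lebesgue R \<partial>count_space S)"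
    proof (intro nn_integral_mono)
      fix R assume "R \<in> space (count_space S)"
      then have R: "R \<in> S" by simp
      have "2 ^ k * emeasure lebesgue (HH R \<inter> R) \<le> 2 ^ k * emeasure lebesgue (HH R)"
        using HH(1)[OF R] by (intro mult_left_mono emeasure_mono) auto
      also note HH(2)[OF R]
      finally show "2 ^ k * emeasure lebesgue (HH R \<inter> R) \<le> emeasure lebesgue R" .
    qed
    also note S(7)
    finally show "2 ^ k * emeasure lebesgue H \<le> 2 ^ (CARD('n) + 1) * emeasure lebesgue (G \<inter> hcube a l)" .
    fix x assume x: "x \<in> G \<inter> hcube a l" "x \<notin> H"
    then obtain R where R: "R \<in> S" "x \<in> R" using S(6) by blast
    obtain b m where bm: "0 < m" "R = hcube b m" "{x \<in> hcube b m. \<Phi> b m x} \<subseteq> HH R"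
      using HH(3)[OF R(1)] by blast
    have "x \<notin> HH R" using x(2) R unfolding H_def by blast
    then have "\<not> \<Phi> b m x" using bm(2,3) R(2) by blast
    then show "\<exists>b m. 0 < m \<and> x \<in> hcube b m \<and> hcube b m \<subseteq> hcube a l \<and>
      2 * emeasure lebesgue (G \<inter> hcube b m) \<le> emeasure lebesgue (hcube b m) \<and> \<not> \<Phi> b m x"
      using bm(1,2) R S(4,5)[OF R(1)] by blast
  qed
qed

text \<open>\<open>cc\<close> and \<open>w\<close> attach a centre and an oscillation bound to each
  cube, while \<open>W\<close> is one function of the point that dominates \<open>w\<close> of all
  cubes through it. The proportion \<open>2^-(n+3)\<close> allows for a doubling when the
  exceptional set is covered by an open set, for the factor \<open>2^(n+1)\<close> of
  \<open>open_stopping\<close>, and for one halving per generation.\<close>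

locale local_oscillation =
  fixes g W :: "real ^ 'n \<Rightarrow> real" and cc w :: "real ^ 'n \<Rightarrow> real \<Rightarrow> real"
  assumes g_measurable [measurable]: "g \<in> borel_measurable lebesgue"
    and osc: "0 < l \<Longrightarrow> 2 ^ (CARD('n) + 3) * emeasure lebesgue {x \<in> hcube a l. w a l < \<bar>g x - cc a l\<bar>}
      \<le> emeasure lebesgue (hcube a l)"
    and w_le: "0 < l \<Longrightarrow> x \<in> hcube a l \<Longrightarrow> w a l \<le> W x"
    and W_nonneg: "0 \<le> W x"
begin

lemma exceptional_sets [measurable]: "{x \<in> hcube a l. w a l < \<bar>g x - cc a l\<bar>} \<in> sets lebesgue"
proof -
  have "{x \<in> hcube a l. w a l < \<bar>g x - cc a l\<bar>} = hcube a l \<inter> {x \<in> space lebesgue. w a l < \<bar>g x - cc a l\<bar>}" by auto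
  also have "\<dots> \<in> sets lebesgue" by measurable
  finally show ?thesis .
qed

text \<open>The set \<open>E\<close> takes up at most half of the cube and the exceptional set at
  most an eighth, so together they cannot exhaust it.\<close>

lemma typical_point:
  assumes m: "0 < m" and E: "E \<in> sets lebesgue" "2 * emeasure lebesgue (E \<inter> hcube b m) \<le> emeasure lebesgue (hcube b m)"
  obtains y where "y \<in> hcube b m" "y \<notin> E" "\<bar>g y - cc b m\<bar> \<le> w b m"
proof (rule ccontr)
  define F where "F = {x \<in> hcube b m. w b m < \<bar>g x - cc b m\<bar>}"
  define v where "v = m ^ CARD('n)"
  have v: "emeasure lebesgue (hcube b m) = ennreal v" "0 < v"
    unfolding v_def using m by (simp_all add: emeasure_hcube del: emeasure_completion)
  have [measurable]: "F \<in> sets lebesgue" "E \<in> sets lebesgue" unfolding F_def using E by auto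
  assume "\<not> thesis"
  then have "\<not> (y \<in> hcube b m \<and> y \<notin> E \<and> \<bar>g y - cc b m\<bar> \<le> w b m)" for y using that by blast
  then have "hcube b m \<subseteq> (E \<inter> hcube b m) \<union> F" unfolding F_def by (force simp: not_le)
  then have "emeasure lebesgue (hcube b m) \<le> emeasure lebesgue ((E \<inter> hcube b m) \<union> F)"
    by (intro emeasure_mono) auto
  also have "\<dots> \<le> emeasure lebesgue (E \<inter> hcube b m) + emeasure lebesgue F"
    by (intro emeasure_subadditive) auto
  finally have "8 * emeasure lebesgue (hcube b m) \<le> 8 * (emeasure lebesgue (E \<inter> hcube b m) + emeasure lebesgue F)"
    by (rule mult_left_mono) simp
  also have "\<dots> = 4 * (2 * emeasure lebesgue (E \<inter> hcube b m)) + 8 * emeasure lebesgue F"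
    by (simp add: distrib_left mult.assoc[symmetric] del: emeasure_completion)
  also have "\<dots> \<le> 4 * emeasure lebesgue (hcube b m) + emeasure lebesgue (hcube b m)"
  proof (intro add_mono mult_left_mono E(2))
    have "(8::ennreal) \<le> 2 ^ (CARD('n) + 3)"
    proof -
      have "(2::real) ^ 3 \<le> 2 ^ (CARD('n) + 3)" by (rule power_increasing) auto
      then have "ennreal 8 \<le> ennreal (2 ^ (CARD('n) + 3))" by (intro ennreal_leI) simp
      then show ?thesis by (simp only: two_power_ennreal ennreal_numeral)
    qed
    then have "8 * emeasure lebesgue F \<le> 2 ^ (CARD('n) + 3) * emeasure lebesgue F" by (rule mult_right_mono) simp
    also have "\<dots> \<le> emeasure lebesgue (hcube b m)" unfolding F_def by (rule osc[OF m])
    finally show "8 * emeasure lebesgue F \<le> emeasure lebesgue (hcube b m)" .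
  qed simp
  finally have "ennreal 8 * ennreal v \<le> ennreal 4 * ennreal v + ennreal v" unfolding v by simp
  then have "ennreal (8 * v) \<le> ennreal (5 * v)" using v(2)
    by (simp add: ennreal_mult'[symmetric] ennreal_plus[symmetric] del: ennreal_plus ennreal_numeral)
  then show False using v(2) by (subst (asm) ennreal_le_iff) auto
qed

text \<open>In a selected subcube \<open>hcube b m\<close> the open set \<open>G\<close> fills at
  most half, so there is a point \<open>y\<close> that is good both for the subcube and for the
  whole cube. Hence \<open>\<bar>cc b m - cc a l\<bar> \<le> w b m + w a l \<le> 2 * W x\<close>,
  and adding this to the induction hypothesis on the subcube gives the next generation. Measures are
  bounded through a measurable superset \<open>H\<close>, since \<open>W\<close> carries no
  measurability assumption in this locale.\<close>

lemma oscillation_decay: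
  assumes "0 < l"
  shows "\<exists>H\<in>sets lebesgue. {x \<in> hcube a l. 2 * real k * W x < \<bar>g x - cc a l\<bar>} \<subseteq> H \<and>
    2 ^ k * emeasure lebesgue H \<le> emeasure lebesgue (hcube a l)"
  using assms
proof (induction k arbitrary: a l)
  case 0
  show ?case by (intro bexI[of _ "hcube a l"]) auto
next
  case (Suc k)
  note l = \<open>0 < l\<close>
  define E where "E = {x \<in> hcube a l. w a l < \<bar>g x - cc a l\<bar>}"
  define v where "v = l ^ CARD('n)"
  have v: "emeasure lebesgue (hcube a l) = ennreal v" "0 < v"
    unfolding v_def using l by (simp_all add: emeasure_hcube del: emeasure_completion)
  have [measurable]: "E \<in> sets lebesgue" unfolding E_def by simp
  obtain G where G: "open G" "E \<subseteq> G" "emeasure lebesgue G \<le> emeasure lebesgue E + ennreal (v / 2 ^ (CARD('n) + 3))"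
    using lebesgue_outer_open[of E "v / 2 ^ (CARD('n) + 3)"] v by auto
  have [measurable]: "G \<in> sets lebesgue" using G(1) by simp
  have "2 ^ (CARD('n) + 3) * emeasure lebesgue G
      \<le> 2 ^ (CARD('n) + 3) * (emeasure lebesgue E + ennreal (v / 2 ^ (CARD('n) + 3)))"
    by (intro mult_left_mono G(3)) simp
  also have "\<dots> = 2 ^ (CARD('n) + 3) * emeasure lebesgue E + 2 ^ (CARD('n) + 3) * ennreal (v / 2 ^ (CARD('n) + 3))"
    by (rule distrib_left)
  also have "2 ^ (CARD('n) + 3) * ennreal (v / 2 ^ (CARD('n) + 3)) = ennreal v"
    unfolding two_power_ennreal using v(2) by (subst ennreal_mult'[symmetric]) auto
  also have "2 ^ (CARD('n) + 3) * emeasure lebesgue E + ennreal v \<le> ennreal v + ennreal v"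
    using osc[OF l, of a] unfolding v E_def by (intro add_right_mono)
  also have "\<dots> = 2 * ennreal v" by (simp add: mult_2)
  finally have "2 * (2 ^ (CARD('n) + 2) * emeasure lebesgue G) \<le> 2 * ennreal v"
    by (simp add: power_add mult_ac)
  then have Gv: "2 ^ (CARD('n) + 2) * emeasure lebesgue G \<le> ennreal v"
    by (subst (asm) ennreal_mult_le_mult_iff) auto
  have "2 * (2 ^ (CARD('n) + 1) * emeasure lebesgue (G \<inter> hcube a l)) \<le> 2 ^ (CARD('n) + 2) * emeasure lebesgue G"
  proof -
    have "emeasure lebesgue (G \<inter> hcube a l) \<le> emeasure lebesgue G" by (intro emeasure_mono) auto
    then have "2 ^ (CARD('n) + 2) * emeasure lebesgue (G \<inter> hcube a l) \<le> 2 ^ (CARD('n) + 2) * emeasure lebesgue G"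
      by (rule mult_left_mono) simp
    then show ?thesis by (simp add: mult.assoc[symmetric])
  qed
  with Gv have GP: "2 * (2 ^ (CARD('n) + 1) * emeasure lebesgue (G \<inter> hcube a l)) \<le> ennreal v" by (rule order_trans[rotated])
  have "2 ^ (CARD('n) + 1) * emeasure lebesgue (G \<inter> hcube a l) \<le> emeasure lebesgue (hcube a l)"
    unfolding v by (rule order_trans[OF _ GP]) (simp only: mult_2 add_increasing2 zero_le order_refl)
  then obtain H where H: "H \<in> sets lebesgue"
    "2 ^ k * emeasure lebesgue H \<le> 2 ^ (CARD('n) + 1) * emeasure lebesgue (G \<inter> hcube a l)"
    "\<And>x. x \<in> G \<inter> hcube a l \<Longrightarrow> x \<notin> H \<Longrightarrow> \<exists>b m. 0 < m \<and> x \<in> hcube b m \<and> hcube b m \<subseteq> hcube a l \<and>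
      2 * emeasure lebesgue (G \<inter> hcube b m) \<le> emeasure lebesgue (hcube b m) \<and> \<not> 2 * real k * W x < \<bar>g x - cc b m\<bar>"
    using stopping_cover[OF l G(1) _ Suc.IH] by metis
  have "2 ^ Suc k * emeasure lebesgue H = 2 * (2 ^ k * emeasure lebesgue H)" by (simp add: mult.assoc)
  also have "\<dots> \<le> 2 * (2 ^ (CARD('n) + 1) * emeasure lebesgue (G \<inter> hcube a l))"
    by (intro mult_left_mono H(2)) simp
  also note GP
  finally have "2 ^ Suc k * emeasure lebesgue H \<le> emeasure lebesgue (hcube a l)" unfolding v .
  moreover have "{x \<in> hcube a l. 2 * real (Suc k) * W x < \<bar>g x - cc a l\<bar>} \<subseteq> H"
  proof
    fix x assume "x \<in> {x \<in> hcube a l. 2 * real (Suc k) * W x < \<bar>g x - cc a l\<bar>}"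
    then have x: "x \<in> hcube a l" "2 * real (Suc k) * W x < \<bar>g x - cc a l\<bar>" by auto
    \<comment> \<open>From one generation on, the threshold is at least \<open>W x\<close> and hence
      at least \<open>w a l\<close>, so a large deviation puts \<open>x\<close> into the exceptional
      set \<open>E\<close>.\<close>
    have "1 * W x \<le> 2 * real (Suc k) * W x" using W_nonneg[of x] by (intro mult_right_mono) auto
    then have "w a l < \<bar>g x - cc a l\<bar>" using w_le[OF l x(1)] x(2) by linarith
    then have "x \<in> G \<inter> hcube a l" using x(1) G(2) by (auto simp: E_def)
    show "x \<in> H"
    proof (rule ccontr)
      assume "x \<notin> H"
      then obtain b m where bm: "0 < m" "x \<in> hcube b m" "hcube b m \<subseteq> hcube a l"
        "2 * emeasure lebesgue (G \<inter> hcube b m) \<le> emeasure lebesgue (hcube b m)" "\<not> 2 * real k * W x < \<bar>g x - cc b m\<bar>"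
        using H(3)[OF \<open>x \<in> G \<inter> hcube a l\<close>] by blast
      obtain y where y: "y \<in> hcube b m" "y \<notin> G" "\<bar>g y - cc b m\<bar> \<le> w b m"
        using typical_point[OF bm(1) _ bm(4)] by auto
      have "y \<notin> E" using y(2) G(2) by blast
      then have "\<bar>g y - cc a l\<bar> \<le> w a l" using y(1) bm(3) by (auto simp: E_def)
      then have "\<bar>cc b m - cc a l\<bar> \<le> 2 * W x"
        using y(3) w_le[OF l x(1)] w_le[OF bm(1,2)] by linarith
      moreover have "2 * real (Suc k) * W x = 2 * W x + 2 * real k * W x" by (simp add: algebra_simps)
      ultimately show False using x(2) bm(5) by linarith
    qed
  qed
  ultimately show ?case using H(1) by blast
qed

text \<open>Let \<open>G\<close> be an open cover of the set where \<open>\<bar>g\<bar>\<close>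
  exceeds \<open>s\<close>, of at most twice its measure. If \<open>G\<close> fills a large part of
  the cube, the decay on the whole cube suffices, its centre being 0. Otherwise the decay is used on
  the cubes selected from \<open>G\<close>: each contains a point off \<open>G\<close>, where
  \<open>\<bar>g\<bar>\<close> is at most \<open>s\<close>, so its centre is at most
  \<open>s + W x\<close> in modulus and a value above \<open>2 * s\<close> deviates from it by
  nearly \<open>s\<close>.\<close>

lemma good_lambda:
  assumes l: "0 < l" and cc0: "cc a l = 0" and lam: "0 < s"
  shows "2 ^ k * emeasure lebesgue {x \<in> hcube a l. 2 * s < \<bar>g x\<bar> \<and> W x \<le> s / real (2 * k + 1)}
    \<le> 2 ^ (CARD('n) + 2) * emeasure lebesgue {x \<in> hcube a l. s < \<bar>g x\<bar>}" (is "_ * emeasure _ ?A \<le> _ * emeasure _ ?E")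
proof -
  \<comment> \<open>Chosen so that \<open>2 * k * \<gamma> = 1 - \<gamma>\<close>: if
    \<open>W x \<le> \<gamma> * s\<close>, a deviation of more than
    \<open>(1 - \<gamma>) * s\<close> exceeds the threshold \<open>2 * k * W x\<close>.\<close>
  define \<gamma> where "\<gamma> = 1 / real (2 * k + 1)"
  have \<gamma>: "1 - \<gamma> = 2 * real k * \<gamma>" "0 < \<gamma>" "\<gamma> \<le> 1" by (auto simp: \<gamma>_def field_simps)
  have A: "?A = {x \<in> hcube a l. 2 * s < \<bar>g x\<bar> \<and> W x \<le> \<gamma> * s}" by (simp add: \<gamma>_def)
  have E': "?E = hcube a l \<inter> {x \<in> space lebesgue. s < \<bar>g x\<bar>}" by auto
  have Es [measurable]: "?E \<in> sets lebesgue" unfolding E' by measurable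
  show ?thesis
  proof (cases "emeasure lebesgue ?E = 0")
    case True
    have "emeasure lebesgue ?A \<le> emeasure lebesgue ?E" using lam by (intro emeasure_mono Es) auto
    then show ?thesis using True by simp
  next
    case False
    have "emeasure lebesgue ?E \<le> emeasure lebesgue (hcube a l)" by (intro emeasure_mono) auto
    then have "emeasure lebesgue ?E < \<infinity>"
      unfolding emeasure_hcube[OF less_imp_le[OF l]] by (rule le_less_trans) simp
    then obtain e where e: "emeasure lebesgue ?E = ennreal e" "0 \<le> e"
      unfolding infinity_ennreal_def less_top_ennreal by blast
    then have "0 < e" using False by (metis ennreal_0 less_eq_real_def)
    obtain G where G: "open G" "?E \<subseteq> G" "emeasure lebesgue G \<le> emeasure lebesgue ?E + ennreal e"
      using lebesgue_outer_open[OF Es \<open>0 < e\<close>] by blast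
    have [measurable]: "G \<in> sets lebesgue" using G(1) by simp
    have "emeasure lebesgue (G \<inter> hcube a l) \<le> emeasure lebesgue G" by (intro emeasure_mono) auto
    also have "\<dots> \<le> 2 * emeasure lebesgue ?E" using G(3) e by (simp add: mult_2)
    finally have *: "2 ^ (CARD('n) + 1) * emeasure lebesgue (G \<inter> hcube a l) \<le> 2 ^ (CARD('n) + 1) * (2 * emeasure lebesgue ?E)"
      by (rule mult_left_mono) simp
    then have GE: "2 ^ (CARD('n) + 1) * emeasure lebesgue (G \<inter> hcube a l) \<le> 2 ^ (CARD('n) + 2) * emeasure lebesgue ?E"
    proof -
      have "(2::ennreal) ^ (CARD('n) + 2) = 2 ^ (CARD('n) + 1) * 2" by (simp add: mult.commute)
      with * show ?thesis by (simp only: mult.assoc)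
    qed
    show ?thesis
    proof (cases "2 ^ (CARD('n) + 1) * emeasure lebesgue (G \<inter> hcube a l) \<le> emeasure lebesgue (hcube a l)")
      case False
      obtain H where H: "H \<in> sets lebesgue" "{x \<in> hcube a l. 2 * real k * W x < \<bar>g x - cc a l\<bar>} \<subseteq> H"
        "2 ^ k * emeasure lebesgue H \<le> emeasure lebesgue (hcube a l)"
        using oscillation_decay[OF l, of a k] by blast
      have "?A \<subseteq> H"
      proof
        fix x assume x: "x \<in> ?A"
        then have "2 * real k * W x \<le> 2 * real k * (\<gamma> * s)" unfolding A by (intro mult_left_mono) auto
        also have "\<dots> = (1 - \<gamma>) * s" unfolding \<gamma>(1) by simp
        also have "\<dots> \<le> 1 * s" using \<gamma> lam by (intro mult_right_mono) auto
        also have "\<dots> < \<bar>g x\<bar>" using x lam by auto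
        finally show "x \<in> H" using x H(2) cc0 by auto
      qed
      then have "2 ^ k * emeasure lebesgue ?A \<le> 2 ^ k * emeasure lebesgue H"
        using H(1) by (intro mult_left_mono emeasure_mono) auto
      also note H(3)
      also have "emeasure lebesgue (hcube a l) \<le> 2 ^ (CARD('n) + 1) * emeasure lebesgue (G \<inter> hcube a l)"
        using False by simp
      also note GE
      finally show ?thesis .
    next
      case True
      then obtain H where H: "H \<in> sets lebesgue"
        "2 ^ k * emeasure lebesgue H \<le> 2 ^ (CARD('n) + 1) * emeasure lebesgue (G \<inter> hcube a l)"
        "\<And>x. x \<in> G \<inter> hcube a l \<Longrightarrow> x \<notin> H \<Longrightarrow> \<exists>b m. 0 < m \<and> x \<in> hcube b m \<and> hcube b m \<subseteq> hcube a l \<and>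
          2 * emeasure lebesgue (G \<inter> hcube b m) \<le> emeasure lebesgue (hcube b m) \<and> \<not> 2 * real k * W x < \<bar>g x - cc b m\<bar>"
        using stopping_cover[OF l G(1) _ oscillation_decay] by metis
      have "?A \<subseteq> H"
      proof (rule subsetI, rule ccontr)
        fix x assume xA: "x \<in> ?A" and "x \<notin> H"
        then have x: "x \<in> hcube a l" "2 * s < \<bar>g x\<bar>" "W x \<le> \<gamma> * s" unfolding A by auto
        then have "x \<in> G \<inter> hcube a l" using G(2) lam by auto
        then obtain b m where bm: "0 < m" "x \<in> hcube b m" "hcube b m \<subseteq> hcube a l"
          "2 * emeasure lebesgue (G \<inter> hcube b m) \<le> emeasure lebesgue (hcube b m)" "\<not> 2 * real k * W x < \<bar>g x - cc b m\<bar>"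
          using H(3) \<open>x \<notin> H\<close> by blast
        obtain y where y: "y \<in> hcube b m" "y \<notin> G" "\<bar>g y - cc b m\<bar> \<le> w b m"
          using typical_point[OF bm(1) _ bm(4)] by auto
        have "\<bar>g y\<bar> \<le> s" using y(1,2) G(2) bm(3) by fastforce
        then have "\<bar>cc b m\<bar> \<le> s + \<gamma> * s" using y(3) w_le[OF bm(1,2)] x(3) by linarith
        moreover have "(1 - \<gamma>) * s = s - \<gamma> * s" by (simp add: algebra_simps)
        ultimately have "(1 - \<gamma>) * s < \<bar>g x - cc b m\<bar>" using x(2) by linarith
        moreover have "2 * real k * W x \<le> 2 * real k * (\<gamma> * s)" using x(3) by (intro mult_left_mono) auto
        moreover have "\<dots> = (1 - \<gamma>) * s" unfolding \<gamma>(1) by simp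
        ultimately show False using bm(5) by linarith
      qed
      then have "2 ^ k * emeasure lebesgue ?A \<le> 2 ^ k * emeasure lebesgue H"
        using H(1) by (intro mult_left_mono emeasure_mono) auto
      also note H(2)
      also note GE
      finally show ?thesis .
    qed
  qed
qed

end

section \<open>The Calderon--Zygmund decomposition\<close>

lemma markov_strict:
  assumes [measurable]: "u \<in> borel_measurable M" and t: "0 \<le> t"
  shows "ennreal t * emeasure M {x \<in> space M. t < u x} \<le> (\<integral>\<^sup>+x. ennreal (u x) \<partial>M)"
proof -
  have "ennreal t * emeasure M {x \<in> space M. t < u x} = (\<integral>\<^sup>+x. ennreal t * indicator {x \<in> space M. t < u x} x \<partial>M)"
    by (rule nn_integral_cmult_indicator[symmetric]) measurable
  also have "\<dots> \<le> (\<integral>\<^sup>+x. ennreal (u x) \<partial>M)"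
    using t by (intro nn_integral_mono) (auto simp: indicator_def intro: ennreal_leI)
  finally show ?thesis .
qed

lemma cball_subset_cube: "cball z r \<subseteq> cbox (z - r *\<^sub>R One) (z - r *\<^sub>R One + (2 * r) *\<^sub>R One)" for z :: "real ^ 'n"
proof
  fix x assume "x \<in> cball z r"
  then have "norm (z - x) \<le> r" by (simp add: dist_norm)
  then have "\<bar>(z - x) $ i\<bar> \<le> r" for i using component_le_norm_cart[of "z - x" i] by linarith
  then have "\<bar>z $ i - x $ i\<bar> \<le> r" for i by simp
  then have "z $ i - r \<le> x $ i \<and> x $ i \<le> z $ i - r + 2 * r" for i
    using abs_le_D1[of "z $ i - x $ i" r] abs_le_D2[of "z $ i - x $ i" r] by (auto simp: algebra_simps)
  then show "x \<in> cbox (z - r *\<^sub>R One) (z - r *\<^sub>R One + (2 * r) *\<^sub>R One)"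
    unfolding mem_cube_iff by simp
qed

lemma emeasure_cball_le:
  fixes z :: "real ^ 'n"
  assumes "0 \<le> r"
  shows "emeasure lebesgue (cball z r) \<le> ennreal ((2 * r) ^ CARD('n))"
proof -
  have "emeasure lebesgue (cball z r) \<le> emeasure lebesgue (cbox (z - r *\<^sub>R One) (z - r *\<^sub>R One + (2 * r) *\<^sub>R One))"
    by (intro emeasure_mono cball_subset_cube) auto
  also have "\<dots> = ennreal ((2 * r) ^ CARD('n))" using assms by (intro emeasure_cube) simp
  finally show ?thesis .
qed

text \<open>The weight is split over the dyadic annuli around \<open>z\<close>.\<close>

lemma nn_integral_tail_weight:
  fixes z :: "real ^ 'n" and F :: "real ^ 'n \<Rightarrow> ennreal"
  assumes [measurable]: "F \<in> borel_measurable lebesgue" and \<rho>: "0 < \<rho>" and \<epsilon>: "0 < \<epsilon>" and m: "0 \<le> m"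
    and avg: "\<And>r. \<rho> \<le> r \<Longrightarrow> (\<integral>\<^sup>+x. F x * indicator (cball z r) x \<partial>lebesgue) \<le> ennreal (m * r ^ CARD('n))"
  shows "(\<integral>\<^sup>+x. ennreal (indicator {x. \<rho> < norm (x - z)} x * (\<rho> powr \<epsilon> / norm (x - z) powr (real CARD('n) + \<epsilon>))) * F x \<partial>lebesgue)
    \<le> ennreal (m * (2 ^ CARD('n) / (1 - 2 powr - \<epsilon>)))"
proof -
  define n where "n = CARD('n)"
  \<comment> \<open>Bound of the weight on the annulus between the radii \<open>2^k * \<rho>\<close>
    and \<open>2^(k+1) * \<rho>\<close>. Multiplied by the mass
    \<open>m * (2^(k+1) * \<rho>)^n\<close> of the larger ball it becomes \<open>m * 2^n\<close>
    times the \<open>k\<close>-th power of \<open>2 powr - \<epsilon>\<close>, the term of a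
    convergent geometric series.\<close>
  define u where "u k = inverse (\<rho> ^ n) * (2 powr - (real n + \<epsilon>)) ^ k" for k
  have [measurable]: "cball z r \<in> sets lebesgue" for r by simp
  have u_pos: "0 \<le> u k" for k using \<rho> by (simp add: u_def)
  have pt: "ennreal (indicator {x. \<rho> < norm (x - z)} x * (\<rho> powr \<epsilon> / norm (x - z) powr (real n + \<epsilon>))) * F x
      \<le> (\<Sum>k. ennreal (u k) * (F x * indicator (cball z (2 ^ Suc k * \<rho>)) x))" for x
  proof (cases "\<rho> < norm (x - z)")
    case True
    define d where "d = norm (x - z)"
    have d: "\<rho> < d" "0 < d" using True \<rho> by (auto simp: d_def)
    have "\<exists>k. d \<le> 2 ^ Suc k * \<rho>"
    proof -
      obtain k where "d / \<rho> < 2 ^ k" using real_arch_pow[of 2 "d / \<rho>"] by auto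
      then have "d < 2 ^ k * \<rho>" using \<rho> by (simp add: field_simps)
      also have "\<dots> \<le> 2 ^ Suc k * \<rho>" using \<rho> by simp
      finally show ?thesis by (intro exI[of _ k]) simp
    qed
    define k where "k = (LEAST k. d \<le> 2 ^ Suc k * \<rho>)"
    have k1: "d \<le> 2 ^ Suc k * \<rho>" unfolding k_def by (rule LeastI_ex) fact
    have k2: "2 ^ k * \<rho> \<le> d"
    proof (cases k)
      case 0
      then show ?thesis using d by simp
    next
      case (Suc j)
      then have "\<not> d \<le> 2 ^ Suc j * \<rho>" using not_less_Least[of j "\<lambda>k. d \<le> 2 ^ Suc k * \<rho>"] k_def by simp
      then show ?thesis using Suc by simp
    qed
    have "(2 ^ k * \<rho>) powr (real n + \<epsilon>) \<le> d powr (real n + \<epsilon>)"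
      using k2 \<rho> \<epsilon> by (intro powr_mono2) auto
    then have "\<rho> powr \<epsilon> / d powr (real n + \<epsilon>) \<le> \<rho> powr \<epsilon> / (2 ^ k * \<rho>) powr (real n + \<epsilon>)"
      using \<rho> d by (intro divide_left_mono) auto
    also have "\<dots> = u k"
    proof -
      have "(2 ^ k * \<rho>) powr (real n + \<epsilon>) = ((2::real) ^ k) powr (real n + \<epsilon>) * (\<rho> powr real n * \<rho> powr \<epsilon>)"
        using \<rho> by (simp add: powr_mult powr_add)
      also have "((2::real) ^ k) powr (real n + \<epsilon>) = (2 powr (real n + \<epsilon>)) ^ k"
        by (simp add: powr_realpow[symmetric] powr_powr mult.commute)
      also have "\<rho> powr real n = \<rho> ^ n" using \<rho> by (simp add: powr_realpow)
      finally have e: "(2 ^ k * \<rho>) powr (real n + \<epsilon>) = (2 powr (real n + \<epsilon>)) ^ k * (\<rho> ^ n * \<rho> powr \<epsilon>)" .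
      have "0 < \<rho> powr \<epsilon>" "0 < \<rho> ^ n" using \<rho> by auto
      then show ?thesis unfolding u_def e powr_minus power_inverse[symmetric]
        by (simp add: field_simps)
    qed
    finally have "\<rho> powr \<epsilon> / d powr (real n + \<epsilon>) \<le> u k" .
    then have "ennreal (indicator {x. \<rho> < norm (x - z)} x * (\<rho> powr \<epsilon> / norm (x - z) powr (real n + \<epsilon>))) * F x
      \<le> ennreal (u k) * (F x * indicator (cball z (2 ^ Suc k * \<rho>)) x)"
      using True k1 by (auto simp: d_def[symmetric] dist_norm norm_minus_commute intro!: mult_right_mono ennreal_leI)
    also have "\<dots> \<le> (\<Sum>k. ennreal (u k) * (F x * indicator (cball z (2 ^ Suc k * \<rho>)) x))"
      using sum_le_suminf[of "\<lambda>k. ennreal (u k) * (F x * indicator (cball z (2 ^ Suc k * \<rho>)) x)" "{k}"] by simp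
    finally show ?thesis .
  qed simp
  have r: "0 < 2 powr - \<epsilon>" "2 powr - \<epsilon> < 1" using \<epsilon> powr_less_mono[of "- \<epsilon>" 0 2] by auto
  have "(\<integral>\<^sup>+x. ennreal (indicator {x. \<rho> < norm (x - z)} x * (\<rho> powr \<epsilon> / norm (x - z) powr (real n + \<epsilon>))) * F x \<partial>lebesgue)
      \<le> (\<integral>\<^sup>+x. (\<Sum>k. ennreal (u k) * (F x * indicator (cball z (2 ^ Suc k * \<rho>)) x)) \<partial>lebesgue)"
    by (intro nn_integral_mono pt)
  also have "\<dots> = (\<Sum>k. \<integral>\<^sup>+x. ennreal (u k) * (F x * indicator (cball z (2 ^ Suc k * \<rho>)) x) \<partial>lebesgue)"
    by (rule nn_integral_suminf) measurable
  also have "\<dots> \<le> (\<Sum>k. ennreal (m * 2 ^ n * (2 powr - \<epsilon>) ^ k))"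
  proof (rule suminf_le)
    fix k
    have "(\<integral>\<^sup>+x. ennreal (u k) * (F x * indicator (cball z (2 ^ Suc k * \<rho>)) x) \<partial>lebesgue)
        = ennreal (u k) * (\<integral>\<^sup>+x. F x * indicator (cball z (2 ^ Suc k * \<rho>)) x \<partial>lebesgue)"
      by (rule nn_integral_cmult) measurable
    also have "\<dots> \<le> ennreal (u k) * ennreal (m * (2 ^ Suc k * \<rho>) ^ n)"
      unfolding n_def
    proof (intro mult_left_mono avg)
      have "1 * \<rho> \<le> 2 ^ Suc k * \<rho>" using \<rho> by (intro mult_right_mono one_le_power) auto
      then show "\<rho> \<le> 2 ^ Suc k * \<rho>" by simp
    qed simp
    also have "\<dots> = ennreal (u k * (m * (2 ^ Suc k * \<rho>) ^ n))"
      using u_pos by (simp add: ennreal_mult')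
    also have "u k * (m * (2 ^ Suc k * \<rho>) ^ n) = m * 2 ^ n * (2 powr - \<epsilon>) ^ k"
    proof -
      have "(2 powr - (real n + \<epsilon>)) = inverse (2 ^ n) * 2 powr - \<epsilon>"
      proof -
        have "(2::real) powr (- (real n + \<epsilon>)) = 2 powr (- real n) * 2 powr - \<epsilon>"
          by (simp add: powr_add[symmetric])
        also have "(2::real) powr (- real n) = inverse (2 ^ n)" by (simp add: powr_minus powr_realpow)
        finally show ?thesis .
      qed
      then have "u k = inverse (\<rho> ^ n) * (inverse (2 ^ n)) ^ k * (2 powr - \<epsilon>) ^ k"
        by (simp add: u_def power_mult_distrib mult.assoc)
      moreover have "(2 ^ Suc k * \<rho>) ^ n = 2 ^ n * (2 ^ n) ^ k * \<rho> ^ n"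
        by (simp add: power_mult_distrib power_mult[symmetric] mult.commute)
      moreover have "(inverse (2 ^ n)) ^ k * (2 ^ n) ^ k = (1::real)"
        by (simp add: power_mult_distrib[symmetric])
      ultimately show ?thesis using \<rho> by (simp add: field_simps)
    qed
    finally show "(\<integral>\<^sup>+x. ennreal (u k) * (F x * indicator (cball z (2 ^ Suc k * \<rho>)) x) \<partial>lebesgue)
      \<le> ennreal (m * 2 ^ n * (2 powr - \<epsilon>) ^ k)" .
  qed auto
  also have "\<dots> = ennreal (\<Sum>k. m * 2 ^ n * (2 powr - \<epsilon>) ^ k)"
    using r m by (intro suminf_ennreal2 summable_mult summable_geometric) auto
  also have "(\<Sum>k. m * 2 ^ n * (2 powr - \<epsilon>) ^ k) = m * 2 ^ n * (1 / (1 - 2 powr - \<epsilon>))"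
    using r by (subst suminf_mult) (auto simp: suminf_geometric summable_geometric)
  finally show ?thesis by (simp add: n_def)
qed

lemma sum_indicator_disjoint:
  assumes "finite S" "disjoint S"
  shows "(\<Sum>R\<in>S. indicator R x) = (indicator (\<Union>S) x :: real)"
  using assms
  by (subst indicator_UN_disjoint[symmetric]) (auto simp: disjoint_family_on_def disjoint_def)

lemma sum_integral_disjoint_le:
  fixes F :: "'a \<Rightarrow> real"
  assumes S: "finite S" "disjoint S" "\<And>R. R \<in> S \<Longrightarrow> R \<in> sets M"
    and F: "integrable M F" "\<And>x. 0 \<le> F x"
  shows "(\<Sum>R\<in>S. LINT x|M. indicator R x * F x) \<le> (LINT x|M. F x)"
proof -
  have int: "integrable M (\<lambda>x. indicator R x * F x)" if "R \<in> sets M" for R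
    using integrable_mult_indicator[OF that F(1)] by simp
  have "(\<Sum>R\<in>S. LINT x|M. indicator R x * F x) = (LINT x|M. (\<Sum>R\<in>S. indicator R x * F x))"
    using int S(3) by (intro Bochner_Integration.integral_sum[symmetric]) auto
  also have "\<dots> \<le> (LINT x|M. F x)"
  proof (intro integral_mono Bochner_Integration.integrable_sum int S(3) F(1))
    show "(\<Sum>R\<in>S. indicator R x * F x) \<le> F x" for x
      unfolding sum_distrib_right[symmetric] sum_indicator_disjoint[OF S(1,2)]
      using F(2)[of x] by (auto simp: indicator_def)
  qed
  finally show ?thesis .
qed

lemma measure_hcube: "0 \<le> l \<Longrightarrow> measure lebesgue (hcube a l) = l ^ CARD('n)" for a :: "real ^ 'n"
  unfolding measure_def by (simp only: emeasure_hcube enn2real_ennreal zero_le_power)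

lemma lmeasurable_hcube [simp]: "hcube a l \<in> lmeasurable"
  using bounded_hcube hcube_sets_lebesgue by (rule bounded_set_imp_lmeasurable)

lemma sum_measure_disjoint_le:
  assumes S: "finite S" "disjoint S" "\<And>R. R \<in> S \<Longrightarrow> R \<in> sets lebesgue" and G: "G \<in> lmeasurable"
  shows "(\<Sum>R\<in>S. measure lebesgue (G \<inter> R)) \<le> measure lebesgue G"
proof -
  have "(\<Sum>R\<in>S. measure lebesgue (G \<inter> R)) = (\<Sum>R\<in>S. LINT x|lebesgue. indicator R x * indicator G x)"
    by (intro sum.cong refl) (simp add: indicator_inter_arith[symmetric] Int_commute)
  also have "\<dots> \<le> (LINT x|lebesgue. indicator G x)"
    using G by (intro sum_integral_disjoint_le S) (auto simp: lmeasurable_iff_integrable)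
  finally show ?thesis by simp
qed

text \<open>Stopping on \<open>G\<close> as well as on large averages makes \<open>F \<le> s\<close> hold off the selected cubes
  pointwise, so that Lebesgue's differentiation theorem is not needed.\<close>

lemma cz_cubes:
  fixes F :: "real ^ 'n \<Rightarrow> real"
  assumes F: "integrable lebesgue F" "\<And>x. 0 \<le> F x" and s: "0 < s" and \<eta>: "0 < \<eta>" and \<delta>: "0 < \<delta>"
  obtains S bb mm U where "finite S" "disjoint S" "\<And>R. R \<in> S \<Longrightarrow> R = hcube (bb R) (mm R) \<and> 0 < mm R"
    "(\<Sum>R\<in>S. mm R ^ CARD('n)) \<le> 3 * ((LINT x|lebesgue. F x) + \<eta>) / s"
    "\<And>R. R \<in> S \<Longrightarrow> (LINT x|lebesgue. indicator R x * F x) \<le> 2 ^ CARD('n) * s * mm R ^ CARD('n)"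
    "U \<in> sets lebesgue" "U \<inter> \<Union>S = {}" "emeasure lebesgue U \<le> ennreal \<delta>"
    "\<And>x. x \<notin> \<Union>S \<union> U \<Longrightarrow> F x \<le> s"
proof -
  have Fm [measurable]: "F \<in> borel_measurable lebesgue" using F(1) by (rule borel_measurable_integrable)
  define I where "I = (LINT x|lebesgue. F x)"
  define J where "J = I + \<eta>"
  have I: "0 \<le> I" unfolding I_def using F(2) by (simp add: integral_nonneg_AE)
  have J: "0 < J" "I \<le> J" using I \<eta> by (auto simp: J_def)
  define E where "E = {x. s < F x}"
  have E' : "E = {x \<in> space lebesgue. s < F x}" by (simp add: E_def)
  have [measurable]: "E \<in> sets lebesgue" unfolding E' by measurable
  have "ennreal s * emeasure lebesgue E \<le> (\<integral>\<^sup>+x. ennreal (F x) \<partial>lebesgue)"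
    unfolding E' using s by (intro markov_strict) auto
  also have "\<dots> = ennreal I" unfolding I_def using F by (intro nn_integral_eq_integral) auto
  finally have sE: "ennreal s * emeasure lebesgue E \<le> ennreal I" .
  obtain G where G: "open G" "E \<subseteq> G" "emeasure lebesgue G \<le> emeasure lebesgue E + ennreal (\<eta> / s)"
    using lebesgue_outer_open[of E "\<eta> / s"] s \<eta> by auto
  have "ennreal s * emeasure lebesgue G \<le> ennreal s * (emeasure lebesgue E + ennreal (\<eta> / s))"
    by (intro mult_left_mono G(3)) simp
  also have "\<dots> = ennreal s * emeasure lebesgue E + ennreal \<eta>"
    using s \<eta> by (simp add: distrib_left ennreal_mult'[symmetric])
  also have "\<dots> \<le> ennreal I + ennreal \<eta>" by (intro add_right_mono sE)
  also have "\<dots> = ennreal J" using I \<eta> by (simp add: J_def)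
  finally have sG: "ennreal s * emeasure lebesgue G \<le> ennreal J" .
  have Gfin: "emeasure lebesgue G < \<infinity>"
  proof (rule ccontr)
    assume "\<not> emeasure lebesgue G < \<infinity>"
    then have "emeasure lebesgue G = top" by (simp add: less_top[symmetric])
    then show False using sG s by (simp add: ennreal_mult_top top_unique)
  qed
  then have Glm: "G \<in> lmeasurable" using G(1) by (intro fmeasurableI) auto
  have mG: "s * measure lebesgue G \<le> J"
  proof -
    have "ennreal (s * measure lebesgue G) \<le> ennreal J"
      using sG s unfolding emeasure_eq_measure2[OF Glm] by (simp add: ennreal_mult')
    then show ?thesis using J by (simp add: ennreal_le_iff)
  qed
  \<comment> \<open>The grid is taken so coarse that no cube of generation 0 is bad: its volume
    exceeds \<open>2 * J / s\<close>, while \<open>F\<close> has integral at most \<open>J\<close>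
    and \<open>G\<close> has measure at most \<open>J / s\<close>.\<close>
  define l where "l = 1 + 2 * J / s"
  have l: "1 \<le> l" "0 < l" using J s by (auto simp: l_def intro: add_pos_nonneg)
  have "l ^ 1 \<le> l ^ CARD('n)" using l by (intro power_increasing) auto
  then have ln: "2 * J / s < l ^ CARD('n)" by (simp add: l_def)
  define bad where "bad R \<longleftrightarrow> s * measure lebesgue R < (LINT x|lebesgue. indicator R x * F x) \<or>
    measure lebesgue R < 2 * measure lebesgue (G \<inter> R)" for R
  have intR: "integrable lebesgue (\<lambda>x. indicator R x * F x)" if "R \<in> sets lebesgue" for R
    using integrable_mult_indicator[OF that F(1)] by simp
  have bad0: "\<not> bad (dyadic 0 l 0 x)" for x
  proof -
    obtain b where b: "dyadic 0 l 0 x = hcube b l" using dyadic_hcube[OF l(2), of 0 0 x] by auto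
    have m: "measure lebesgue (dyadic 0 l 0 x) = l ^ CARD('n)" unfolding b using l by (intro measure_hcube) simp
    have "(LINT x|lebesgue. indicator (hcube b l) x * F x) \<le> I"
      unfolding I_def using F by (intro integral_mono intR) (auto simp: indicator_def)
    also have "\<dots> \<le> s * (2 * J / s)" using J s by simp
    also have "\<dots> \<le> s * l ^ CARD('n)" using ln s by (intro mult_left_mono) auto
    finally have 1: "(LINT x|lebesgue. indicator (hcube b l) x * F x) \<le> s * l ^ CARD('n)" .
    have "measure lebesgue (G \<inter> hcube b l) \<le> measure lebesgue G"
      by (rule measure_mono_fmeasurable) (use Glm in auto)
    also have "\<dots> \<le> J / s" using mG s by (simp add: field_simps)
    finally have "2 * measure lebesgue (G \<inter> hcube b l) \<le> l ^ CARD('n)" using ln by simp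
    with 1 show ?thesis using m unfolding bad_def b by simp
  qed
  obtain SS where SS: "countable SS" "disjoint SS"
    "\<And>R. R \<in> SS \<Longrightarrow> \<exists>k x. R = dyadic 0 l k x \<and> bad R \<and> (\<forall>j<k. \<not> bad (dyadic 0 l j x))"
    "\<And>k x. bad (dyadic 0 l k x) \<Longrightarrow> x \<in> \<Union>SS"
    by (rule dyadic_stopping[OF l(2), of 0 bad]) blast
  \<comment> \<open>Badness of \<open>R\<close> pays for its volume, either by the integral of
    \<open>F\<close> over \<open>R\<close> or by the part of \<open>G\<close> in \<open>R\<close>.
    That its parent is not bad keeps the mean of \<open>F\<close> on \<open>R\<close> at most
    \<open>2^n * s\<close>.\<close>
  have cube_ex: "\<exists>b m. R = hcube b m \<and> 0 < m \<and> s * m ^ CARD('n) \<le> (LINT x|lebesgue. indicator R x * F x) + 2 * s * measure lebesgue (G \<inter> R) \<and>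
     (LINT x|lebesgue. indicator R x * F x) \<le> 2 ^ CARD('n) * s * m ^ CARD('n)" if RS: "R \<in> SS" for R
  proof -
    obtain k x where kx: "R = dyadic 0 l k x" "bad R" "\<forall>j<k. \<not> bad (dyadic 0 l j x)" using SS(3)[OF RS] by blast
    then have "k \<noteq> 0" using bad0 by metis
    then obtain j where j: "k = Suc j" by (cases k) auto
    obtain b where b: "R = hcube b (l / 2 ^ k)" using dyadic_hcube[OF l(2)] kx(1) by blast
    obtain b' where b': "dyadic 0 l j x = hcube b' (l / 2 ^ j)" using dyadic_hcube[OF l(2)] by blast
    define m where "m = l / 2 ^ k"
    have m: "0 < m" using l by (simp add: m_def)
    have mR: "measure lebesgue R = m ^ CARD('n)" unfolding b m_def[symmetric] using m by (intro measure_hcube) simp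
    have mR': "measure lebesgue (dyadic 0 l j x) = 2 ^ CARD('n) * m ^ CARD('n)"
      unfolding b' using l by (subst measure_hcube) (auto simp: m_def j power_mult_distrib[symmetric])
    have sub: "R \<subseteq> dyadic 0 l j x" unfolding kx(1) j using l by (intro dyadic_antimono) auto
    have "(LINT x|lebesgue. indicator R x * F x) \<le> (LINT xa|lebesgue. indicator (dyadic 0 l j x) xa * F xa)"
      using F sub l b by (intro integral_mono intR dyadic_sets) (auto simp: indicator_def)
    also have "\<dots> \<le> s * (2 ^ CARD('n) * m ^ CARD('n))"
    proof -
      have "\<not> bad (dyadic 0 l j x)" using kx(3) j by simp
      then show ?thesis unfolding bad_def mR' by simp
    qed
    finally have 2: "(LINT x|lebesgue. indicator R x * F x) \<le> 2 ^ CARD('n) * s * m ^ CARD('n)" by (simp add: mult_ac)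
    have nn: "0 \<le> (LINT x|lebesgue. indicator R x * F x)" "0 \<le> 2 * s * measure lebesgue (G \<inter> R)"
      using F(2) s by (auto simp: integral_nonneg_AE)
    have "s * m ^ CARD('n) \<le> (LINT x|lebesgue. indicator R x * F x) + 2 * s * measure lebesgue (G \<inter> R)"
      using kx(2) unfolding bad_def mR
    proof
      assume "m ^ CARD('n) < 2 * measure lebesgue (G \<inter> R)"
      then have "s * m ^ CARD('n) < s * (2 * measure lebesgue (G \<inter> R))" using s by (rule mult_strict_left_mono)
      then show ?thesis using nn(1) by simp
    qed (use nn in simp)
    then show ?thesis using 2 b m unfolding m_def by blast
  qed
  have "\<forall>R\<in>SS. \<exists>p. R = hcube (fst p) (snd p) \<and> 0 < snd p \<and>
      s * snd p ^ CARD('n) \<le> (LINT x|lebesgue. indicator R x * F x) + 2 * s * measure lebesgue (G \<inter> R) \<and>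
      (LINT x|lebesgue. indicator R x * F x) \<le> 2 ^ CARD('n) * s * snd p ^ CARD('n)"
  proof
    fix R assume "R \<in> SS"
    from cube_ex[OF this] obtain b m where "R = hcube b m \<and> 0 < m \<and>
      s * m ^ CARD('n) \<le> (LINT x|lebesgue. indicator R x * F x) + 2 * s * measure lebesgue (G \<inter> R) \<and>
      (LINT x|lebesgue. indicator R x * F x) \<le> 2 ^ CARD('n) * s * m ^ CARD('n)" by (elim exE)
    then show "\<exists>p. R = hcube (fst p) (snd p) \<and> 0 < snd p \<and>
      s * snd p ^ CARD('n) \<le> (LINT x|lebesgue. indicator R x * F x) + 2 * s * measure lebesgue (G \<inter> R) \<and>
      (LINT x|lebesgue. indicator R x * F x) \<le> 2 ^ CARD('n) * s * snd p ^ CARD('n)"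
      by (intro exI[of _ "(b, m)"], unfold fst_conv snd_conv)
  qed
  from bchoice[OF this] obtain pp where pp: "\<forall>R\<in>SS. R = hcube (fst (pp R)) (snd (pp R)) \<and> 0 < snd (pp R) \<and>
      s * snd (pp R) ^ CARD('n) \<le> (LINT x|lebesgue. indicator R x * F x) + 2 * s * measure lebesgue (G \<inter> R) \<and>
      (LINT x|lebesgue. indicator R x * F x) \<le> 2 ^ CARD('n) * s * snd (pp R) ^ CARD('n)" ..
  define bb where "bb R = fst (pp R)" for R
  define mm where "mm R = snd (pp R)" for R
  have bm: "\<And>R. R \<in> SS \<Longrightarrow> R = hcube (bb R) (mm R)" "\<And>R. R \<in> SS \<Longrightarrow> 0 < mm R"
    "\<And>R. R \<in> SS \<Longrightarrow> s * mm R ^ CARD('n) \<le> (LINT x|lebesgue. indicator R x * F x) + 2 * s * measure lebesgue (G \<inter> R)"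
    "\<And>R. R \<in> SS \<Longrightarrow> (LINT x|lebesgue. indicator R x * F x) \<le> 2 ^ CARD('n) * s * mm R ^ CARD('n)"
    using pp unfolding bb_def mm_def by blast+
  have Rset: "R \<in> sets lebesgue" if "R \<in> SS" for R using bm(1)[OF that] hcube_sets_lebesgue by metis
  \<comment> \<open>The factor 3 counts one integral of \<open>F\<close> and two copies of
    \<open>s * measure lebesgue G\<close>, each of them at most \<open>J\<close>.\<close>
  have total: "(\<Sum>R\<in>S. mm R ^ CARD('n)) \<le> 3 * J / s" if S: "finite S" "S \<subseteq> SS" for S
  proof -
    have dS: "disjoint S" using SS(2) S(2) by (meson disjoint_def subsetD)
    have "s * (\<Sum>R\<in>S. mm R ^ CARD('n)) \<le> (\<Sum>R\<in>S. (LINT x|lebesgue. indicator R x * F x) + 2 * s * measure lebesgue (G \<inter> R))"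
      unfolding sum_distrib_left using bm(3) S(2) by (intro sum_mono) auto
    also have "\<dots> = (\<Sum>R\<in>S. LINT x|lebesgue. indicator R x * F x) + 2 * s * (\<Sum>R\<in>S. measure lebesgue (G \<inter> R))"
      by (simp add: sum.distrib sum_distrib_left)
    also have "\<dots> \<le> I + 2 * s * measure lebesgue G"
      unfolding I_def using S dS Rset F Glm s
      by (intro add_mono mult_left_mono sum_integral_disjoint_le sum_measure_disjoint_le) auto
    also have "\<dots> \<le> 3 * J" using mG J by simp
    finally show ?thesis using s by (simp add: field_simps)
  qed
  define B where "B = (\<lambda>i. if SS = {} then {} else from_nat_into SS i)"
  have Bin: "B i \<in> SS" if "SS \<noteq> {}" for i using that from_nat_into[OF that] by (simp add: B_def)
  have BU: "(\<Union>i. B i) = \<Union>SS"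
    using range_from_nat_into[OF _ SS(1)] by (cases "SS = {}") (auto simp: B_def)
  have Bs: "B i \<in> sets lebesgue" for i using Bin[of i] Rset by (cases "SS = {}") (auto simp: B_def)
  \<comment> \<open>The selection may be infinite, whereas linearity of the operator gives
    additivity over finite sums. \<open>V k\<close> is what the first \<open>k\<close> cubes leave
    uncovered; its measure tends to 0 because all selected cubes together have finite
    measure.\<close>
  define V where "V = (\<lambda>k. \<Union>SS - (\<Union>i<k. B i))"
  have SSs: "\<Union>SS \<in> sets lebesgue" unfolding BU[symmetric] using Bs by auto
  have Vs: "V k \<in> sets lebesgue" for k unfolding V_def using SSs Bs by auto
  have part: "emeasure lebesgue (\<Union>i<k. B i) \<le> ennreal (3 * J / s)" for k
  proof (cases "SS = {}")
    case False
    define S where "S = B ` {..<k}"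
    have S: "finite S" "S \<subseteq> SS" using Bin[OF False] by (auto simp: S_def)
    have "emeasure lebesgue (\<Union>R\<in>S. R) \<le> (\<Sum>R\<in>S. emeasure lebesgue R)"
      using S Rset by (intro emeasure_subadditive_finite) auto
    also have "\<dots> = (\<Sum>R\<in>S. ennreal (mm R ^ CARD('n)))"
    proof (intro sum.cong refl)
      fix R assume "R \<in> S"
      then have R: "R \<in> SS" using S by blast
      show "emeasure lebesgue R = ennreal (mm R ^ CARD('n))"
        using emeasure_hcube[of "mm R" "bb R"] bm(1,2)[OF R] by (metis less_imp_le)
    qed
    also have "\<dots> = ennreal (\<Sum>R\<in>S. mm R ^ CARD('n))"
      using S(2) bm(2) by (intro sum_ennreal zero_le_power less_imp_le) blast
    also have "\<dots> \<le> ennreal (3 * J / s)" by (intro ennreal_leI total S)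
    finally show ?thesis by (simp add: S_def)
  qed (simp add: B_def)
  have inc: "incseq (\<lambda>k. \<Union>i<k. B i)" by (intro monoI UN_mono) auto
  have UUk: "(\<Union>k. \<Union>i<k. B i) = \<Union>SS" unfolding BU[symmetric] by auto
  have "emeasure lebesgue (\<Union>k. \<Union>i<k. B i) = (SUP k. emeasure lebesgue (\<Union>i<k. B i))"
    by (rule SUP_emeasure_incseq[symmetric]) (use Bs inc in auto)
  also have "\<dots> \<le> ennreal (3 * J / s)" by (intro SUP_least part)
  finally have SSfin: "emeasure lebesgue (\<Union>SS) < \<infinity>" unfolding UUk using le_less_trans ennreal_less_top by (metis infinity_ennreal_def)
  have "(\<lambda>k. emeasure lebesgue (V k)) \<longlonglongrightarrow> emeasure lebesgue (\<Inter>k. V k)"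
  proof (rule Lim_emeasure_decseq)
    show "range V \<subseteq> sets lebesgue" using Vs by auto
    show "decseq V" unfolding V_def by (intro antimonoI Diff_mono UN_mono) auto
    fix k
    have "emeasure lebesgue (V k) \<le> emeasure lebesgue (\<Union>SS)" by (intro emeasure_mono SSs) (auto simp: V_def)
    then show "emeasure lebesgue (V k) \<noteq> \<infinity>" using SSfin by (metis infinity_ennreal_def leD less_top)
  qed
  moreover have "(\<Inter>k. V k) = {}" unfolding V_def using UUk by auto
  ultimately have "(\<lambda>k. emeasure lebesgue (V k)) \<longlonglongrightarrow> 0" by simp
  then have "\<forall>\<^sub>F k in sequentially. emeasure lebesgue (V k) < ennreal \<delta>" using \<delta> by (intro order_tendstoD) auto
  then obtain k where k: "emeasure lebesgue (V k) < ennreal \<delta>" by (blast dest: eventually_happens'[OF sequentially_bot])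
  define S where "S = (if SS = {} then {} else B ` {..<k})"
  have S: "finite S" "S \<subseteq> SS" using Bin by (auto simp: S_def)
  have US: "\<Union>S = (\<Union>i<k. B i)" by (cases "SS = {}") (auto simp: S_def B_def)
  show ?thesis
  proof (rule that[of S bb mm "V k"])
    show "disjoint S" using SS(2) S(2) by (meson disjoint_def subsetD)
    show "R = hcube (bb R) (mm R) \<and> 0 < mm R" if "R \<in> S" for R using that S bm(1,2) by blast
    show "(\<Sum>R\<in>S. mm R ^ CARD('n)) \<le> 3 * ((LINT x|lebesgue. F x) + \<eta>) / s"
      using total[OF S] unfolding J_def I_def .
    show "(LINT x|lebesgue. indicator R x * F x) \<le> 2 ^ CARD('n) * s * mm R ^ CARD('n)" if "R \<in> S" for R
      using that S bm(4) by blast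
    show "V k \<inter> \<Union>S = {}" unfolding US V_def by auto
    show "emeasure lebesgue (V k) \<le> ennreal \<delta>" using k by simp
    fix x assume "x \<notin> \<Union>S \<union> V k"
    then have x: "x \<notin> \<Union>SS" unfolding US V_def by auto
    have "x \<notin> G"
    proof
      assume xG: "x \<in> G"
      obtain j where j: "dyadic 0 l j x \<subseteq> G" using dyadic_small[OF l(2) G(1) xG] by blast
      obtain b where b: "dyadic 0 l j x = hcube b (l / 2 ^ j)" using dyadic_hcube[OF l(2)] by blast
      have "0 < measure lebesgue (dyadic 0 l j x)" unfolding b using l by (subst measure_hcube) auto
      then have "bad (dyadic 0 l j x)" unfolding bad_def using j by (simp add: Int_absorb1)
      then show False using SS(4) x by blast
    qed
    then show "F x \<le> s" using G(2) unfolding E_def by (metis mem_Collect_eq not_le subsetD)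
  qed (use S Vs in auto)
qed

section \<open>Weak type from strong type\<close>

lemma Bc_indicator_const:
  assumes "E \<in> sets lebesgue" "bounded E"
  shows "(\<lambda>x. of_real (indicator E x) * z) \<in> Bc"
proof -
  have "norm (of_real (indicator E x) * z) \<le> norm z" for x by (auto simp: indicator_def)
  moreover have "bounded {x. of_real (indicator E x) * z \<noteq> 0}"
    using assms(2) by (rule bounded_subset) (auto simp: indicator_def split: if_splits)
  moreover have "(\<lambda>x. of_real (indicator E x) * z) \<in> borel_measurable lebesgue"
    using assms(1) by measurable
  ultimately show ?thesis unfolding Bc_def by blast
qed

lemma Bc_lqn:
  assumes q: "1 < q" and f: "\<And>j. j < N \<Longrightarrow> f j \<in> Bc"
  shows "integrable lebesgue (\<lambda>x. lqn q N (\<lambda>j. f j x))" "\<exists>M>0. \<forall>x. lqn q N (\<lambda>j. f j x) \<le> M"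
    "bounded {x. lqn q N (\<lambda>j. f j x) \<noteq> 0}" "(\<lambda>x. lqn q N (\<lambda>j. f j x)) \<in> borel_measurable lebesgue"
proof -
  show "integrable lebesgue (\<lambda>x. lqn q N (\<lambda>j. f j x))"
    using f by (intro lqn_integrable[OF q] Bc_integrable)
  then show "(\<lambda>x. lqn q N (\<lambda>j. f j x)) \<in> borel_measurable lebesgue" by (rule borel_measurable_integrable)
  have "\<forall>j\<in>{..<N}. \<exists>B. \<forall>x. norm (f j x) \<le> B" using f by (auto simp: Bc_def)
  from bchoice[OF this] obtain B where B: "\<forall>j\<in>{..<N}. \<forall>x. norm (f j x) \<le> B j" ..
  show "\<exists>M>0. \<forall>x. lqn q N (\<lambda>j. f j x) \<le> M"
  proof (intro exI[of _ "\<bar>\<Sum>j<N. B j\<bar> + 1"] conjI allI)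
    fix x
    have "lqn q N (\<lambda>j. f j x) \<le> (\<Sum>j<N. norm (f j x))" by (rule lqn_le_sum[OF q])
    also have "\<dots> \<le> (\<Sum>j<N. B j)" using B by (intro sum_mono) auto
    finally show "lqn q N (\<lambda>j. f j x) \<le> \<bar>\<Sum>j<N. B j\<bar> + 1" by linarith
  qed simp
  have "bounded (\<Union>j<N. {x. f j x \<noteq> 0})" using f by (intro bounded_UN) (auto simp: Bc_def)
  then show "bounded {x. lqn q N (\<lambda>j. f j x) \<noteq> 0}"
  proof (rule bounded_subset)
    show "{x. lqn q N (\<lambda>j. f j x) \<noteq> 0} \<subseteq> (\<Union>j<N. {x. f j x \<noteq> 0})"
    proof
      fix x assume "x \<in> {x. lqn q N (\<lambda>j. f j x) \<noteq> 0}"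
      then have "\<exists>j<N. f j x \<noteq> 0" using lqn_zero[OF q, of N "\<lambda>j. f j x"] by auto
      then show "x \<in> (\<Union>j<N. {x. f j x \<noteq> 0})" by auto
    qed
  qed
qed

context cz_operator
begin

text \<open>Mean zero lets \<open>K x y\<close> be replaced by \<open>K x y - K x b\<close>, which
  smoothness makes small for \<open>y\<close> in the support. Minkowski's integral inequality then
  treats all components at once.\<close>

lemma T_atom:
  assumes q: "1 < q" and a: "\<And>j. j < N \<Longrightarrow> a j \<in> Bc" and \<rho>: "0 < \<rho>"
    and supp: "\<And>j y. j < N \<Longrightarrow> \<rho> < norm (y - b) \<Longrightarrow> a j y = 0"
    and mean: "\<And>j. j < N \<Longrightarrow> (LINT y|lebesgue. a j y) = 0"
  shows "AE x in lebesgue. 2 * \<rho> < norm (x - b) \<longrightarrow>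
    lqn q N (\<lambda>j. T (a j) x) \<le> c * (\<rho> powr \<epsilon> / norm (x - b) powr (real CARD('n) + \<epsilon>)) * (LINT y|lebesgue. lqn q N (\<lambda>j. a j y))"
proof -
  have "AE x in lebesgue. \<forall>j\<in>{..<N}. x \<notin> cball b \<rho> \<longrightarrow> T (a j) x = (LINT y|lebesgue. K x y * a j y)"
  proof (subst AE_finite_all)
    show "\<forall>j\<in>{..<N}. AE x in lebesgue. x \<notin> cball b \<rho> \<longrightarrow> T (a j) x = (LINT y|lebesgue. K x y * a j y)"
    proof
      fix j assume j: "j \<in> {..<N}"
      show "AE x in lebesgue. x \<notin> cball b \<rho> \<longrightarrow> T (a j) x = (LINT y|lebesgue. K x y * a j y)"
        using j supp by (intro kernel_representation a) (auto simp: dist_norm norm_minus_commute)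
    qed
  qed simp
  then show ?thesis
  proof (rule eventually_mono, intro impI)
    fix x assume x: "\<forall>j\<in>{..<N}. x \<notin> cball b \<rho> \<longrightarrow> T (a j) x = (LINT y|lebesgue. K x y * a j y)"
      and far: "2 * \<rho> < norm (x - b)"
    define W where "W = c * (\<rho> powr \<epsilon> / norm (x - b) powr (real CARD('n) + \<epsilon>))"
    have W: "0 \<le> W" using c_nonneg by (simp add: W_def)
    have int: "integrable lebesgue (\<lambda>y. K x y * a j y)" if j: "j < N" for j
    proof (rule K_integrable[OF a[OF j] \<rho>])
      fix y assume "a j y \<noteq> 0"
      then have "norm (y - b) \<le> \<rho>" using supp[OF j, of y] by (meson not_le)
      then show "\<rho> \<le> dist x y" using far norm_triangle_ineq[of "x - y" "y - b"] by (simp add: dist_norm)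
    qed
    have int2: "integrable lebesgue (\<lambda>y. (K x y - K x b) * a j y)" if "j < N" for j
      using int[OF that] Bc_integrable[OF a[OF that]] by (simp add: left_diff_distrib)
    have "lqn q N (\<lambda>j. T (a j) x) = lqn q N (\<lambda>j. LINT y|lebesgue. (K x y - K x b) * a j y)"
    proof (rule lqn_cong)
      fix j assume j: "j < N"
      have "x \<notin> cball b \<rho>" using far \<rho> by (auto simp: dist_norm norm_minus_commute)
      then have "T (a j) x = (LINT y|lebesgue. K x y * a j y) - K x b * (LINT y|lebesgue. a j y)"
        using x j mean[OF j] by simp
      also have "\<dots> = (LINT y|lebesgue. (K x y - K x b) * a j y)"
        using int[OF j] Bc_integrable[OF a[OF j]] by (simp add: left_diff_distrib)
      finally show "norm (T (a j) x) = norm (LINT y|lebesgue. (K x y - K x b) * a j y)" by simp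
    qed
    also have "\<dots> \<le> (LINT y|lebesgue. lqn q N (\<lambda>j. (K x y - K x b) * a j y))"
      by (rule lqn_integral[OF q int2])
    also have "\<dots> \<le> (LINT y|lebesgue. W * lqn q N (\<lambda>j. a j y))"
    proof (rule integral_mono)
      show "integrable lebesgue (\<lambda>y. lqn q N (\<lambda>j. (K x y - K x b) * a j y))"
        by (rule lqn_integrable[OF q int2])
      show "integrable lebesgue (\<lambda>y. W * lqn q N (\<lambda>j. a j y))"
        using Bc_lqn(1)[OF q, of N a] a by (intro integrable_mult_right) blast
      fix y
      show "lqn q N (\<lambda>j. (K x y - K x b) * a j y) \<le> W * lqn q N (\<lambda>j. a j y)"
      proof (cases "norm (y - b) \<le> \<rho>")
        case True
        then have "2 * norm (b - y) < norm (b - x)" using far by (simp add: norm_minus_commute)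
        then have "norm (K x b - K x y) \<le> c * (norm (b - y) powr \<epsilon> / norm (b - x) powr (real CARD('n) + \<epsilon>))"
          by (rule K_smooth2)
        also have "\<dots> \<le> W"
          unfolding W_def using True eps_pos c_nonneg
          by (intro mult_left_mono) (auto simp: norm_minus_commute intro!: divide_right_mono powr_mono2)
        finally show ?thesis unfolding lqn_scale[OF q] by (intro mult_right_mono) (auto simp: norm_minus_commute)
      next
        case False
        then have "a j y = 0" if "j < N" for j using supp[OF that, of y] by simp
        then show ?thesis using q by (simp add: lqn_zero)
      qed
    qed
    finally show "lqn q N (\<lambda>j. T (a j) x) \<le> c * (\<rho> powr \<epsilon> / norm (x - b) powr (real CARD('n) + \<epsilon>)) * (LINT y|lebesgue. lqn q N (\<lambda>j. a j y))"
      unfolding W_def by simp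
  qed
qed

text \<open>The exponent \<open>q\<close> of the sequence norm and the exponent \<open>p\<close> of
  integration are kept apart because the same passage to weak type is used twice: for one component
  with \<open>p = 2\<close>, and for sequences with \<open>p = q\<close>.\<close>

definition strong_type :: "real \<Rightarrow> nat \<Rightarrow> real \<Rightarrow> real \<Rightarrow> bool" where
  "strong_type q N p B \<longleftrightarrow> (\<forall>f. (\<forall>j<N. f j \<in> Bc) \<longrightarrow>
     (\<integral>\<^sup>+x. lqn q N (\<lambda>j. T (f j) x) powr p \<partial>lebesgue) \<le> ennreal B * (\<integral>\<^sup>+x. lqn q N (\<lambda>j. f j x) powr p \<partial>lebesgue))"

definition weak_type :: "real \<Rightarrow> nat \<Rightarrow> real \<Rightarrow> bool" where
  "weak_type q N C \<longleftrightarrow> (\<forall>f s. (\<forall>j<N. f j \<in> Bc) \<longrightarrow> 0 < s \<longrightarrow>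
     ennreal s * emeasure lebesgue {x. s < lqn q N (\<lambda>j. T (f j) x)} \<le> ennreal (C * (LINT x|lebesgue. lqn q N (\<lambda>j. f j x))))"

lemma T_lqn_measurable:
  assumes "\<And>j. j < N \<Longrightarrow> f j \<in> Bc"
  shows "(\<lambda>x. lqn q N (\<lambda>j. T (f j) x)) \<in> borel_measurable lebesgue"
  using assms by (intro lqn_measurable T_measurable)

lemma strong_type_chebyshev:
  assumes strong: "strong_type q N p B" and p: "1 < p" and B: "0 \<le> B" and f: "\<And>j. j < N \<Longrightarrow> f j \<in> Bc" and t: "0 < t"
    and Y: "(\<integral>\<^sup>+x. lqn q N (\<lambda>j. f j x) powr p \<partial>lebesgue) \<le> ennreal Y" "0 \<le> Y"
  shows "emeasure lebesgue {x. t < lqn q N (\<lambda>j. T (f j) x)} \<le> ennreal ((1 / t) powr p * (B * Y))"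
proof -
  note [measurable] = T_lqn_measurable[OF f]
  have eq: "{x. t < lqn q N (\<lambda>j. T (f j) x)} = {x \<in> space lebesgue. t powr p < lqn q N (\<lambda>j. T (f j) x) powr p}"
  proof -
    have "t < lqn q N a \<longleftrightarrow> t powr p < lqn q N a powr p" for a
    proof
      show "t < lqn q N a \<Longrightarrow> t powr p < lqn q N a powr p" using p t by (intro powr_less_mono2) auto
      show "t < lqn q N a" if less: "t powr p < lqn q N a powr p"
      proof (rule ccontr)
        assume "\<not> t < lqn q N a"
        then have "lqn q N a powr p \<le> t powr p" using p by (intro powr_mono2) auto
        then show False using less by simp
      qed
    qed
    then show ?thesis by simp
  qed
  have "ennreal (t powr p) * emeasure lebesgue {x. t < lqn q N (\<lambda>j. T (f j) x)} \<le> (\<integral>\<^sup>+x. lqn q N (\<lambda>j. T (f j) x) powr p \<partial>lebesgue)"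
    unfolding eq by (rule markov_strict) (auto intro!: powr_real_measurable)
  also have "\<dots> \<le> ennreal B * (\<integral>\<^sup>+x. lqn q N (\<lambda>j. f j x) powr p \<partial>lebesgue)"
    using strong f unfolding strong_type_def by blast
  also have "\<dots> \<le> ennreal B * ennreal Y" by (intro mult_left_mono Y) simp
  also have "\<dots> = ennreal (B * Y)" using B Y by (simp add: ennreal_mult)
  finally have "ennreal ((1 / t) powr p) * (ennreal (t powr p) * emeasure lebesgue {x. t < lqn q N (\<lambda>j. T (f j) x)})
    \<le> ennreal ((1 / t) powr p) * ennreal (B * Y)" by (rule mult_left_mono) simp
  moreover have "ennreal ((1 / t) powr p) * ennreal (t powr p) = 1"
    using t by (simp add: ennreal_mult'[symmetric] powr_mult[symmetric])
  ultimately show ?thesis by (simp add: mult.assoc[symmetric] ennreal_mult'[symmetric] del: emeasure_completion)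
qed

text \<open>\<open>f = g + b + r\<close> along the cubes of \<open>cz_cubes\<close>. The norm of
  \<open>g\<close> is at most \<open>2^n * s\<close> with integral at most \<open>I\<close>, which
  bounds the integral of its \<open>p\<close>-th power. \<open>b\<close> is a sum of mean-zero
  atoms, whose images are integrable off dilated balls, and \<open>r\<close> lives on the small
  uncovered set. The parts are tested at height \<open>s / 3\<close> each; \<open>\<eta>\<close>
  pays for the open cover in the stopping argument and for \<open>r\<close>.\<close>

lemma weak_type_of_strong_type_aux:
  assumes q: "1 < q" and p: "1 < p" and B: "0 \<le> B" and strong: "strong_type q N p B"
    and f: "\<And>j. j < N \<Longrightarrow> f j \<in> Bc" and s: "0 < s" and \<eta>: "0 < \<eta>"
  defines "D \<equiv> 2 ^ CARD('n) * (2 ^ CARD('n) / (1 - 2 powr - \<epsilon>))"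
  defines "I \<equiv> (LINT x|lebesgue. lqn q N (\<lambda>j. f j x))"
  shows "ennreal s * emeasure lebesgue {x. s < lqn q N (\<lambda>j. T (f j) x)} \<le>
    ennreal ((3 powr p * (B * (2 ^ CARD('n)) powr (p - 1)) + 3 * (4 * real CARD('n)) ^ CARD('n) + 6 * c * D + 1) * (I + \<eta>))"
proof -
  define n where "n = CARD('n)"
  have n: "1 \<le> n" unfolding n_def by simp
  define F where "F = (\<lambda>x. lqn q N (\<lambda>j. f j x))"
  have F: "integrable lebesgue F" "\<And>x. 0 \<le> F x" unfolding F_def using Bc_lqn(1)[OF q f] by auto
  have Fm [measurable]: "F \<in> borel_measurable lebesgue" using F(1) by (rule borel_measurable_integrable)
  have "\<exists>M>0. \<forall>x. lqn q N (\<lambda>j. f j x) \<le> M" by (rule Bc_lqn(2)[OF q f])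
  then obtain M where "M > 0 \<and> (\<forall>x. lqn q N (\<lambda>j. f j x) \<le> M)" ..
  then have M: "0 < M" "F x \<le> M" for x by (simp_all add: F_def)
  have I: "I = (LINT x|lebesgue. F x)" "0 \<le> I" unfolding I_def F_def by (simp_all add: integral_nonneg_AE)
  \<comment> \<open>Since \<open>F\<close> is at most \<open>M\<close>, Chebyshev's inequality
    bounds the contribution of the remainder by \<open>s * L * \<delta>\<close>. The choice of
    \<open>\<delta>\<close> makes this at most \<open>\<eta>\<close>; the denominator has
    \<open>1 + L\<close> because \<open>L\<close> may be 0.\<close>
  define L where "L = (3 / s) powr p * (B * M powr p)"
  have L: "0 \<le> L" unfolding L_def using B by simp
  define \<delta> where "\<delta> = \<eta> / (s * (1 + L))"
  have \<delta>: "0 < \<delta>" unfolding \<delta>_def using \<eta> s L by simp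
  obtain S bb mm U where S: "finite S" "disjoint S" "\<And>R. R \<in> S \<Longrightarrow> R = hcube (bb R) (mm R) \<and> 0 < mm R"
    "(\<Sum>R\<in>S. mm R ^ n) \<le> 3 * ((LINT x|lebesgue. F x) + \<eta>) / s"
    "\<And>R. R \<in> S \<Longrightarrow> (LINT x|lebesgue. indicator R x * F x) \<le> 2 ^ n * s * mm R ^ n"
    "U \<in> sets lebesgue" "U \<inter> \<Union>S = {}" "emeasure lebesgue U \<le> ennreal \<delta>"
    "\<And>x. x \<notin> \<Union>S \<union> U \<Longrightarrow> F x \<le> s"
    unfolding n_def by (rule cz_cubes[OF F s \<eta> \<delta>]) blast
  have Rhc: "R = hcube (bb R) (mm R)" and mm: "0 < mm R" if "R \<in> S" for R using S(3)[OF that] by auto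
  have Rs: "R \<in> sets lebesgue" if "R \<in> S" for R using Rhc[OF that] hcube_sets_lebesgue by metis
  have Rb: "bounded R" if "R \<in> S" for R using Rhc[OF that] bounded_hcube by metis
  have Rm: "measure lebesgue R = mm R ^ n" if "R \<in> S" for R
    using measure_hcube[of "mm R" "bb R"] Rhc[OF that] mm[OF that] unfolding n_def by (metis less_imp_le)
  have Rl: "R \<in> lmeasurable" if "R \<in> S" for R using Rhc[OF that] lmeasurable_hcube by metis
  have uniq: "R = R'" if "R \<in> S" "R' \<in> S" "x \<in> R" "x \<in> R'" for R R' x
    using S(2) that unfolding disjoint_def by blast
  have intF: "integrable lebesgue (\<lambda>x. indicator E x * F x)" if "E \<in> sets lebesgue" for E
    using integrable_mult_indicator[OF that F(1)] by simp

  \<comment> \<open>The pieces of the decomposition\<close>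
  define av where "av R j = (LINT x|lebesgue. of_real (indicator R x) * f j x) / of_real (mm R ^ n)" for R j
  define bR where "bR R j x = of_real (indicator R x) * f j x - of_real (indicator R x) * av R j" for R j x
  define b where "b j x = (\<Sum>R\<in>S. bR R j x)" for j x
  define r where "r j x = of_real (indicator U x) * f j x" for j x
  \<comment> \<open>Hence \<open>g j\<close> is the average of \<open>f j\<close> on a selected
    cube, 0 on the uncovered set \<open>U\<close>, and \<open>f j\<close> elsewhere.\<close>
  define g where "g j x = f j x - b j x - r j x" for j x
  define A where "A R = (LINT x|lebesgue. indicator R x * F x)" for R
  have A0: "0 \<le> A R" for R unfolding A_def using F(2) by (simp add: integral_nonneg_AE)
  have bRBc: "bR R j \<in> Bc" if "R \<in> S" "j < N" for R j
    unfolding bR_def using Rs[OF that(1)] Rb[OF that(1)] f[OF that(2)]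
    by (intro Bc_diff Bc_indicator Bc_indicator_const)
  have bBc: "b j \<in> Bc" if "j < N" for j unfolding b_def using S(1) bRBc that by (intro Bc_sum) auto
  have rBc: "r j \<in> Bc" if "j < N" for j unfolding r_def using S(6) f[OF that] by (intro Bc_indicator)
  have gBc: "g j \<in> Bc" if "j < N" for j unfolding g_def using f bBc rBc that by (intro Bc_diff) auto
  have b_in: "b j x = f j x - av R j" if "R \<in> S" "x \<in> R" for R x j
  proof -
    have "b j x = (\<Sum>R'\<in>S. if R' = R then f j x - av R j else 0)"
      unfolding b_def bR_def using uniq that by (intro sum.cong) (auto simp: indicator_def)
    also have "\<dots> = f j x - av R j" using S(1) that by simp
    finally show ?thesis .
  qed
  have b_out: "b j x = 0" if "x \<notin> \<Union>S" for x j
    unfolding b_def bR_def using that by (intro sum.neutral) (auto simp: indicator_def)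
  have lav: "lqn q N (\<lambda>j. av R j) \<le> A R / mm R ^ n" if R: "R \<in> S" for R
  proof -
    have "lqn q N (\<lambda>j. av R j) = lqn q N (\<lambda>j. of_real (1 / mm R ^ n) * (LINT x|lebesgue. of_real (indicator R x) * f j x))"
      by (intro lqn_cong) (simp add: av_def)
    also have "\<dots> = (1 / mm R ^ n) * lqn q N (\<lambda>j. LINT x|lebesgue. of_real (indicator R x) * f j x)"
      unfolding lqn_scale[OF q] norm_of_real using mm[OF R] by simp
    also have "\<dots> \<le> (1 / mm R ^ n) * (LINT x|lebesgue. lqn q N (\<lambda>j. of_real (indicator R x) * f j x))"
      using mm[OF R] Rs[OF R] f by (intro mult_left_mono lqn_integral[OF q] Bc_integrable Bc_indicator) auto
    also have "(LINT x|lebesgue. lqn q N (\<lambda>j. of_real (indicator R x) * f j x)) = A R"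
      unfolding A_def lqn_scale[OF q] F_def by simp
    finally show ?thesis by simp
  qed
  define G where "G = (\<lambda>x. lqn q N (\<lambda>j. g j x))"
  have G_in: "G x \<le> A R / mm R ^ n" if "R \<in> S" "x \<in> R" for R x
  proof -
    have "x \<notin> U" using S(7) that by blast
    then have "g j x = av R j" for j by (simp add: g_def r_def b_in[OF that])
    then show ?thesis unfolding G_def using lav[OF that(1)] by simp
  qed
  have G_out: "G x = F x \<or> G x = 0" if "x \<notin> \<Union>S" for x
  proof (cases "x \<in> U")
    case True
    then have "g j x = 0" for j by (simp add: g_def r_def b_out[OF that])
    then show ?thesis unfolding G_def using q by (simp add: lqn_zero)
  next
    case False
    then have "g j x = f j x" for j by (simp add: g_def r_def b_out[OF that])
    then show ?thesis unfolding G_def F_def by simp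
  qed
  have G_le: "G x \<le> 2 ^ n * s" for x
  proof (cases "x \<in> \<Union>S")
    case True
    then obtain R where R: "R \<in> S" "x \<in> R" by blast
    have "A R / mm R ^ n \<le> 2 ^ n * s" using S(5)[OF R(1)] mm[OF R(1)] unfolding A_def by (simp add: divide_le_eq)
    then show ?thesis using G_in[OF R] by linarith
  next
    case False
    have "1 * s \<le> 2 ^ n * s" using s by (intro mult_right_mono) auto
    moreover have "G x \<le> s"
    proof (cases "x \<in> U")
      case True
      then have "g j x = 0" for j by (simp add: g_def r_def b_out[OF False])
      then have "G x = 0" unfolding G_def using q by (simp add: lqn_zero)
      then show ?thesis using s by simp
    next
      case nU: False
      then have "F x \<le> s" using S(9) False by blast
      then show ?thesis using G_out[OF False] s by auto
    qed
    ultimately show ?thesis by simp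
  qed
  have Gint: "integrable lebesgue G" unfolding G_def using gBc by (intro Bc_lqn(1)[OF q]) auto
  have G0: "0 \<le> G x" for x unfolding G_def by simp
  \<comment> \<open>Averaging does not increase the total: on each cube the norm of the mean is at
    most the mean of the norm.\<close>
  have GI: "(LINT x|lebesgue. G x) \<le> I"
  proof -
    have US: "\<Union>S \<in> sets lebesgue" using S(1) Rs by auto
    have i1: "integrable lebesgue (\<lambda>x. indicator (- \<Union>S) x * F x)"
      using sets.compl_sets[OF US] by (intro intF) (simp add: Compl_eq_Diff_UNIV)
    have i2: "integrable lebesgue (\<lambda>x. \<Sum>R\<in>S. indicator R x * (A R / mm R ^ n))"
      using Rl by (intro Bochner_Integration.integrable_sum integrable_mult_left) (auto simp: lmeasurable_iff_integrable)
    have "(LINT x|lebesgue. G x) \<le> (LINT x|lebesgue. indicator (- \<Union>S) x * F x + (\<Sum>R\<in>S. indicator R x * (A R / mm R ^ n)))"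
    proof (intro integral_mono Gint Bochner_Integration.integrable_add i1 i2)
      fix x
      have nn: "0 \<le> indicator R x * (A R / mm R ^ n)" if "R \<in> S" for R
        using A0[of R] mm[OF that] by (auto simp: indicator_def)
      show "G x \<le> indicator (- \<Union>S) x * F x + (\<Sum>R\<in>S. indicator R x * (A R / mm R ^ n))"
      proof (cases "x \<in> \<Union>S")
        case True
        then obtain R where R: "R \<in> S" "x \<in> R" by blast
        have "G x \<le> indicator R x * (A R / mm R ^ n)" using G_in[OF R] R(2) by simp
        also have "\<dots> \<le> (\<Sum>R\<in>S. indicator R x * (A R / mm R ^ n))" by (intro member_le_sum R nn S(1)) auto
        also have "\<dots> \<le> indicator (- \<Union>S) x * F x + (\<Sum>R\<in>S. indicator R x * (A R / mm R ^ n))"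
          using F(2)[of x] by (auto simp: indicator_def)
        finally show ?thesis .
      next
        case False
        have "G x \<le> indicator (- \<Union>S) x * F x" using G_out[OF False] F(2)[of x] False by (auto simp: indicator_def)
        moreover have "0 \<le> (\<Sum>R\<in>S. indicator R x * (A R / mm R ^ n))" by (intro sum_nonneg nn)
        ultimately show ?thesis by linarith
      qed
    qed
    also have "\<dots> = (LINT x|lebesgue. indicator (- \<Union>S) x * F x) + (LINT x|lebesgue. (\<Sum>R\<in>S. indicator R x * (A R / mm R ^ n)))"
      by (intro Bochner_Integration.integral_add i1 i2)
    also have "(LINT x|lebesgue. (\<Sum>R\<in>S. indicator R x * (A R / mm R ^ n))) = (\<Sum>R\<in>S. LINT x|lebesgue. indicator R x * (A R / mm R ^ n))"
      using Rl by (intro Bochner_Integration.integral_sum integrable_mult_left) (auto simp: lmeasurable_iff_integrable)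
    also have "\<dots> = (\<Sum>R\<in>S. A R)"
    proof (intro sum.cong refl)
      fix R assume R: "R \<in> S"
      show "(LINT x|lebesgue. indicator R x * (A R / mm R ^ n)) = A R" using Rm[OF R] mm[OF R] by simp
    qed
    also have "\<dots> = (LINT x|lebesgue. (\<Sum>R\<in>S. indicator R x * F x))"
      unfolding A_def using Rs by (intro Bochner_Integration.integral_sum[symmetric] intF) auto
    also have "(LINT x|lebesgue. indicator (- \<Union>S) x * F x) + \<dots> = (LINT x|lebesgue. indicator (- \<Union>S) x * F x + (\<Sum>R\<in>S. indicator R x * F x))"
      using Rs by (intro Bochner_Integration.integral_add[symmetric] i1 Bochner_Integration.integrable_sum intF) auto
    also have "\<dots> = I"
      unfolding I(1) sum_distrib_right[symmetric] sum_indicator_disjoint[OF S(1,2)]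
      by (intro Bochner_Integration.integral_cong) (auto simp: indicator_def)
    finally show ?thesis .
  qed

  \<comment> \<open>The good part: strong type for a bounded function\<close>
  have good: "ennreal s * emeasure lebesgue {x. s / 3 < lqn q N (\<lambda>j. T (g j) x)} \<le> ennreal (3 powr p * (B * (2 ^ n) powr (p - 1)) * I)"
  proof -
    have "(\<integral>\<^sup>+x. lqn q N (\<lambda>j. g j x) powr p \<partial>lebesgue) \<le> (\<integral>\<^sup>+x. ennreal ((2 ^ n * s) powr (p - 1) * G x) \<partial>lebesgue)"
    proof (intro nn_integral_mono ennreal_leI)
      fix x
      have "G x powr p = G x powr (p - 1) * G x"
        using G0[of x] p by (cases "G x = 0") (auto simp: powr_mult_base mult.commute)
      also have "\<dots> \<le> (2 ^ n * s) powr (p - 1) * G x"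
        using G_le[of x] G0[of x] p by (intro mult_right_mono powr_mono2) auto
      finally show "lqn q N (\<lambda>j. g j x) powr p \<le> (2 ^ n * s) powr (p - 1) * G x" unfolding G_def .
    qed
    also have "\<dots> = ennreal (LINT x|lebesgue. (2 ^ n * s) powr (p - 1) * G x)"
      using Gint G0 by (intro nn_integral_eq_integral integrable_mult_right) auto
    also have "\<dots> \<le> ennreal ((2 ^ n * s) powr (p - 1) * I)"
      using GI by (intro ennreal_leI) (simp add: mult_left_mono)
    finally have "emeasure lebesgue {x. s / 3 < lqn q N (\<lambda>j. T (g j) x)} \<le> ennreal ((1 / (s / 3)) powr p * (B * ((2 ^ n * s) powr (p - 1) * I)))"
      using s I gBc by (intro strong_type_chebyshev[OF strong p B]) auto
    then have "ennreal s * emeasure lebesgue {x. s / 3 < lqn q N (\<lambda>j. T (g j) x)} \<le> ennreal s * ennreal ((1 / (s / 3)) powr p * (B * ((2 ^ n * s) powr (p - 1) * I)))"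
      by (rule mult_left_mono) simp
    also have "\<dots> = ennreal (s * ((1 / (s / 3)) powr p * (B * ((2 ^ n * s) powr (p - 1) * I))))"
      using s by (simp add: ennreal_mult')
    also have "s * ((1 / (s / 3)) powr p * (B * ((2 ^ n * s) powr (p - 1) * I))) = 3 powr p * (B * (2 ^ n) powr (p - 1)) * I"
    proof -
      have e1: "(1 / (s / 3)) powr p = 3 powr p / s powr p" using s by (simp add: powr_divide)
      have e2: "(2 ^ n * s) powr (p - 1) = (2 ^ n) powr (p - 1) * s powr (p - 1)" using s by (simp add: powr_mult)
      have e3: "s * s powr (p - 1) = s powr p" using s by (simp add: powr_mult_base)
      have "s * (a / s powr p * (B * (b * s powr (p - 1) * I))) = a * (B * b) * I * ((s * s powr (p - 1)) / s powr p)" for a b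
        by (simp add: divide_inverse mult_ac)
      then show ?thesis unfolding e1 e2 e3 using s by simp
    qed
    finally show ?thesis .
  qed

  \<comment> \<open>The remainder on the uncovered set\<close>
  have rest: "ennreal s * emeasure lebesgue {x. s / 3 < lqn q N (\<lambda>j. T (r j) x)} \<le> ennreal \<eta>"
  proof -
    have "(\<integral>\<^sup>+x. lqn q N (\<lambda>j. r j x) powr p \<partial>lebesgue) \<le> (\<integral>\<^sup>+x. ennreal (M powr p) * indicator U x \<partial>lebesgue)"
    proof (intro nn_integral_mono)
      fix x
      have "lqn q N (\<lambda>j. r j x) = indicator U x * F x" unfolding r_def lqn_scale[OF q] F_def by simp
      moreover have "F x powr p \<le> M powr p" using M F(2) p by (intro powr_mono2) auto
      ultimately show "ennreal (lqn q N (\<lambda>j. r j x) powr p) \<le> ennreal (M powr p) * indicator U x"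
        using p by (auto simp: indicator_def intro!: ennreal_leI)
    qed
    also have "\<dots> = ennreal (M powr p) * emeasure lebesgue U" using S(6) by (intro nn_integral_cmult_indicator)
    also have "\<dots> \<le> ennreal (M powr p) * ennreal \<delta>" by (intro mult_left_mono S(8)) simp
    also have "\<dots> = ennreal (M powr p * \<delta>)" by (simp add: ennreal_mult')
    finally have "emeasure lebesgue {x. s / 3 < lqn q N (\<lambda>j. T (r j) x)} \<le> ennreal ((1 / (s / 3)) powr p * (B * (M powr p * \<delta>)))"
      using s \<delta> rBc by (intro strong_type_chebyshev[OF strong p B]) auto
    then have "ennreal s * emeasure lebesgue {x. s / 3 < lqn q N (\<lambda>j. T (r j) x)} \<le> ennreal s * ennreal ((1 / (s / 3)) powr p * (B * (M powr p * \<delta>)))"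
      by (rule mult_left_mono) simp
    also have "\<dots> = ennreal (s * (L * \<delta>))"
      using s by (simp add: ennreal_mult' L_def mult.assoc)
    also have "\<dots> \<le> ennreal \<eta>"
    proof (rule ennreal_leI)
      have "s * (L * \<delta>) \<le> s * ((1 + L) * \<delta>)" using s \<delta> by (intro mult_left_mono mult_right_mono) auto
      also have "\<dots> = (s * (1 + L)) * \<delta>" by (simp only: mult.assoc)
      also have "\<dots> = \<eta>"
      proof -
        have "s * (1 + L) \<noteq> 0" using s L by simp
        then show ?thesis unfolding \<delta>_def by (simp del: mult_eq_0_iff)
      qed
      finally show "s * (L * \<delta>) \<le> \<eta>" .
    qed
    finally show ?thesis .
  qed
  \<comment> \<open>A bound for the diameter of \<open>R\<close>, so that the atom on
    \<open>R\<close> vanishes farther than \<open>\<rho> R\<close> from the corner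
    \<open>bb R\<close>. The exceptional balls get radius \<open>2 * \<rho> R\<close>, the distance
    beyond which \<open>T_atom\<close> applies.\<close>
  define \<rho> where "\<rho> R = real n * mm R" for R
  have \<rho>: "0 < \<rho> R" if "R \<in> S" for R unfolding \<rho>_def using mm[OF that] n by simp
  have far_out: "y \<notin> R" if "R \<in> S" "\<rho> R < norm (y - bb R)" for R y
  proof
    assume "y \<in> R"
    then have "y \<in> hcube (bb R) (mm R)" using Rhc[OF that(1)] by simp
    moreover have "bb R \<in> hcube (bb R) (mm R)" using mm[OF that(1)] by (simp add: hcube_def)
    ultimately have "norm (y - bb R) \<le> \<rho> R" unfolding \<rho>_def n_def by (rule hcube_dist)
    then show False using that(2) by simp
  qed
  define Exc where "Exc = (\<Union>R\<in>S. cball (bb R) (2 * \<rho> R))"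
  have Excs: "Exc \<in> sets lebesgue" unfolding Exc_def using S(1) by auto
  have exc: "ennreal s * emeasure lebesgue Exc \<le> ennreal (3 * (4 * real n) ^ n * (I + \<eta>))"
  proof -
    have "emeasure lebesgue Exc \<le> (\<Sum>R\<in>S. emeasure lebesgue (cball (bb R) (2 * \<rho> R)))"
      unfolding Exc_def using S(1) by (intro emeasure_subadditive_finite) auto
    also have "\<dots> \<le> (\<Sum>R\<in>S. ennreal ((2 * (2 * \<rho> R)) ^ n))"
      unfolding n_def using \<rho> by (intro sum_mono emeasure_cball_le) (auto intro: less_imp_le)
    also have "\<dots> = ennreal (\<Sum>R\<in>S. (2 * (2 * \<rho> R)) ^ n)"
      using \<rho> by (intro sum_ennreal) (auto intro: less_imp_le)
    also have "(\<Sum>R\<in>S. (2 * (2 * \<rho> R)) ^ n) = (4 * real n) ^ n * (\<Sum>R\<in>S. mm R ^ n)"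
      unfolding sum_distrib_left
    proof (rule sum.cong)
      show "(2 * (2 * \<rho> R)) ^ n = (4 * real n) ^ n * mm R ^ n" for R
        by (simp add: \<rho>_def power_mult_distrib)
    qed simp
    finally have "ennreal s * emeasure lebesgue Exc \<le> ennreal s * ennreal ((4 * real n) ^ n * (\<Sum>R\<in>S. mm R ^ n))"
      by (rule mult_left_mono) simp
    also have "\<dots> = ennreal ((4 * real n) ^ n * (s * (\<Sum>R\<in>S. mm R ^ n)))"
      using s by (subst ennreal_mult'[symmetric]) (simp_all add: mult.left_commute)
    also have "\<dots> \<le> ennreal ((4 * real n) ^ n * (3 * (I + \<eta>)))"
    proof -
      have "s * (\<Sum>R\<in>S. mm R ^ n) \<le> 3 * (I + \<eta>)"
        using S(4) s unfolding I(1)[symmetric] by (simp add: pos_le_divide_eq mult.commute)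
      then show ?thesis by (intro ennreal_leI mult_left_mono) auto
    qed
    also have "(4 * real n) ^ n * (3 * (I + \<eta>)) = 3 * (4 * real n) ^ n * (I + \<eta>)" by simp
    finally show ?thesis .
  qed
  define \<beta> where "\<beta> R = (LINT y|lebesgue. lqn q N (\<lambda>j. bR R j y))" for R
  have \<beta>: "0 \<le> \<beta> R" "\<beta> R \<le> 2 * A R" if R: "R \<in> S" for R
  proof -
    show "0 \<le> \<beta> R" unfolding \<beta>_def by (simp add: integral_nonneg_AE)
    have i1: "integrable lebesgue (\<lambda>y. indicator R y * F y)" by (intro intF Rs R)
    have i2: "integrable lebesgue (\<lambda>y. indicator R y * (A R / mm R ^ n))"
      using Rl[OF R] by (intro integrable_mult_left) (auto simp: lmeasurable_iff_integrable)
    have "\<beta> R \<le> (LINT y|lebesgue. indicator R y * F y + indicator R y * (A R / mm R ^ n))"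
      unfolding \<beta>_def
    proof (intro integral_mono Bochner_Integration.integrable_add i1 i2)
      show "integrable lebesgue (\<lambda>y. lqn q N (\<lambda>j. bR R j y))" using bRBc[OF R] by (intro Bc_lqn(1)[OF q]) auto
      fix y
      have "lqn q N (\<lambda>j. bR R j y) = lqn q N (\<lambda>j. of_real (indicator R y) * f j y + of_real (- indicator R y) * av R j)"
        by (simp add: bR_def)
      also have "\<dots> \<le> lqn q N (\<lambda>j. of_real (indicator R y) * f j y) + lqn q N (\<lambda>j. of_real (- indicator R y) * av R j)"
        by (rule lqn_triangle[OF q])
      also have "\<dots> = indicator R y * F y + indicator R y * lqn q N (av R)"
        unfolding lqn_scale[OF q] F_def by simp
      also have "\<dots> \<le> indicator R y * F y + indicator R y * (A R / mm R ^ n)"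
        using lav[OF R] by (intro add_left_mono mult_left_mono) auto
      finally show "lqn q N (\<lambda>j. bR R j y) \<le> indicator R y * F y + indicator R y * (A R / mm R ^ n)" .
    qed
    also have "\<dots> = A R + measure lebesgue R * (A R / mm R ^ n)"
      using i1 i2 by (simp add: A_def)
    also have "\<dots> = 2 * A R" using Rm[OF R] mm[OF R] by simp
    finally show "\<beta> R \<le> 2 * A R" .
  qed
  \<comment> \<open>The numerator of the atom estimate is enlarged from \<open>\<rho> R\<close> to
    \<open>2 * \<rho> R\<close> so that it matches the inner radius, as
    \<open>nn_integral_tail_weight\<close> requires. That lemma with the constant function 1 bounds
    the integral of the weight by \<open>D\<close>, the factor \<open>2^n\<close> coming from the
    volume of a ball.\<close>
  define wt where "wt R x = indicator {x. 2 * \<rho> R < norm (x - bb R)} x * ((2 * \<rho> R) powr \<epsilon> / norm (x - bb R) powr (real n + \<epsilon>))" for R x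
  have wt_meas [measurable]: "wt R \<in> borel_measurable lebesgue" for R
  proof -
    have "wt R \<in> borel_measurable borel" unfolding wt_def by measurable
    then show ?thesis by (intro measurable_completion) simp
  qed
  have wt0: "0 \<le> wt R x" for R x by (simp add: wt_def)
  have D: "0 \<le> D"
  proof -
    have "2 powr - \<epsilon> \<le> 1" using eps_pos powr_mono[of "- \<epsilon>" 0 2] by simp
    then show ?thesis unfolding D_def by simp
  qed
  have wt_int: "(\<integral>\<^sup>+x. wt R x \<partial>lebesgue) \<le> ennreal D" if R: "R \<in> S" for R
  proof -
    have "(\<integral>\<^sup>+x. ennreal (wt R x) * 1 \<partial>lebesgue) \<le> ennreal D"
      unfolding wt_def D_def n_def
    proof (rule nn_integral_tail_weight)
      fix t assume "2 * \<rho> R \<le> t"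
      then have "0 \<le> t" using \<rho>[OF R] by simp
      then show "(\<integral>\<^sup>+x. 1 * indicator (cball (bb R) t) x \<partial>lebesgue) \<le> ennreal (2 ^ CARD('n) * t ^ CARD('n))"
        using emeasure_cball_le[of t "bb R"] by (simp add: power_mult_distrib del: emeasure_completion)
    qed (use \<rho>[OF R] eps_pos in auto)
    then show ?thesis by simp
  qed

  \<comment> \<open>The atoms away from the exceptional balls\<close>
  define h where "h x = (\<Sum>R\<in>S. c * wt R x * \<beta> R)" for x
  have h_meas [measurable]: "h \<in> borel_measurable lebesgue" unfolding h_def by measurable
  have h_int: "(\<integral>\<^sup>+x. h x \<partial>lebesgue) \<le> ennreal (2 * c * D * I)"
  proof -
    have "(\<integral>\<^sup>+x. h x \<partial>lebesgue) = (\<integral>\<^sup>+x. (\<Sum>R\<in>S. ennreal (c * \<beta> R) * ennreal (wt R x)) \<partial>lebesgue)"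
    proof (intro nn_integral_cong)
      fix x
      have "ennreal (h x) = (\<Sum>R\<in>S. ennreal (c * wt R x * \<beta> R))"
        unfolding h_def using c_nonneg wt0 \<beta>(1) by (intro sum_ennreal[symmetric]) auto
      also have "\<dots> = (\<Sum>R\<in>S. ennreal (c * \<beta> R) * ennreal (wt R x))"
        using c_nonneg \<beta>(1) wt0 by (intro sum.cong refl) (simp add: ennreal_mult[symmetric] mult_ac)
      finally show "ennreal (h x) = (\<Sum>R\<in>S. ennreal (c * \<beta> R) * ennreal (wt R x))" .
    qed
    also have "\<dots> = (\<Sum>R\<in>S. \<integral>\<^sup>+x. ennreal (c * \<beta> R) * ennreal (wt R x) \<partial>lebesgue)"
      by (rule nn_integral_sum) measurable
    also have "\<dots> = (\<Sum>R\<in>S. ennreal (c * \<beta> R) * (\<integral>\<^sup>+x. wt R x \<partial>lebesgue))"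
      by (intro sum.cong refl nn_integral_cmult) measurable
    also have "\<dots> \<le> (\<Sum>R\<in>S. ennreal (c * (2 * A R)) * ennreal D)"
      using \<beta>(2) c_nonneg by (intro sum_mono mult_mono wt_int ennreal_leI mult_left_mono) auto
    also have "\<dots> = (\<Sum>R\<in>S. ennreal (c * (2 * A R) * D))"
      using c_nonneg A0 by (intro sum.cong refl) (simp add: ennreal_mult'[symmetric])
    also have "\<dots> = ennreal (\<Sum>R\<in>S. c * (2 * A R) * D)" using c_nonneg A0 D by (intro sum_ennreal) auto
    also have "(\<Sum>R\<in>S. c * (2 * A R) * D) = 2 * c * D * (\<Sum>R\<in>S. A R)"
      unfolding sum_distrib_left by (intro sum.cong refl) simp
    also have "ennreal \<dots> \<le> ennreal (2 * c * D * I)"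
    proof (intro ennreal_leI mult_left_mono)
      show "(\<Sum>R\<in>S. A R) \<le> I" unfolding A_def I(1) using S(1,2) Rs F by (intro sum_integral_disjoint_le)
    qed (use c_nonneg D in simp)
    finally show ?thesis .
  qed
  have hs: "ennreal s * emeasure lebesgue {x \<in> space lebesgue. s / 3 < h x} \<le> ennreal (6 * c * D * I)"
  proof -
    have "ennreal s * emeasure lebesgue {x \<in> space lebesgue. s / 3 < h x} = ennreal 3 * (ennreal (s / 3) * emeasure lebesgue {x \<in> space lebesgue. s / 3 < h x})"
      using s by (simp add: mult.assoc[symmetric] ennreal_mult'[symmetric] del: emeasure_completion ennreal_numeral)
    also have "\<dots> \<le> ennreal 3 * ennreal (2 * c * D * I)"
      using markov_strict[of h lebesgue "s / 3"] s h_int by (intro mult_left_mono) (auto simp del: emeasure_completion)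
    also have "\<dots> = ennreal (3 * (2 * c * D * I))" by (rule ennreal_mult'[symmetric]) simp
    also have "3 * (2 * c * D * I) = 6 * c * D * I" by simp
    finally show ?thesis .
  qed
  have ae1: "AE x in lebesgue. \<forall>R\<in>S. 2 * \<rho> R < norm (x - bb R) \<longrightarrow> lqn q N (\<lambda>j. T (bR R j) x) \<le> c * (\<rho> R powr \<epsilon> / norm (x - bb R) powr (real CARD('n) + \<epsilon>)) * (LINT y|lebesgue. lqn q N (\<lambda>j. bR R j y))"
  proof (subst AE_finite_all[OF S(1)], intro ballI T_atom[OF q])
    fix R j assume R: "R \<in> S" and j: "j < N"
    show "bR R j \<in> Bc" by (rule bRBc[OF R j])
    show "bR R j y = 0" if "\<rho> R < norm (y - bb R)" for y
      using far_out[OF R that] by (simp add: bR_def)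
    have "(LINT y|lebesgue. bR R j y) = (LINT y|lebesgue. of_real (indicator R y) * f j y) - (LINT y|lebesgue. of_real (indicator R y) * av R j)"
      unfolding bR_def using Rs[OF R] Rb[OF R] f[OF j]
      by (intro Bochner_Integration.integral_diff Bc_integrable Bc_indicator Bc_indicator_const)
    also have "(LINT y|lebesgue. of_real (indicator R y) * av R j) = (LINT y|lebesgue. of_real (indicator R y)) * av R j"
      by simp
    also have "(LINT y|lebesgue. complex_of_real (indicator R y)) = of_real (measure lebesgue R)"
      using integral_complex_of_real[of lebesgue "indicator R"] Rs[OF R] by simp
    also have "(LINT y|lebesgue. of_real (indicator R y) * f j y) = of_real (measure lebesgue R) * av R j"
      unfolding av_def Rm[OF R] using mm[OF R] by simp
    finally show "(LINT y|lebesgue. bR R j y) = 0" by simp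
  qed (use \<rho> in auto)
  have ae2: "AE x in lebesgue. \<forall>j\<in>{..<N}. T (b j) x = (\<Sum>R\<in>S. T (bR R j) x)"
    unfolding b_def using bRBc by (subst AE_finite_all) (auto intro!: T_sum S(1))
  have ae3: "AE x in lebesgue. \<forall>j\<in>{..<N}. T (f j) x = T (g j) x + T (b j) x + T (r j) x"
  proof (subst AE_finite_all, simp, intro ballI)
    fix j assume "j \<in> {..<N}"
    then have j: "j < N" by simp
    have e: "f j = (\<lambda>x. (g j x + b j x) + r j x)" by (simp add: g_def)
    have "AE x in lebesgue. T (\<lambda>x. (g j x + b j x) + r j x) x = T (\<lambda>x. g j x + b j x) x + T (r j) x"
      by (intro T_add Bc_add gBc bBc rBc j)
    moreover have "AE x in lebesgue. T (\<lambda>x. g j x + b j x) x = T (g j) x + T (b j) x"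
      by (intro T_add gBc bBc j)
    ultimately show "AE x in lebesgue. T (f j) x = T (g j) x + T (b j) x + T (r j) x"
      unfolding e[symmetric] by eventually_elim simp
  qed

  \<comment> \<open>Assembly of the four exceptional sets\<close>
  have ae: "AE x in lebesgue. x \<in> {x. s < lqn q N (\<lambda>j. T (f j) x)} \<longrightarrow>
      x \<in> {x. s / 3 < lqn q N (\<lambda>j. T (g j) x)} \<union> {x. s / 3 < lqn q N (\<lambda>j. T (r j) x)} \<union> (Exc \<union> {x \<in> space lebesgue. s / 3 < h x})"
  proof (rule eventually_mono[OF eventually_conj[OF eventually_conj[OF ae1 ae2] ae3]], erule conjE)
    fix x
    assume "(\<forall>R\<in>S. 2 * \<rho> R < norm (x - bb R) \<longrightarrow> lqn q N (\<lambda>j. T (bR R j) x) \<le> c * (\<rho> R powr \<epsilon> / norm (x - bb R) powr (real CARD('n) + \<epsilon>)) * (LINT y|lebesgue. lqn q N (\<lambda>j. bR R j y))) \<and>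
       (\<forall>j\<in>{..<N}. T (b j) x = (\<Sum>R\<in>S. T (bR R j) x))"
    then have 1: "\<And>R. R \<in> S \<Longrightarrow> 2 * \<rho> R < norm (x - bb R) \<Longrightarrow> lqn q N (\<lambda>j. T (bR R j) x) \<le> c * (\<rho> R powr \<epsilon> / norm (x - bb R) powr (real n + \<epsilon>)) * \<beta> R"
      and 2: "\<And>j. j < N \<Longrightarrow> T (b j) x = (\<Sum>R\<in>S. T (bR R j) x)" unfolding \<beta>_def n_def by auto
    assume "\<forall>j\<in>{..<N}. T (f j) x = T (g j) x + T (b j) x + T (r j) x"
    then have 3: "\<And>j. j < N \<Longrightarrow> T (f j) x = T (g j) x + T (b j) x + T (r j) x" by auto
    have tri: "lqn q N (\<lambda>j. T (f j) x) \<le> lqn q N (\<lambda>j. T (g j) x) + lqn q N (\<lambda>j. T (b j) x) + lqn q N (\<lambda>j. T (r j) x)"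
    proof -
      have "lqn q N (\<lambda>j. T (f j) x) = lqn q N (\<lambda>j. (T (g j) x + T (b j) x) + T (r j) x)"
        using 3 by (intro lqn_cong) simp
      also have "\<dots> \<le> lqn q N (\<lambda>j. T (g j) x + T (b j) x) + lqn q N (\<lambda>j. T (r j) x)" by (rule lqn_triangle[OF q])
      also have "\<dots> \<le> lqn q N (\<lambda>j. T (g j) x) + lqn q N (\<lambda>j. T (b j) x) + lqn q N (\<lambda>j. T (r j) x)"
        by (intro add_right_mono lqn_triangle[OF q])
      finally show ?thesis .
    qed
    have bh: "lqn q N (\<lambda>j. T (b j) x) \<le> h x" if "x \<notin> Exc"
    proof -
      have "lqn q N (\<lambda>j. T (b j) x) = lqn q N (\<lambda>j. \<Sum>R\<in>S. T (bR R j) x)" using 2 by (intro lqn_cong) simp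
      also have "\<dots> \<le> (\<Sum>R\<in>S. lqn q N (\<lambda>j. T (bR R j) x))" by (rule lqn_sum[OF q S(1)])
      also have "\<dots> \<le> h x"
        unfolding h_def
      proof (rule sum_mono)
        fix R assume R: "R \<in> S"
        have far: "2 * \<rho> R < norm (x - bb R)" using that R unfolding Exc_def by (auto simp: dist_norm norm_minus_commute not_le)
        have "lqn q N (\<lambda>j. T (bR R j) x) \<le> c * (\<rho> R powr \<epsilon> / norm (x - bb R) powr (real n + \<epsilon>)) * \<beta> R"
          by (rule 1[OF R far])
        also have "\<dots> \<le> c * wt R x * \<beta> R"
          unfolding wt_def using far c_nonneg \<beta>(1)[OF R] \<rho>[OF R] eps_pos
          by (intro mult_right_mono mult_left_mono) (auto intro!: divide_right_mono powr_mono2)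
        finally show "lqn q N (\<lambda>j. T (bR R j) x) \<le> c * wt R x * \<beta> R" .
      qed
      finally show ?thesis .
    qed
    show "x \<in> {x. s < lqn q N (\<lambda>j. T (f j) x)} \<longrightarrow>
      x \<in> {x. s / 3 < lqn q N (\<lambda>j. T (g j) x)} \<union> {x. s / 3 < lqn q N (\<lambda>j. T (r j) x)} \<union> (Exc \<union> {x \<in> space lebesgue. s / 3 < h x})"
    proof (rule impI, rule ccontr)
      assume a: "x \<in> {x. s < lqn q N (\<lambda>j. T (f j) x)}"
        and "x \<notin> {x. s / 3 < lqn q N (\<lambda>j. T (g j) x)} \<union> {x. s / 3 < lqn q N (\<lambda>j. T (r j) x)} \<union> (Exc \<union> {x \<in> space lebesgue. s / 3 < h x})"
      then have "lqn q N (\<lambda>j. T (g j) x) \<le> s / 3" "lqn q N (\<lambda>j. T (r j) x) \<le> s / 3" "x \<notin> Exc" "h x \<le> s / 3"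
        by (auto simp: not_less)
      then show False using a tri bh by simp
    qed
  qed
  have sets: "{x. s / 3 < lqn q N (\<lambda>j. T (u j) x)} \<in> sets lebesgue" if "\<And>j. j < N \<Longrightarrow> u j \<in> Bc" for u
  proof -
    note [measurable] = T_lqn_measurable[OF that]
    have "{x \<in> space lebesgue. s / 3 < lqn q N (\<lambda>j. T (u j) x)} \<in> sets lebesgue" by measurable
    then show ?thesis by simp
  qed
  note sg = sets[OF gBc] and sr = sets[OF rBc]
  have sh: "{x \<in> space lebesgue. s / 3 < h x} \<in> sets lebesgue" by measurable
  have "emeasure lebesgue {x. s < lqn q N (\<lambda>j. T (f j) x)} \<le>
      emeasure lebesgue ({x. s / 3 < lqn q N (\<lambda>j. T (g j) x)} \<union> {x. s / 3 < lqn q N (\<lambda>j. T (r j) x)} \<union> (Exc \<union> {x \<in> space lebesgue. s / 3 < h x}))"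
    by (rule emeasure_mono_AE[OF ae sets.Un[OF sets.Un[OF sg sr] sets.Un[OF Excs sh]]])
  also have "\<dots> \<le> emeasure lebesgue ({x. s / 3 < lqn q N (\<lambda>j. T (g j) x)} \<union> {x. s / 3 < lqn q N (\<lambda>j. T (r j) x)}) + emeasure lebesgue (Exc \<union> {x \<in> space lebesgue. s / 3 < h x})"
    by (rule emeasure_subadditive[OF sets.Un[OF sg sr] sets.Un[OF Excs sh]])
  also have "\<dots> \<le> (emeasure lebesgue {x. s / 3 < lqn q N (\<lambda>j. T (g j) x)} + emeasure lebesgue {x. s / 3 < lqn q N (\<lambda>j. T (r j) x)})
      + (emeasure lebesgue Exc + emeasure lebesgue {x \<in> space lebesgue. s / 3 < h x})"
    by (intro add_mono emeasure_subadditive sg sr sh Excs)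
  finally have "ennreal s * emeasure lebesgue {x. s < lqn q N (\<lambda>j. T (f j) x)} \<le>
      ennreal s * ((emeasure lebesgue {x. s / 3 < lqn q N (\<lambda>j. T (g j) x)} + emeasure lebesgue {x. s / 3 < lqn q N (\<lambda>j. T (r j) x)})
      + (emeasure lebesgue Exc + emeasure lebesgue {x \<in> space lebesgue. s / 3 < h x}))"
    by (rule mult_left_mono) simp
  also have "\<dots> \<le> (ennreal (3 powr p * (B * (2 ^ n) powr (p - 1)) * I) + ennreal \<eta>) + (ennreal (3 * (4 * real n) ^ n * (I + \<eta>)) + ennreal (6 * c * D * I))"
    unfolding distrib_left[where a="ennreal s"] by (intro add_mono good rest exc hs)
  also have "\<dots> = ennreal (3 powr p * (B * (2 ^ n) powr (p - 1)) * I + \<eta> + (3 * (4 * real n) ^ n * (I + \<eta>) + 6 * c * D * I))"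
    using B I \<eta> c_nonneg D by (simp add: ennreal_plus[symmetric] del: ennreal_plus)
  also have "\<dots> \<le> ennreal ((3 powr p * (B * (2 ^ n) powr (p - 1)) + 3 * (4 * real n) ^ n + 6 * c * D + 1) * (I + \<eta>))"
  proof (rule ennreal_leI)
    have "3 powr p * (B * (2 ^ n) powr (p - 1)) * I \<le> 3 powr p * (B * (2 ^ n) powr (p - 1)) * (I + \<eta>)"
      using B \<eta> by (intro mult_left_mono) auto
    moreover have "6 * c * D * I \<le> 6 * c * D * (I + \<eta>)" using c_nonneg D \<eta> by (intro mult_left_mono) auto
    moreover have "u * I \<le> u * (I + \<eta>) \<Longrightarrow> d * I \<le> d * (I + \<eta>) \<Longrightarrow>
        u * I + \<eta> + (v * (I + \<eta>) + d * I) \<le> (u + v + d + 1) * (I + \<eta>)" for u v d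
      using I(2) by (simp add: algebra_simps)
    ultimately show "3 powr p * (B * (2 ^ n) powr (p - 1)) * I + \<eta> + (3 * (4 * real n) ^ n * (I + \<eta>) + 6 * c * D * I)
      \<le> (3 powr p * (B * (2 ^ n) powr (p - 1)) + 3 * (4 * real n) ^ n + 6 * c * D + 1) * (I + \<eta>)"
      by blast
  qed
  finally show ?thesis unfolding n_def .
qed

text \<open>What matters is that \<open>C\<close> is chosen before \<open>N\<close>, so that it
  serves all truncations. The slack of the auxiliary estimate disappears by taking
  \<open>\<eta> = e / C\<close> with \<open>e\<close> arbitrary.\<close>

lemma weak_type_of_strong_type:
  assumes q: "1 < q" and p: "1 < p" and B: "0 \<le> B"
  obtains C where "0 < C" "\<And>N. strong_type q N p B \<Longrightarrow> weak_type q N C"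
proof -
  define D where "D = (2::real) ^ CARD('n) * (2 ^ CARD('n) / (1 - 2 powr - \<epsilon>))"
  define C where "C = 3 powr p * (B * (2 ^ CARD('n)) powr (p - 1)) + 3 * (4 * real CARD('n)) ^ CARD('n) + 6 * c * D + 1"
  have D: "0 \<le> D"
  proof -
    have "2 powr - \<epsilon> \<le> 1" using eps_pos powr_mono[of "- \<epsilon>" 0 2] by simp
    then show ?thesis unfolding D_def by simp
  qed
  have C: "0 < C" unfolding C_def using B c_nonneg D by (intro add_nonneg_pos add_nonneg_nonneg) auto
  have "weak_type q N C" if strong: "strong_type q N p B" for N
    unfolding weak_type_def
  proof (intro allI impI)
    fix f :: "nat \<Rightarrow> real ^ 'n \<Rightarrow> complex" and s :: real
    assume f: "\<forall>j<N. f j \<in> Bc" and s: "0 < s"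
    define I where "I = (LINT x|lebesgue. lqn q N (\<lambda>j. f j x))"
    have I: "0 \<le> I" unfolding I_def by (simp add: integral_nonneg_AE)
    show "ennreal s * emeasure lebesgue {x. s < lqn q N (\<lambda>j. T (f j) x)} \<le> ennreal (C * (LINT x|lebesgue. lqn q N (\<lambda>j. f j x)))"
    proof (rule ennreal_le_epsilon)
      fix e :: real assume e: "0 < e"
      have "ennreal s * emeasure lebesgue {x. s < lqn q N (\<lambda>j. T (f j) x)} \<le> ennreal (C * (I + e / C))"
        unfolding C_def D_def I_def using f e C
        by (intro weak_type_of_strong_type_aux[OF q p B strong _ s]) (auto simp: C_def D_def)
      also have "C * (I + e / C) = C * I + e" using C by (simp add: field_simps)
      also have "ennreal (C * I + e) = ennreal (C * I) + ennreal e" using C I e by (intro ennreal_plus) auto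
      finally show "ennreal s * emeasure lebesgue {x. s < lqn q N (\<lambda>j. T (f j) x)} \<le> ennreal (C * (LINT x|lebesgue. lqn q N (\<lambda>j. f j x))) + ennreal e"
        unfolding I_def .
    qed
  qed
  with C show ?thesis using that by blast
qed

end

section \<open>The maximal function\<close>

lemma less_divide_ennreal_iff:
  fixes t X b :: ennreal
  assumes "b \<noteq> 0" "b < top"
  shows "t < X / b \<longleftrightarrow> t * b < X"
proof
  assume "t < X / b"
  then have "b * t < b * (X / b)" using assms by (intro ennreal_mult_strict_left_mono) (auto simp: zero_less_iff_neq_zero)
  also have "b * (X / b) = X" using assms ennreal_divide_times[of X b b] by (simp add: mult.commute)
  finally show "t * b < X" by (simp add: mult.commute)
next
  assume "t * b < X"
  moreover have "b * (X / b) = X" using assms ennreal_divide_times[of X b b] by (simp add: mult.commute)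
  moreover have "b * (X / b) \<le> b * t" if "X / b \<le> t" using that by (rule mult_left_mono) simp
  ultimately show "t < X / b" by (metis mult.commute not_le)
qed

text \<open>The volume of a cube is positive and finite, so the quotient in
  \<open>[0, \<infinity>]\<close> can be multiplied out; the later arguments then handle strict
  inequalities between products and integrals.\<close>

lemma less_maximal_function_iff:
  fixes g :: "real ^ 'n \<Rightarrow> ennreal"
  shows "t < maximal_function g x \<longleftrightarrow>
    (\<exists>a l. 0 < l \<and> x \<in> cbox a (a + l *\<^sub>R One) \<and> t * ennreal (l ^ CARD('n)) < (\<integral>\<^sup>+ y \<in> cbox a (a + l *\<^sub>R One). g y \<partial>lebesgue))"
proof -
  have *: "t < (\<integral>\<^sup>+ y \<in> cbox a (a + l *\<^sub>R One). g y \<partial>lebesgue) / emeasure lebesgue (cbox a (a + l *\<^sub>R One)) \<longleftrightarrow>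
     t * ennreal (l ^ CARD('n)) < (\<integral>\<^sup>+ y \<in> cbox a (a + l *\<^sub>R One). g y \<partial>lebesgue)" if "0 < l" for a :: "real ^ 'n" and l
    unfolding emeasure_cube[OF less_imp_le[OF that]] using that by (intro less_divide_ennreal_iff) auto
  have "t < maximal_function g x \<longleftrightarrow> (\<exists>a l. 0 < l \<and> x \<in> cbox a (a + l *\<^sub>R One) \<and>
      t < (\<integral>\<^sup>+ y \<in> cbox a (a + l *\<^sub>R One). g y \<partial>lebesgue) / emeasure lebesgue (cbox a (a + l *\<^sub>R One)))"
    unfolding maximal_function_def less_SUP_iff cube_def by blast
  then show ?thesis by (simp only: * cong: conj_cong)
qed

lemma maximal_function_upper:
  fixes g :: "real ^ 'n \<Rightarrow> ennreal"
  assumes "0 < l" "x \<in> cbox a (a + l *\<^sub>R One)"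
  shows "(\<integral>\<^sup>+ y \<in> cbox a (a + l *\<^sub>R One). g y \<partial>lebesgue) \<le> maximal_function g x * ennreal (l ^ CARD('n))"
  using less_maximal_function_iff[of "maximal_function g x" g x] assms by (meson less_irrefl not_le)

lemma maximal_function_mono:
  assumes "\<And>y. g y \<le> h y"
  shows "maximal_function g x \<le> maximal_function h x"
  unfolding maximal_function_def
  by (intro SUP_mono' divide_right_mono_ennreal nn_integral_mono mult_right_mono assms) auto

text \<open>Enlarging the witnessing cube by a small \<open>e\<close> on every side increases the
  integral and changes the volume continuously, so the strict inequality survives; the enlarged cube
  contains a ball about \<open>x\<close>. Measurability of the maximal function is a
  consequence.\<close>

lemma open_superlevel_maximal_function:
  fixes g :: "real ^ 'n \<Rightarrow> ennreal"
  shows "open {x. t < maximal_function g x}"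
  unfolding open_contains_ball
proof
  fix x assume "x \<in> {x. t < maximal_function g x}"
  then obtain a l where al: "0 < l" "x \<in> cbox a (a + l *\<^sub>R One)"
    "t * ennreal (l ^ CARD('n)) < (\<integral>\<^sup>+ y \<in> cbox a (a + l *\<^sub>R One). g y \<partial>lebesgue)"
    using less_maximal_function_iff by blast
  then have "t \<noteq> top" by (auto simp: ennreal_top_mult)
  then obtain \<tau> where \<tau>: "t = ennreal \<tau>" "0 \<le> \<tau>" by (cases t) auto
  have "((\<lambda>e. ennreal (\<tau> * (l + 2 * e) ^ CARD('n))) \<longlongrightarrow> ennreal (\<tau> * (l + 2 * 0) ^ CARD('n))) (at_right 0)"
    by (intro tendsto_intros)
  moreover have "ennreal (\<tau> * (l + 2 * 0) ^ CARD('n)) < (\<integral>\<^sup>+ y \<in> cbox a (a + l *\<^sub>R One). g y \<partial>lebesgue)"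
    using al(3) \<tau> by (simp add: ennreal_mult')
  ultimately have "\<forall>\<^sub>F e in at_right 0. ennreal (\<tau> * (l + 2 * e) ^ CARD('n)) < (\<integral>\<^sup>+ y \<in> cbox a (a + l *\<^sub>R One). g y \<partial>lebesgue)"
    by (rule order_tendstoD)
  then obtain d where d: "0 < d" "\<And>e. 0 < e \<Longrightarrow> e < d \<Longrightarrow>
      ennreal (\<tau> * (l + 2 * e) ^ CARD('n)) < (\<integral>\<^sup>+ y \<in> cbox a (a + l *\<^sub>R One). g y \<partial>lebesgue)"
    unfolding eventually_at_right_field by auto
  define e where "e = d / 2"
  have e: "0 < e" "e < d" using d(1) by (auto simp: e_def)
  define a' where "a' = a - e *\<^sub>R One"
  define l' where "l' = l + 2 * e"
  have l': "0 < l'" using al(1) e by (simp add: l'_def)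
  have sub: "cbox a (a + l *\<^sub>R One) \<subseteq> cbox a' (a' + l' *\<^sub>R One)"
  proof
    fix z assume "z \<in> cbox a (a + l *\<^sub>R One)"
    then have z: "\<forall>i. a $ i \<le> z $ i \<and> z $ i \<le> a $ i + l" unfolding mem_cube_iff .
    show "z \<in> cbox a' (a' + l' *\<^sub>R One)"
      unfolding mem_cube_iff
    proof
      fix i
      have "a $ i \<le> z $ i" "z $ i \<le> a $ i + l" using z by blast+
      then show "a' $ i \<le> z $ i \<and> z $ i \<le> a' $ i + l'" using e by (simp add: a'_def l'_def)
    qed
  qed
  have "ball x e \<subseteq> {x. t < maximal_function g x}"
  proof
    fix z assume "z \<in> ball x e"
    then have "norm (x - z) < e" by (simp add: dist_norm)
    then have zi: "\<bar>x $ i - z $ i\<bar> < e" for i using component_le_norm_cart[of "x - z" i] by simp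
    have xi: "a $ i \<le> x $ i \<and> x $ i \<le> a $ i + l" for i using al(2) unfolding mem_cube_iff by blast
    have "z \<in> cbox a' (a' + l' *\<^sub>R One)"
      unfolding mem_cube_iff
    proof
      fix i show "a' $ i \<le> z $ i \<and> z $ i \<le> a' $ i + l'"
        using zi[of i] xi[of i] by (simp add: a'_def l'_def abs_less_iff)
    qed
    moreover have "t * ennreal (l' ^ CARD('n)) < (\<integral>\<^sup>+ y \<in> cbox a' (a' + l' *\<^sub>R One). g y \<partial>lebesgue)"
    proof -
      have "t * ennreal (l' ^ CARD('n)) = ennreal (\<tau> * (l + 2 * e) ^ CARD('n))"
        unfolding \<tau>(1) l'_def using \<tau>(2) by (simp add: ennreal_mult')
      also have "\<dots> < (\<integral>\<^sup>+ y \<in> cbox a (a + l *\<^sub>R One). g y \<partial>lebesgue)" by (rule d(2)[OF e])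
      also have "\<dots> \<le> (\<integral>\<^sup>+ y \<in> cbox a' (a' + l' *\<^sub>R One). g y \<partial>lebesgue)"
        using sub by (intro nn_integral_mono) (auto simp: indicator_def)
      finally show ?thesis .
    qed
    ultimately show "z \<in> {x. t < maximal_function g x}" using less_maximal_function_iff l' by blast
  qed
  then show "\<exists>e>0. ball x e \<subseteq> {x. t < maximal_function g x}" using e by blast
qed

lemma maximal_function_measurable [measurable]:
  fixes g :: "real ^ 'n \<Rightarrow> ennreal"
  shows "maximal_function g \<in> borel_measurable lebesgue"
proof -
  have "maximal_function g \<in> borel_measurable borel"
    by (rule borel_measurableI_greater) (use open_superlevel_maximal_function[of _ g] in simp)
  then show ?thesis by (intro measurable_completion) simp
qed

lemma nn_integral_disjoint_le:
  assumes "countable C" and X: "\<And>i. i \<in> C \<Longrightarrow> X i \<in> sets M" "disjoint_family_on X C" and [measurable]: "G \<in> borel_measurable M"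
  shows "(\<integral>\<^sup>+i. (\<integral>\<^sup>+x. G x * indicator (X i) x \<partial>M) \<partial>count_space C) \<le> (\<integral>\<^sup>+x. G x \<partial>M)"
proof -
  have "(\<integral>\<^sup>+i. (\<integral>\<^sup>+x. G x * indicator (X i) x \<partial>M) \<partial>count_space C) = (\<integral>\<^sup>+i. emeasure (density M G) (X i) \<partial>count_space C)"
    using X(1) by (intro nn_integral_cong) (simp add: emeasure_density)
  also have "\<dots> = emeasure (density M G) (\<Union>i\<in>C. X i)"
    using assms by (intro emeasure_UN_countable[symmetric]) auto
  also have "\<dots> \<le> emeasure (density M G) (space M)"
    using X(1) assms(1) by (intro emeasure_mono UN_least) (auto dest: sets.sets_into_space)
  also have "\<dots> = (\<integral>\<^sup>+x. G x \<partial>M)"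
    by (subst emeasure_density) (auto intro!: nn_integral_cong)
  finally show ?thesis .
qed

lemma emeasure_countable_subadditive:
  assumes "countable C" and X: "\<And>i. i \<in> C \<Longrightarrow> X i \<in> sets M"
  shows "emeasure M (\<Union>i\<in>C. X i) \<le> (\<integral>\<^sup>+i. emeasure M (X i) \<partial>count_space C)"
proof -
  have "emeasure M (\<Union>i\<in>C. X i) = (\<integral>\<^sup>+x. indicator (\<Union>i\<in>C. X i) x \<partial>M)"
    using assms by (intro nn_integral_indicator[symmetric]) auto
  also have "\<dots> \<le> (\<integral>\<^sup>+x. (\<integral>\<^sup>+i. indicator (X i) x \<partial>count_space C) \<partial>M)"
  proof (intro nn_integral_mono)
    fix x
    show "indicator (\<Union>i\<in>C. X i) x \<le> (\<integral>\<^sup>+i. (indicator (X i) x :: ennreal) \<partial>count_space C)"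
    proof (cases "x \<in> (\<Union>i\<in>C. X i)")
      case True
      then obtain i where i: "i \<in> C" "x \<in> X i" by blast
      have "(1::ennreal) = indicator (X i) x" using i by simp
      also have "\<dots> \<le> (\<integral>\<^sup>+i. indicator (X i) x \<partial>count_space C)" by (rule nn_integral_ge_point[OF i(1)])
      finally show ?thesis using True by simp
    qed simp
  qed
  also have "\<dots> = (\<integral>\<^sup>+i. (\<integral>\<^sup>+x. indicator (X i) x \<partial>M) \<partial>count_space C)"
    using assms by (intro nn_integral_count_space_nn_integral) auto
  also have "\<dots> = (\<integral>\<^sup>+i. emeasure M (X i) \<partial>count_space C)"
    using X by (intro nn_integral_cong) simp
  finally show ?thesis .
qed

text \<open>Each cube on which the mean exceeds \<open>t\<close> is placed in the ball about its
  corner with radius \<open>n\<close> times its side. A finite integral bounds these radii, so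
  Vitali's lemma yields disjoint balls whose fivefold dilates cover. The cubes in them are disjoint
  as well, and a dilate has volume at most \<open>(10 * n)^n\<close> times that of its cube.\<close>

lemma maximal_function_weak_type:
  fixes G :: "real ^ 'n \<Rightarrow> ennreal"
  assumes G [measurable]: "G \<in> borel_measurable lebesgue" and t: "0 < t"
  shows "ennreal t * emeasure lebesgue {x. ennreal t < maximal_function G x} \<le> ennreal ((10 * real CARD('n)) ^ CARD('n)) * (\<integral>\<^sup>+x. G x \<partial>lebesgue)"
proof (cases "(\<integral>\<^sup>+x. G x \<partial>lebesgue) = top")
  case True
  then show ?thesis by (simp add: ennreal_mult_top)
next
  case False
  define n where "n = CARD('n)"
  have n: "1 \<le> n" unfolding n_def by simp
  obtain I where I: "(\<integral>\<^sup>+x. G x \<partial>lebesgue) = ennreal I" "0 \<le> I" using False by (cases "\<integral>\<^sup>+x. G x \<partial>lebesgue") auto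
  define Q where "Q i = cbox (fst i) (fst i + snd i *\<^sub>R One)" for i :: "(real ^ 'n) \<times> real"
  define KK where "KK = {i :: (real ^ 'n) \<times> real. 0 < snd i \<and> ennreal t * ennreal (snd i ^ n) < (\<integral>\<^sup>+ y \<in> Q i. G y \<partial>lebesgue)}"
  define r where "r i = real n * snd i" for i :: "(real ^ 'n) \<times> real"
  have Qsub: "Q i \<subseteq> cball (fst i) (r i)" if "0 < snd i" for i
  proof
    fix x assume "x \<in> Q i"
    then have xi: "fst i $ k \<le> x $ k \<and> x $ k \<le> fst i $ k + snd i" for k unfolding Q_def mem_cube_iff by blast
    have "norm (fst i - x) \<le> real CARD('n) * snd i"
    proof (rule norm_le_of_coords)
      fix k show "\<bar>(fst i - x) $ k\<bar> \<le> snd i" using xi[of k] by (simp add: abs_le_iff)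
    qed
    then show "x \<in> cball (fst i) (r i)" by (simp add: dist_norm r_def n_def)
  qed
  have cover: "{x. ennreal t < maximal_function G x} \<subseteq> (\<Union>i\<in>KK. cball (fst i) (r i))"
  proof
    fix x assume "x \<in> {x. ennreal t < maximal_function G x}"
    then obtain a l where al: "0 < l" "x \<in> cbox a (a + l *\<^sub>R One)"
      "ennreal t * ennreal (l ^ CARD('n)) < (\<integral>\<^sup>+ y \<in> cbox a (a + l *\<^sub>R One). G y \<partial>lebesgue)"
      using less_maximal_function_iff by blast
    then have "(a, l) \<in> KK" unfolding KK_def Q_def n_def by simp
    moreover have "x \<in> cball (fst (a, l)) (r (a, l))" using Qsub[of "(a, l)"] al(1,2) unfolding Q_def by auto
    ultimately show "x \<in> (\<Union>i\<in>KK. cball (fst i) (r i))" by blast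
  qed
  have rad: "0 < r i \<and> r i \<le> real n * (1 + I / t)" if "i \<in> KK" for i
  proof -
    have l: "0 < snd i" using that by (simp add: KK_def)
    have "ennreal (t * snd i ^ n) = ennreal t * ennreal (snd i ^ n)" using t by (simp add: ennreal_mult')
    also have "\<dots> \<le> (\<integral>\<^sup>+ y \<in> Q i. G y \<partial>lebesgue)" using that by (simp add: KK_def less_imp_le)
    also have "\<dots> \<le> ennreal I" unfolding I(1)[symmetric] by (intro nn_integral_mono) (auto simp: indicator_def)
    finally have "t * snd i ^ n \<le> I" using I(2) by simp
    then have le: "snd i ^ n \<le> I / t" using t by (simp add: field_simps)
    have "snd i \<le> 1 + I / t"
    proof (cases "snd i \<le> 1")
      case True
      then show ?thesis using I(2) t by (simp add: add_increasing2)
    next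
      case False
      then have "snd i ^ 1 \<le> snd i ^ n" using n by (intro power_increasing) auto
      then show ?thesis using le by simp
    qed
    then show ?thesis using l n unfolding r_def by (intro conjI mult_left_mono) auto
  qed
  obtain C where C: "countable C" "C \<subseteq> KK" "pairwise (\<lambda>i j. disjnt (cball (fst i) (r i)) (cball (fst j) (r j))) C"
    "{x. ennreal t < maximal_function G x} \<subseteq> (\<Union>i\<in>C. cball (fst i) (5 * r i))"
    using Vitali_covering_lemma_cballs[OF cover rad] by blast
  have "emeasure lebesgue {x. ennreal t < maximal_function G x} \<le> emeasure lebesgue (\<Union>i\<in>C. cball (fst i) (5 * r i))"
    using C(1) by (intro emeasure_mono C(4)) auto
  also have "\<dots> \<le> (\<integral>\<^sup>+i. emeasure lebesgue (cball (fst i) (5 * r i)) \<partial>count_space C)"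
    using C(1) by (intro emeasure_countable_subadditive) auto
  finally have "ennreal t * emeasure lebesgue {x. ennreal t < maximal_function G x}
      \<le> ennreal t * (\<integral>\<^sup>+i. emeasure lebesgue (cball (fst i) (5 * r i)) \<partial>count_space C)"
    by (rule mult_left_mono) simp
  also have "\<dots> = (\<integral>\<^sup>+i. ennreal t * emeasure lebesgue (cball (fst i) (5 * r i)) \<partial>count_space C)"
    by (rule nn_integral_cmult[symmetric]) simp
  also have "\<dots> \<le> (\<integral>\<^sup>+i. ennreal ((10 * real n) ^ n) * (\<integral>\<^sup>+x. G x * indicator (Q i) x \<partial>lebesgue) \<partial>count_space C)"
  proof (intro nn_integral_mono)
    fix i assume "i \<in> space (count_space C)"
    then have i: "i \<in> KK" using C(2) by auto
    then have l: "0 < snd i" by (simp add: KK_def)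
    have "emeasure lebesgue (cball (fst i) (5 * r i)) \<le> ennreal ((2 * (5 * r i)) ^ n)"
      unfolding n_def using rad[OF i] by (intro emeasure_cball_le) simp
    then have "ennreal t * emeasure lebesgue (cball (fst i) (5 * r i)) \<le> ennreal t * ennreal ((2 * (5 * r i)) ^ n)"
      by (rule mult_left_mono) simp
    also have "(2 * (5 * r i)) ^ n = (10 * real n) ^ n * snd i ^ n" by (simp add: r_def power_mult_distrib)
    also have "ennreal t * ennreal ((10 * real n) ^ n * snd i ^ n) = ennreal ((10 * real n) ^ n) * (ennreal t * ennreal (snd i ^ n))"
      using l by (subst ennreal_mult) (auto simp: mult.left_commute)
    also have "\<dots> \<le> ennreal ((10 * real n) ^ n) * (\<integral>\<^sup>+x. G x * indicator (Q i) x \<partial>lebesgue)"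
      using i by (intro mult_left_mono) (auto simp: KK_def less_imp_le)
    finally show "ennreal t * emeasure lebesgue (cball (fst i) (5 * r i)) \<le> ennreal ((10 * real n) ^ n) * (\<integral>\<^sup>+x. G x * indicator (Q i) x \<partial>lebesgue)" .
  qed
  also have "\<dots> = ennreal ((10 * real n) ^ n) * (\<integral>\<^sup>+i. (\<integral>\<^sup>+x. G x * indicator (Q i) x \<partial>lebesgue) \<partial>count_space C)"
    by (rule nn_integral_cmult) simp
  also have "\<dots> \<le> ennreal ((10 * real n) ^ n) * (\<integral>\<^sup>+x. G x \<partial>lebesgue)"
  proof (intro mult_left_mono nn_integral_disjoint_le C(1) G)
    show "Q i \<in> sets lebesgue" for i unfolding Q_def by simp
    show "disjoint_family_on Q C"
      unfolding disjoint_family_on_def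
    proof (intro ballI impI)
      fix i j assume ij: "i \<in> C" "j \<in> C" "i \<noteq> j"
      then have "disjnt (cball (fst i) (r i)) (cball (fst j) (r j))" using C(3) by (auto simp: pairwise_def)
      moreover have "0 < snd i" "0 < snd j" using ij C(2) by (auto simp: KK_def)
      ultimately show "Q i \<inter> Q j = {}" using Qsub[of i] Qsub[of j] unfolding disjnt_def by blast
    qed
  qed simp
  finally show ?thesis unfolding n_def .
qed

lemma sigma_finite_lebesgue: "sigma_finite_measure (lebesgue :: 'a::euclidean_space measure)"
proof
  obtain A :: "'a set set" where A: "countable A" "A \<subseteq> sets lborel" "\<Union>A = space lborel" "\<forall>a\<in>A. emeasure lborel a \<noteq> \<infinity>"
    using lborel.sigma_finite_countable by blast
  show "\<exists>A::'a set set. countable A \<and> A \<subseteq> sets lebesgue \<and> \<Union>A = space lebesgue \<and> (\<forall>a\<in>A. emeasure lebesgue a \<noteq> \<infinity>)"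
  proof (intro exI[of _ A] conjI)
    show "A \<subseteq> sets lebesgue" using A(2) by auto
    show "\<forall>a\<in>A. emeasure lebesgue a \<noteq> \<infinity>"
    proof
      fix a assume "a \<in> A"
      then have "a \<in> sets lborel" using A(2) by blast
      then have "emeasure lebesgue a = emeasure lborel a" by simp
      then show "emeasure lebesgue a \<noteq> \<infinity>" using A(4) \<open>a \<in> A\<close> by auto
    qed
  qed (use A in auto)
qed

text \<open>Fubini's theorem, with \<open>u x powr p\<close> written as the integral of
  \<open>p * t powr (p - 1)\<close> over \<open>0 < t < u x\<close>. The weight \<open>w\<close> is
  there for the maximal inequality, where level sets are measured with density
  \<open>F\<close>.\<close>

lemma layer_cake:
  fixes u :: "real ^ 'n \<Rightarrow> real" and w :: "real ^ 'n \<Rightarrow> ennreal"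
  assumes p: "0 < p" and u [measurable]: "u \<in> borel_measurable lebesgue" "\<And>x. 0 \<le> u x"
    and w [measurable]: "w \<in> borel_measurable lebesgue"
  shows "(\<integral>\<^sup>+x. w x * ennreal (u x powr p) \<partial>lebesgue)
    = (\<integral>\<^sup>+t. ennreal (indicator {0<..} t * (p * t powr (p - 1))) * (\<integral>\<^sup>+x. w x * indicator {x. t < u x} x \<partial>lebesgue) \<partial>lborel)"
proof -
  interpret lebesgue: sigma_finite_measure "lebesgue :: (real ^ 'n) measure" by (rule sigma_finite_lebesgue)
  interpret P: pair_sigma_finite "lebesgue :: (real ^ 'n) measure" "lborel :: real measure" ..
  define k where "k t = ennreal (indicator {0<..} t * (p * t powr (p - 1)))" for t
  have [measurable]: "k \<in> borel_measurable borel" unfolding k_def by measurable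
  have inner: "ennreal (c powr p) = (\<integral>\<^sup>+t. k t * indicator {t. t < c} t \<partial>lborel)" if c: "0 \<le> c" for c
  proof -
    have "((\<lambda>t. t powr (p - 1)) has_integral (c powr (p - 1 + 1) / (p - 1 + 1))) {0..c}"
      using p c by (intro has_integral_powr_from_0) auto
    then have "((\<lambda>t. p * t powr (p - 1)) has_integral (p * (c powr p / p))) {0..c}"
      by (intro has_integral_mult_right) simp
    then have "((\<lambda>t. p * t powr (p - 1)) has_integral (c powr p)) {0..c}" using p by simp
    then have "(\<integral>\<^sup>+t. ennreal (p * t powr (p - 1)) * indicator {0..c} t \<partial>lborel) = ennreal (c powr p)"
      using p by (intro nn_integral_has_integral_lebesgue') auto
    moreover have "(\<integral>\<^sup>+t. ennreal (p * t powr (p - 1)) * indicator {0..c} t \<partial>lborel) = (\<integral>\<^sup>+t. k t * indicator {t. t < c} t \<partial>lborel)"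
    proof (rule nn_integral_cong_AE)
      have "AE t in lborel. t \<noteq> 0" "AE t in lborel. t \<noteq> c" by (rule AE_lborel_singleton)+
      then show "AE t in lborel. ennreal (p * t powr (p - 1)) * indicator {0..c} t = k t * indicator {t. t < c} t"
        by eventually_elim (auto simp: k_def indicator_def)
    qed
    ultimately show ?thesis by simp
  qed
  have "(\<integral>\<^sup>+x. w x * ennreal (u x powr p) \<partial>lebesgue) = (\<integral>\<^sup>+x. (\<integral>\<^sup>+t. w x * (k t * indicator {t. t < u x} t) \<partial>lborel) \<partial>lebesgue)"
  proof (intro nn_integral_cong)
    fix x
    show "w x * ennreal (u x powr p) = (\<integral>\<^sup>+t. w x * (k t * indicator {t. t < u x} t) \<partial>lborel)"
      unfolding inner[OF u(2)] by (rule nn_integral_cmult[symmetric]) measurable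
  qed
  also have "\<dots> = (\<integral>\<^sup>+t. (\<integral>\<^sup>+x. w x * (k t * indicator {t. t < u x} t) \<partial>lebesgue) \<partial>lborel)"
    by (rule P.Fubini'[symmetric]) measurable
  also have "\<dots> = (\<integral>\<^sup>+t. k t * (\<integral>\<^sup>+x. w x * indicator {x. t < u x} x \<partial>lebesgue) \<partial>lborel)"
  proof (intro nn_integral_cong)
    fix t
    have "(\<integral>\<^sup>+x. w x * (k t * indicator {t. t < u x} t) \<partial>lebesgue) = (\<integral>\<^sup>+x. k t * (w x * indicator {x. t < u x} x) \<partial>lebesgue)"
      by (intro nn_integral_cong) (auto simp: indicator_def mult.commute)
    also have "\<dots> = k t * (\<integral>\<^sup>+x. w x * indicator {x. t < u x} x \<partial>lebesgue)"
      by (rule nn_integral_cmult) measurable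
    finally show "(\<integral>\<^sup>+x. w x * (k t * indicator {t. t < u x} t) \<partial>lebesgue) = k t * (\<integral>\<^sup>+x. w x * indicator {x. t < u x} x \<partial>lebesgue)" .
  qed
  finally show ?thesis unfolding k_def .
qed

lemma layer_cake_measure:
  fixes u :: "real ^ 'n \<Rightarrow> real"
  assumes p: "0 < p" and u [measurable]: "u \<in> borel_measurable lebesgue" and nn: "\<And>x. 0 \<le> u x"
  shows "(\<integral>\<^sup>+x. ennreal (u x powr p) \<partial>lebesgue)
    = (\<integral>\<^sup>+t. ennreal (indicator {0<..} t * (p * t powr (p - 1))) * emeasure lebesgue {x. t < u x} \<partial>lborel)"
proof -
  have "{x. t < u x} \<in> sets lebesgue" for t
  proof -
    have "{x \<in> space lebesgue. t < u x} \<in> sets lebesgue" by measurable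
    then show ?thesis by simp
  qed
  then have "(\<integral>\<^sup>+x. 1 * indicator {x. t < u x} x \<partial>lebesgue) = emeasure lebesgue {x. t < u x}" for t
    by (simp del: emeasure_completion)
  then show ?thesis using layer_cake[OF p u nn, of "\<lambda>_. 1"] by simp
qed

text \<open>\<open>enn2real\<close> sends \<open>\<infinity>\<close> to 0, so this is the maximal
  function only where the latter is finite; for \<open>F\<close> bounded above \<open>MFr_eq\<close>
  secures that.\<close>

definition MFr :: "(real ^ 'n \<Rightarrow> real) \<Rightarrow> real ^ 'n \<Rightarrow> real" where
  "MFr F x = enn2real (maximal_function (\<lambda>y. ennreal (F y)) x)"

lemma maximal_function_le_const:
  fixes G :: "real ^ 'n \<Rightarrow> ennreal"
  assumes "\<And>y. G y \<le> ennreal B"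
  shows "maximal_function G x \<le> ennreal B"
proof (rule ccontr)
  assume "\<not> maximal_function G x \<le> ennreal B"
  then obtain a l where al: "0 < l" "ennreal B * ennreal (l ^ CARD('n)) < (\<integral>\<^sup>+ y \<in> cbox a (a + l *\<^sub>R One). G y \<partial>lebesgue)"
    unfolding not_le less_maximal_function_iff by blast
  have "(\<integral>\<^sup>+ y \<in> cbox a (a + l *\<^sub>R One). G y \<partial>lebesgue) \<le> (\<integral>\<^sup>+ y. ennreal B * indicator (cbox a (a + l *\<^sub>R One)) y \<partial>lebesgue)"
    using assms by (intro nn_integral_mono mult_right_mono) auto
  also have "\<dots> = ennreal B * ennreal (l ^ CARD('n))"
    using al(1) by (subst nn_integral_cmult_indicator) (auto simp: emeasure_cube simp del: emeasure_completion)
  finally show False using al(2) by simp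
qed

lemma MFr_eq:
  assumes "\<And>x. F x \<le> B"
  shows "ennreal (MFr F x) = maximal_function (\<lambda>y. ennreal (F y)) x"
proof -
  have "maximal_function (\<lambda>y. ennreal (F y)) x \<le> ennreal B"
    using assms by (intro maximal_function_le_const ennreal_leI)
  then have "maximal_function (\<lambda>y. ennreal (F y)) x < top" by (rule le_less_trans) simp
  then show ?thesis unfolding MFr_def by simp
qed

lemma MFr_nonneg [simp]: "0 \<le> MFr F x"
  by (simp add: MFr_def)

lemma MFr_measurable [measurable]: "MFr F \<in> borel_measurable lebesgue"
  unfolding MFr_def by measurable

text \<open>Marcinkiewicz's argument between weak \<open>L^1\<close> and the sup norm. The part of
  \<open>F\<close> below \<open>t\<close> adds at most \<open>t\<close> to any mean, so a maximal
  function above \<open>2 * t\<close> forces that of the part above \<open>t\<close> to exceed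
  \<open>t\<close>, and the weak type bound is applied to this part at each level. Integrating
  \<open>p * t powr (p - 2)\<close> over the levels produces the factor
  \<open>p / (p - 1)\<close>.\<close>

lemma maximal_function_strong_type:
  fixes p :: real
  assumes p: "1 < p"
  obtains C where "0 < C" "\<And>(F :: real ^ 'n \<Rightarrow> real) B. F \<in> borel_measurable lebesgue \<Longrightarrow> (\<And>x. 0 \<le> F x) \<Longrightarrow> (\<And>x. F x \<le> B) \<Longrightarrow>
    (\<integral>\<^sup>+x. ennreal (MFr F x powr p) \<partial>lebesgue) \<le> ennreal C * (\<integral>\<^sup>+x. ennreal (F x powr p) \<partial>lebesgue)"
proof -
  define A where "A = (10 * real CARD('n)) ^ CARD('n)"
  have A: "0 < A" unfolding A_def by simp
  define C where "C = 2 powr p * (A * (p / (p - 1)))"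
  show ?thesis
  proof (rule that[of C])
    show "0 < C" unfolding C_def using A p by simp
    fix F :: "real ^ 'n \<Rightarrow> real" and B
    assume F [measurable]: "F \<in> borel_measurable lebesgue" and F0: "\<And>x. 0 \<le> F x" and FB: "\<And>x. F x \<le> B"
    have weak: "ennreal t * emeasure lebesgue {x. t < MFr F x / 2} \<le> ennreal A * (\<integral>\<^sup>+x. ennreal (F x) * indicator {x. t < F x} x \<partial>lebesgue)"
      if t: "0 < t" for t
    proof -
      define G where "G x = ennreal (F x) * indicator {x. t < F x} x" for x
      have [measurable]: "G \<in> borel_measurable lebesgue" unfolding G_def by measurable
      have "{x. t < MFr F x / 2} \<subseteq> {x. ennreal t < maximal_function G x}"
      proof
        fix x assume "x \<in> {x. t < MFr F x / 2}"
        then have "2 * t < MFr F x" by simp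
        then have "ennreal (2 * t) < ennreal (MFr F x)" using t by (simp add: ennreal_less_iff)
        then have "ennreal (2 * t) < maximal_function (\<lambda>y. ennreal (F y)) x" unfolding MFr_eq[OF FB] .
        from this[unfolded less_maximal_function_iff] obtain a l where al: "0 < l" "x \<in> cbox a (a + l *\<^sub>R One)"
          "ennreal (2 * t) * ennreal (l ^ CARD('n)) < (\<integral>\<^sup>+ y \<in> cbox a (a + l *\<^sub>R One). ennreal (F y) \<partial>lebesgue)"
          by blast
        define R where "R = cbox a (a + l *\<^sub>R One)"
        have Rs [measurable]: "R \<in> sets lebesgue" unfolding R_def by simp
        have "(\<integral>\<^sup>+ y \<in> R. ennreal (F y) \<partial>lebesgue) \<le> (\<integral>\<^sup>+ y. G y * indicator R y + ennreal t * indicator R y \<partial>lebesgue)"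
          using t by (intro nn_integral_mono) (auto simp: G_def indicator_def not_less intro: ennreal_leI)
        also have "\<dots> = (\<integral>\<^sup>+ y \<in> R. G y \<partial>lebesgue) + (\<integral>\<^sup>+ y. ennreal t * indicator R y \<partial>lebesgue)"
          by (rule nn_integral_add) measurable
        also have "(\<integral>\<^sup>+ y. ennreal t * indicator R y \<partial>lebesgue) = ennreal t * ennreal (l ^ CARD('n))"
          using emeasure_cube[of l a] al(1) Rs unfolding R_def
          by (subst nn_integral_cmult_indicator) (auto simp del: emeasure_completion)
        finally have "ennreal (2 * t) * ennreal (l ^ CARD('n)) < (\<integral>\<^sup>+ y \<in> R. G y \<partial>lebesgue) + ennreal t * ennreal (l ^ CARD('n))"
          using al(3) unfolding R_def by (rule less_le_trans[rotated])
        moreover have "ennreal (2 * t) * ennreal (l ^ CARD('n)) = ennreal t * ennreal (l ^ CARD('n)) + ennreal t * ennreal (l ^ CARD('n))"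
          using t al(1) by (simp add: ennreal_mult[symmetric] ennreal_plus[symmetric] del: ennreal_plus)
        ultimately have "ennreal t * ennreal (l ^ CARD('n)) < (\<integral>\<^sup>+ y \<in> R. G y \<partial>lebesgue)"
          by (simp add: add.commute[of "\<integral>\<^sup>+ y \<in> R. G y \<partial>lebesgue"] ennreal_add_left_cancel_less)
        then show "x \<in> {x. ennreal t < maximal_function G x}"
          unfolding less_maximal_function_iff mem_Collect_eq R_def using al(1,2) by blast
      qed
      then have "ennreal t * emeasure lebesgue {x. t < MFr F x / 2} \<le> ennreal t * emeasure lebesgue {x. ennreal t < maximal_function G x}"
        using open_superlevel_maximal_function[of "ennreal t" G] by (intro mult_left_mono emeasure_mono) auto
      also have "\<dots> \<le> ennreal A * (\<integral>\<^sup>+x. G x \<partial>lebesgue)" unfolding A_def by (rule maximal_function_weak_type[OF _ t]) measurable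
      finally show ?thesis unfolding G_def .
    qed
    have "(\<integral>\<^sup>+x. ennreal ((MFr F x / 2) powr p) \<partial>lebesgue)
      = (\<integral>\<^sup>+t. ennreal (indicator {0<..} t * (p * t powr (p - 1))) * emeasure lebesgue {x. t < MFr F x / 2} \<partial>lborel)"
      using p by (intro layer_cake_measure) auto
    also have "\<dots> \<le> (\<integral>\<^sup>+t. ennreal (A * (p / (p - 1))) * (ennreal (indicator {0<..} t * ((p - 1) * t powr (p - 1 - 1))) * (\<integral>\<^sup>+x. ennreal (F x) * indicator {x. t < F x} x \<partial>lebesgue)) \<partial>lborel)"
    proof (intro nn_integral_mono)
      fix t :: real
      show "ennreal (indicator {0<..} t * (p * t powr (p - 1))) * emeasure lebesgue {x. t < MFr F x / 2}
        \<le> ennreal (A * (p / (p - 1))) * (ennreal (indicator {0<..} t * ((p - 1) * t powr (p - 1 - 1))) * (\<integral>\<^sup>+x. ennreal (F x) * indicator {x. t < F x} x \<partial>lebesgue))"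
      proof (cases "0 < t")
        case True
        then have ind: "indicator {0<..} t = (1::real)" by simp
        have "p * t powr (p - 1) = (p * t powr (p - 1 - 1)) * t" using True powr_mult_base[of t "p - 1 - 1"] by (simp add: mult.commute mult.left_commute)
        then have "ennreal (indicator {0<..} t * (p * t powr (p - 1))) * emeasure lebesgue {x. t < MFr F x / 2}
          = ennreal (p * t powr (p - 1 - 1)) * (ennreal t * emeasure lebesgue {x. t < MFr F x / 2})"
          using True p by (simp add: ennreal_mult mult.assoc del: emeasure_completion)
        also have "\<dots> \<le> ennreal (p * t powr (p - 1 - 1)) * (ennreal A * (\<integral>\<^sup>+x. ennreal (F x) * indicator {x. t < F x} x \<partial>lebesgue))"
          by (intro mult_left_mono weak True) simp
        also have "\<dots> = ennreal (p * t powr (p - 1 - 1) * A) * (\<integral>\<^sup>+x. ennreal (F x) * indicator {x. t < F x} x \<partial>lebesgue)"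
          using A p by (simp add: ennreal_mult mult.assoc)
        also have "p * t powr (p - 1 - 1) * A = (A * (p / (p - 1))) * ((p - 1) * t powr (p - 1 - 1))" using p by simp
        also have "ennreal ((A * (p / (p - 1))) * ((p - 1) * t powr (p - 1 - 1))) = ennreal (A * (p / (p - 1))) * ennreal ((p - 1) * t powr (p - 1 - 1))"
          using A p by (intro ennreal_mult') simp
        finally show ?thesis by (simp only: ind mult_1 mult.assoc)
      qed simp
    qed
    also have "\<dots> = ennreal (A * (p / (p - 1))) * (\<integral>\<^sup>+t. ennreal (indicator {0<..} t * ((p - 1) * t powr (p - 1 - 1))) * (\<integral>\<^sup>+x. ennreal (F x) * indicator {x. t < F x} x \<partial>lebesgue) \<partial>lborel)"
    proof (rule nn_integral_cmult)
      interpret lebesgue: sigma_finite_measure "lebesgue :: (real ^ 'n) measure" by (rule sigma_finite_lebesgue)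
      show "(\<lambda>t. ennreal (indicator {0<..} t * ((p - 1) * t powr (p - 1 - 1))) * (\<integral>\<^sup>+x. ennreal (F x) * indicator {x. t < F x} x \<partial>lebesgue)) \<in> borel_measurable lborel"
        by measurable
    qed
    also have "(\<integral>\<^sup>+t. ennreal (indicator {0<..} t * ((p - 1) * t powr (p - 1 - 1))) * (\<integral>\<^sup>+x. ennreal (F x) * indicator {x. t < F x} x \<partial>lebesgue) \<partial>lborel)
       = (\<integral>\<^sup>+x. ennreal (F x) * ennreal (F x powr (p - 1)) \<partial>lebesgue)"
      using p F0 by (intro layer_cake[symmetric]) auto
    also have "\<dots> = (\<integral>\<^sup>+x. ennreal (F x powr p) \<partial>lebesgue)"
    proof (intro nn_integral_cong)
      fix x
      show "ennreal (F x) * ennreal (F x powr (p - 1)) = ennreal (F x powr p)"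
        using F0[of x] p by (cases "F x = 0") (auto simp: ennreal_mult[symmetric] powr_mult_base)
    qed
    finally have half: "(\<integral>\<^sup>+x. ennreal ((MFr F x / 2) powr p) \<partial>lebesgue) \<le> ennreal (A * (p / (p - 1))) * (\<integral>\<^sup>+x. ennreal (F x powr p) \<partial>lebesgue)" .
    have "(\<integral>\<^sup>+x. ennreal (MFr F x powr p) \<partial>lebesgue) = (\<integral>\<^sup>+x. ennreal (2 powr p) * ennreal ((MFr F x / 2) powr p) \<partial>lebesgue)"
      by (intro nn_integral_cong) (simp add: ennreal_mult[symmetric] powr_mult[symmetric])
    also have "\<dots> = ennreal (2 powr p) * (\<integral>\<^sup>+x. ennreal ((MFr F x / 2) powr p) \<partial>lebesgue)"
      by (rule nn_integral_cmult) measurable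
    also have "\<dots> \<le> ennreal (2 powr p) * (ennreal (A * (p / (p - 1))) * (\<integral>\<^sup>+x. ennreal (F x powr p) \<partial>lebesgue))"
      by (intro mult_left_mono half) simp
    also have "\<dots> = ennreal C * (\<integral>\<^sup>+x. ennreal (F x powr p) \<partial>lebesgue)"
      unfolding C_def by (subst ennreal_mult') (simp_all only: mult.assoc powr_ge_zero)
    finally show "(\<integral>\<^sup>+x. ennreal (MFr F x powr p) \<partial>lebesgue) \<le> ennreal C * (\<integral>\<^sup>+x. ennreal (F x powr p) \<partial>lebesgue)" .
  qed
qed

section \<open>Local oscillation of the operator\<close>

lemma MFr_upper:
  fixes F :: "real ^ 'n \<Rightarrow> real"
  assumes B: "\<And>x. F x \<le> B" and F: "F \<in> borel_measurable lebesgue" "\<And>x. 0 \<le> F x"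
    and l: "0 < l" and x: "x \<in> cbox a (a + l *\<^sub>R One)"
  shows "(\<integral>\<^sup>+ y \<in> cbox a (a + l *\<^sub>R One). ennreal (F y) \<partial>lebesgue) \<le> ennreal (MFr F x * l ^ CARD('n))"
proof -
  have "(\<integral>\<^sup>+ y \<in> cbox a (a + l *\<^sub>R One). ennreal (F y) \<partial>lebesgue) \<le> maximal_function (\<lambda>y. ennreal (F y)) x * ennreal (l ^ CARD('n))"
    by (rule maximal_function_upper[OF l x])
  also have "\<dots> = ennreal (MFr F x * l ^ CARD('n))"
    unfolding MFr_eq[OF B, symmetric] by (simp add: ennreal_mult')
  finally show ?thesis .
qed

context cz_operator
begin

text \<open>In \<open>AA\<close> the summand \<open>A1\<close> comes from the near part and
  \<open>c * D\<close> from the far part; neither depends on \<open>N\<close> or \<open>f\<close>.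
  The point at which the far kernel integrals are evaluated is the corner \<open>a\<close>. The
  clause on \<open>cc\<close> covers cubes so large relative to \<open>f\<close> that the far part
  vanishes.\<close>

lemma oscillation_of_weak_type:
  assumes q: "1 < q" and C: "0 < C"
  obtains AA where "0 < AA" "\<And>N f. weak_type q N C \<Longrightarrow> (\<And>j. j < N \<Longrightarrow> f j \<in> Bc) \<Longrightarrow>
     \<exists>cc w. local_oscillation (\<lambda>x. lqn q N (\<lambda>j. T (f j) x)) (\<lambda>x. AA * MFr (\<lambda>x. lqn q N (\<lambda>j. f j x)) x) cc w \<and>
       (\<forall>a l. 0 < l \<longrightarrow> (\<forall>j<N. \<forall>x. x \<notin> cball a (2 * (real CARD('n) * l)) \<longrightarrow> f j x = 0) \<longrightarrow> cc a l = 0)"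
proof -
  define n where "n = CARD('n)"
  have n: "1 \<le> n" unfolding n_def by simp
  define D where "D = (2::real) ^ n * (2 ^ n / (1 - 2 powr - \<epsilon>))"
  have D: "0 \<le> D"
  proof -
    have "2 powr - \<epsilon> \<le> 1" using eps_pos powr_mono[of "- \<epsilon>" 0 2] by simp
    then show ?thesis unfolding D_def by simp
  qed
  \<comment> \<open>The near part has integral at most \<open>m a l * (4 * n * l)^n\<close>, the
    ball of radius \<open>2 * n * l\<close> lying in a cube of side \<open>4 * n * l\<close>. At
    level \<open>A1 * m a l\<close> the weak type inequality then leaves at most the proportion
    \<open>2^-(n+3)\<close> allowed for an exceptional set.\<close>
  define A1 where "A1 = 2 ^ (n + 3) * C * (4 * real n) ^ n"
  have A1: "0 < A1" unfolding A1_def using C n by simp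
  define AA where "AA = A1 + c * D"
  have AA: "0 < AA" unfolding AA_def using A1 c_nonneg D by (intro add_pos_nonneg) auto
  show ?thesis
  proof (rule that[OF AA])
    fix N and f :: "nat \<Rightarrow> real ^ 'n \<Rightarrow> complex" assume weak: "weak_type q N C" and f: "\<And>j. j < N \<Longrightarrow> f j \<in> Bc"
    define F where "F = (\<lambda>x. lqn q N (\<lambda>j. f j x))"
    have Fm [measurable]: "F \<in> borel_measurable lebesgue" unfolding F_def using Bc_lqn(4)[OF q f] .
    have F0: "\<And>x. 0 \<le> F x" unfolding F_def by simp
    have "\<exists>M>0. \<forall>x. lqn q N (\<lambda>j. f j x) \<le> M" by (rule Bc_lqn(2)[OF q f])
    then obtain M where "M > 0 \<and> (\<forall>x. lqn q N (\<lambda>j. f j x) \<le> M)" ..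
    then have FM: "F x \<le> M" for x by (simp add: F_def)
    have Fint: "integrable lebesgue F" unfolding F_def by (rule Bc_lqn(1)[OF q f])
    define rad where "rad l = real n * l" for l
    define f1 where "f1 a l j x = of_real (indicator (cball a (2 * rad l)) x) * f j x" for a l j x
    define f2 where "f2 a l j x = of_real (indicator (- cball a (2 * rad l)) x) * f j x" for a l j x
    define cc where "cc a l = lqn q N (\<lambda>j. LINT y|lebesgue. K a y * f2 a l j y)" for a l
    define m where "m a l = Inf (MFr F ` hcube a l)" for a l
    define w where "w a l = AA * m a l" for a l
    have f1Bc: "f1 a l j \<in> Bc" if "j < N" for a l j unfolding f1_def using f[OF that] by (intro Bc_indicator) auto
    have f2Bc: "f2 a l j \<in> Bc" if "j < N" for a l j
    proof -
      have "space lebesgue - cball a (2 * rad l) \<in> sets lebesgue" by (intro sets.compl_sets) simp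
      then show ?thesis unfolding f2_def using f[OF that] by (intro Bc_indicator) (simp_all add: Compl_eq_Diff_UNIV)
    qed
    have bdd: "bdd_below (MFr F ` X)" for X by (rule bdd_belowI[of _ 0]) auto
    have m_le: "m a l \<le> MFr F x" if "x \<in> hcube a l" for a l x
      unfolding m_def using that by (intro cINF_lower bdd)
    have ane: "a \<in> hcube a l" if "0 < l" for a :: "real ^ 'n" and l using that by (simp add: hcube_def)
    have m0: "0 \<le> m a l" if "0 < l" for a l
      unfolding m_def using ane[OF that] by (intro cINF_greatest) auto
    \<comment> \<open>A cube of side \<open>2 * t\<close> contains both the ball and all of
      \<open>hcube a l\<close>, so the same integral is bounded through the maximal function at
      every point of \<open>hcube a l\<close>. Division by the volume then permits passing to the
      infimum.\<close>
    have avg: "(\<integral>\<^sup>+x. ennreal (F x) * indicator (cball a t) x \<partial>lebesgue) \<le> ennreal (m a l * 2 ^ n * t ^ n)"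
      if l: "0 < l" and t: "2 * rad l \<le> t" for a l t
    proof -
      have radl: "l \<le> rad l" using n l unfolding rad_def by simp
      then have t0: "0 < t" "l \<le> t" using t l by auto
      have "(\<integral>\<^sup>+x. ennreal (F x) * indicator (cball a t) x \<partial>lebesgue) \<le> ennreal (MFr F x * (2 * t) ^ n)" if x: "x \<in> hcube a l" for x
      proof -
        have "(\<integral>\<^sup>+x. ennreal (F x) * indicator (cball a t) x \<partial>lebesgue)
          \<le> (\<integral>\<^sup>+ y \<in> cbox (a - t *\<^sub>R One) (a - t *\<^sub>R One + (2 * t) *\<^sub>R One). ennreal (F y) \<partial>lebesgue)"
          using cball_subset_cube[of a t] by (intro nn_integral_mono) (auto simp: indicator_def)
        also have "\<dots> \<le> ennreal (MFr F x * (2 * t) ^ CARD('n))"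
        proof (rule MFr_upper[OF FM Fm F0])
          show "0 < 2 * t" using t0 by simp
          have "a $ i \<le> x $ i \<and> x $ i < a $ i + l" for i using x by (simp add: hcube_def)
          then have "a $ i - t \<le> x $ i \<and> x $ i \<le> a $ i - t + 2 * t" for i
            using t0 by (smt (verit))
          then show "x \<in> cbox (a - t *\<^sub>R One) (a - t *\<^sub>R One + (2 * t) *\<^sub>R One)"
            unfolding mem_cube_iff by simp
        qed
        finally show ?thesis unfolding n_def .
      qed
      note all = this
      define X where "X = (\<integral>\<^sup>+x. ennreal (F x) * indicator (cball a t) x \<partial>lebesgue)"
      have "X \<le> ennreal (MFr F a * (2 * t) ^ n)" unfolding X_def by (rule all[OF ane[OF l]])
      then have "X < top" by (rule le_less_trans) simp
      then obtain r where r: "X = ennreal r" "0 \<le> r" unfolding less_top_ennreal by blast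
      have "r / (2 * t) ^ n \<le> MFr F x" if "x \<in> hcube a l" for x
      proof -
        have "ennreal r \<le> ennreal (MFr F x * (2 * t) ^ n)" using all[OF that] unfolding X_def[symmetric] r(1) .
        then have "r \<le> MFr F x * (2 * t) ^ n" using t0 by (subst (asm) ennreal_le_iff) auto
        then show ?thesis using t0 by (simp add: divide_le_eq)
      qed
      then have "r / (2 * t) ^ n \<le> m a l" unfolding m_def using ane[OF l] by (intro cINF_greatest) auto
      then have "r \<le> m a l * (2 * t) ^ n" using t0 by (simp add: divide_le_eq)
      then show ?thesis unfolding X_def[symmetric] r(1) by (intro ennreal_leI) (simp add: power_mult_distrib mult.assoc)
    qed
    have "local_oscillation (\<lambda>x. lqn q N (\<lambda>j. T (f j) x)) (\<lambda>x. AA * MFr F x) cc w"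
    proof
      show "(\<lambda>x. lqn q N (\<lambda>j. T (f j) x)) \<in> borel_measurable lebesgue" by (rule T_lqn_measurable[OF f])
      show "0 \<le> AA * MFr F x" for x using AA by simp
      show "w a l \<le> AA * MFr F x" if "0 < l" "x \<in> hcube a l" for a l x
        unfolding w_def using AA m_le[OF that(2)] by (intro mult_left_mono) auto
      fix a :: "real ^ 'n" and l :: real assume l: "0 < l"
      have radl: "0 < rad l" unfolding rad_def using n l by simp
      have near: "norm (x - a) \<le> rad l" if "x \<in> hcube a l" for x
        unfolding rad_def n_def using that ane[OF l] by (rule hcube_dist)
      have inner: "2 ^ (n + 3) * emeasure lebesgue {x. A1 * m a l < lqn q N (\<lambda>j. T (f1 a l j) x)} \<le> ennreal (l ^ n)"
      proof -
        have F1: "lqn q N (\<lambda>j. f1 a l j x) = indicator (cball a (2 * rad l)) x * F x" for x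
          unfolding f1_def lqn_scale[OF q] F_def by simp
        have int1: "integrable lebesgue (\<lambda>x. indicator (cball a (2 * rad l)) x * F x)"
          using integrable_mult_indicator[of "cball a (2 * rad l)" lebesgue F] Fint by simp
        have "ennreal (LINT x|lebesgue. indicator (cball a (2 * rad l)) x * F x) = (\<integral>\<^sup>+x. ennreal (F x) * indicator (cball a (2 * rad l)) x \<partial>lebesgue)"
          using F0 by (subst nn_integral_eq_integral[OF int1, symmetric]) (auto intro!: nn_integral_cong simp: indicator_def)
        also have "\<dots> \<le> ennreal (m a l * 2 ^ n * (2 * rad l) ^ n)" by (rule avg[OF l]) simp
        finally have I1: "(LINT x|lebesgue. indicator (cball a (2 * rad l)) x * F x) \<le> m a l * 2 ^ n * (2 * rad l) ^ n"
          using m0[OF l] radl by (subst (asm) ennreal_le_iff) auto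
        have ww: "ennreal s * emeasure lebesgue {x. s < lqn q N (\<lambda>j. T (f1 a l j) x)} \<le> ennreal (C * (m a l * (4 * real n) ^ n * l ^ n))" if s: "0 < s" for s
        proof -
          have "ennreal s * emeasure lebesgue {x. s < lqn q N (\<lambda>j. T (f1 a l j) x)} \<le> ennreal (C * (LINT x|lebesgue. lqn q N (\<lambda>j. f1 a l j x)))"
            using weak f1Bc s unfolding weak_type_def by blast
          also have "\<dots> \<le> ennreal (C * (m a l * 2 ^ n * (2 * rad l) ^ n))"
            unfolding F1 using I1 C by (intro ennreal_leI mult_left_mono) auto
          also have "m a l * 2 ^ n * (2 * rad l) ^ n = m a l * (4 * real n) ^ n * l ^ n"
          proof -
            have "(2::real) ^ n * 2 ^ n = 4 ^ n" by (simp add: power_mult_distrib[symmetric])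
            then show ?thesis by (simp add: rad_def power_mult_distrib)
          qed
          finally show ?thesis .
        qed
        show ?thesis
        proof (cases "m a l = 0")
          case False
          then have m: "0 < m a l" using m0[OF l, of a] by linarith
          have "ennreal (A1 * m a l) * emeasure lebesgue {x. A1 * m a l < lqn q N (\<lambda>j. T (f1 a l j) x)} \<le> ennreal (C * (m a l * (4 * real n) ^ n * l ^ n))"
            using A1 m by (intro ww) simp
          moreover define Y where "Y = C * (m a l * (4 * real n) ^ n)"
          have Y: "0 < Y" unfolding Y_def using C m n by simp
          have "A1 * m a l = Y * 2 ^ (n + 3)" unfolding Y_def A1_def by simp
          moreover have "C * (m a l * (4 * real n) ^ n * l ^ n) = Y * l ^ n" unfolding Y_def by simp
          ultimately have "ennreal Y * (ennreal (2 ^ (n + 3)) * emeasure lebesgue {x. A1 * m a l < lqn q N (\<lambda>j. T (f1 a l j) x)}) \<le> ennreal Y * ennreal (l ^ n)"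
            using Y by (simp only: ennreal_mult' less_imp_le mult.assoc)
          then show ?thesis using Y unfolding two_power_ennreal by (subst (asm) ennreal_mult_le_mult_iff) auto
        next
          \<comment> \<open>The weak type inequality needs a positive level. If the infimum
            vanishes, it shows \<open>Z s\<close> to be null for each \<open>s > 0\<close>, and
            \<open>Z 0\<close> is a countable union of such sets.\<close>
          case True
          define Z where "Z s = {x. s < lqn q N (\<lambda>j. T (f1 a l j) x)}" for s :: real
          have "emeasure lebesgue (Z s) = 0" if "0 < s" for s
            using ww[OF that] that unfolding True Z_def by (simp del: emeasure_completion)
          moreover have Zs: "Z s \<in> sets lebesgue" for s
          proof -
            note [measurable] = T_lqn_measurable[OF f1Bc]
            have "{x \<in> space lebesgue. s < lqn q N (\<lambda>j. T (f1 a l j) x)} \<in> sets lebesgue" by measurable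
            then show ?thesis unfolding Z_def by simp
          qed
          ultimately have nul: "(\<Union>k. Z (inverse (real (Suc k)))) \<in> null_sets lebesgue"
            by (intro null_sets_UN null_setsI) auto
          have "Z 0 \<subseteq> (\<Union>k. Z (inverse (real (Suc k))))"
          proof
            fix x assume "x \<in> Z 0"
            then have "0 < lqn q N (\<lambda>j. T (f1 a l j) x)" by (simp add: Z_def)
            then obtain k where "inverse (real (Suc k)) < lqn q N (\<lambda>j. T (f1 a l j) x)" using reals_Archimedean by blast
            then have "x \<in> Z (inverse (real (Suc k)))" by (simp add: Z_def)
            then show "x \<in> (\<Union>k. Z (inverse (real (Suc k))))" by blast
          qed
          then have "emeasure lebesgue (Z 0) \<le> emeasure lebesgue (\<Union>k. Z (inverse (real (Suc k))))"
            using nul by (intro emeasure_mono) auto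
          also have "\<dots> = 0" using nul by (rule null_setsD1)
          finally have "emeasure lebesgue (Z 0) = 0" by (simp del: emeasure_completion)
          then show ?thesis unfolding True mult_zero_right Z_def by (simp del: emeasure_completion)
        qed
      qed
      \<comment> \<open>Off this set the far part of a component with support radius
        \<open>R\<close> vanishes, and \<open>hcube a l\<close> does not meet it. The open ball is
        removed, rather than the closed one, to keep the set compact.\<close>
      define S where "S R = cball (0::real ^ 'n) R - ball a (2 * rad l)" for R
      have "\<forall>j\<in>{..<N}. \<exists>R. \<forall>x. f j x \<noteq> 0 \<longrightarrow> norm x \<le> R" using f by (auto simp: Bc_def bounded_iff)
      from bchoice[OF this] obtain RR where RR: "\<forall>j\<in>{..<N}. \<forall>x. f j x \<noteq> 0 \<longrightarrow> norm x \<le> RR j" ..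
      have ae1: "AE x in lebesgue. \<forall>j\<in>{..<N}. x \<notin> S (RR j) \<longrightarrow> T (f2 a l j) x = (LINT y|lebesgue. K x y * f2 a l j y)"
      proof (subst AE_finite_all, simp, intro ballI)
        fix j assume j: "j \<in> {..<N}"
        show "AE x in lebesgue. x \<notin> S (RR j) \<longrightarrow> T (f2 a l j) x = (LINT y|lebesgue. K x y * f2 a l j y)"
        proof (rule kernel_representation)
          show "f2 a l j \<in> Bc" using f2Bc j by simp
          show "compact (S (RR j))" unfolding S_def by (intro compact_diff) auto
          fix x assume "x \<notin> S (RR j)"
          then show "f2 a l j x = 0" using RR j unfolding S_def f2_def by (auto simp: indicator_def)
        qed
      qed
      have ae2: "AE x in lebesgue. \<forall>j\<in>{..<N}. T (f j) x = T (f1 a l j) x + T (f2 a l j) x"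
      proof (subst AE_finite_all, simp, intro ballI)
        fix j assume "j \<in> {..<N}"
        then have j: "j < N" by simp
        have "f j = (\<lambda>x. f1 a l j x + f2 a l j x)" by (rule ext) (simp add: f1_def f2_def indicator_def)
        then show "AE x in lebesgue. T (f j) x = T (f1 a l j) x + T (f2 a l j) x"
          using T_add[OF f1Bc[OF j, of a l] f2Bc[OF j, of a l]] by simp
      qed
      have outer: "\<bar>lqn q N (\<lambda>j. LINT y|lebesgue. K x y * f2 a l j y) - cc a l\<bar> \<le> c * D * m a l" if x: "x \<in> hcube a l" for x
      proof -
        have away: "2 * rad l < norm (y - a)" if "f2 a l j y \<noteq> 0" for y j
          using that unfolding f2_def by (auto simp: indicator_def dist_norm norm_minus_commute split: if_splits)
        have int: "integrable lebesgue (\<lambda>y. K z y * f2 a l j y)" if z: "z \<in> hcube a l" and j: "j < N" for z j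
        proof (rule K_integrable[OF f2Bc[OF j] radl])
          fix y assume "f2 a l j y \<noteq> 0"
          then have "2 * rad l < norm (y - a)" by (rule away)
          then show "rad l \<le> dist z y" using near[OF z] norm_triangle_ineq[of "y - z" "z - a"] by (simp add: dist_norm norm_minus_commute)
        qed
        have int2: "integrable lebesgue (\<lambda>y. (K x y - K a y) * f2 a l j y)" if "j < N" for j
          using int[OF x that] int[OF ane[OF l] that] by (simp add: left_diff_distrib)
        have "\<bar>lqn q N (\<lambda>j. LINT y|lebesgue. K x y * f2 a l j y) - cc a l\<bar>
          \<le> lqn q N (\<lambda>j. (LINT y|lebesgue. K x y * f2 a l j y) - (LINT y|lebesgue. K a y * f2 a l j y))"
          unfolding cc_def by (rule lqn_triangle_diff[OF q])
        also have "\<dots> = lqn q N (\<lambda>j. LINT y|lebesgue. (K x y - K a y) * f2 a l j y)"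
        proof (rule lqn_cong)
          fix j assume j: "j < N"
          show "norm ((LINT y|lebesgue. K x y * f2 a l j y) - (LINT y|lebesgue. K a y * f2 a l j y)) = norm (LINT y|lebesgue. (K x y - K a y) * f2 a l j y)"
            using int[OF x j] int[OF ane[OF l] j] by (simp add: left_diff_distrib)
        qed
        also have "\<dots> \<le> (LINT y|lebesgue. lqn q N (\<lambda>j. (K x y - K a y) * f2 a l j y))"
          by (rule lqn_integral[OF q int2])
        finally have 1: "\<bar>lqn q N (\<lambda>j. LINT y|lebesgue. K x y * f2 a l j y) - cc a l\<bar> \<le> (LINT y|lebesgue. lqn q N (\<lambda>j. (K x y - K a y) * f2 a l j y))" .
        define wt where "wt y = indicator {y. 2 * rad l < norm (y - a)} y * ((2 * rad l) powr \<epsilon> / norm (y - a) powr (real CARD('n) + \<epsilon>))" for y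
        have pt: "lqn q N (\<lambda>j. (K x y - K a y) * f2 a l j y) \<le> c * (wt y * F y)" for y
        proof (cases "2 * rad l < norm (y - a)")
          case True
          have "2 * norm (a - x) < norm (a - y)" using near[OF x] True by (simp add: norm_minus_commute)
          then have "norm (K a y - K x y) \<le> c * (norm (a - x) powr \<epsilon> / norm (a - y) powr (real CARD('n) + \<epsilon>))"
            by (rule K_smooth1)
          also have "\<dots> \<le> c * wt y"
            unfolding wt_def using True near[OF x] radl c_nonneg eps_pos
            by (intro mult_left_mono) (auto simp: norm_minus_commute intro!: divide_right_mono powr_mono2)
          finally have "norm (K x y - K a y) \<le> c * wt y" by (simp add: norm_minus_commute)
          moreover have "lqn q N (\<lambda>j. f2 a l j y) \<le> F y"
            unfolding F_def f2_def by (intro lqn_mono q) (auto simp: indicator_def norm_mult)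
          ultimately have "norm (K x y - K a y) * lqn q N (\<lambda>j. f2 a l j y) \<le> (c * wt y) * F y"
            by (intro mult_mono) (auto intro: order_trans[OF norm_ge_zero])
          then show ?thesis unfolding lqn_scale[OF q] by (simp add: mult.assoc)
        next
          case False
          then have "f2 a l j y = 0" for j using away by blast
          then show ?thesis using False q by (simp add: lqn_zero wt_def)
        qed
        have "ennreal (LINT y|lebesgue. lqn q N (\<lambda>j. (K x y - K a y) * f2 a l j y)) = (\<integral>\<^sup>+y. lqn q N (\<lambda>j. (K x y - K a y) * f2 a l j y) \<partial>lebesgue)"
          by (rule nn_integral_eq_integral[symmetric]) (auto intro!: lqn_integrable[OF q int2])
        also have "\<dots> \<le> (\<integral>\<^sup>+y. ennreal c * (ennreal (wt y) * ennreal (F y)) \<partial>lebesgue)"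
        proof (intro nn_integral_mono)
          fix y
          have "ennreal (lqn q N (\<lambda>j. (K x y - K a y) * f2 a l j y)) \<le> ennreal (c * (wt y * F y))" by (intro ennreal_leI pt)
          also have "\<dots> = ennreal c * (ennreal (wt y) * ennreal (F y))"
            using c_nonneg F0 by (simp add: ennreal_mult' ennreal_mult'' )
          finally show "ennreal (lqn q N (\<lambda>j. (K x y - K a y) * f2 a l j y)) \<le> ennreal c * (ennreal (wt y) * ennreal (F y))" .
        qed
        also have "\<dots> = ennreal c * (\<integral>\<^sup>+y. ennreal (wt y) * ennreal (F y) \<partial>lebesgue)"
        proof (rule nn_integral_cmult)
          have "wt \<in> borel_measurable borel" unfolding wt_def by measurable
          then have [measurable]: "wt \<in> borel_measurable lebesgue" by (intro measurable_completion) simp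
          show "(\<lambda>y. ennreal (wt y) * ennreal (F y)) \<in> borel_measurable lebesgue" by measurable
        qed
        also have "\<dots> \<le> ennreal c * ennreal (m a l * 2 ^ n * (2 ^ CARD('n) / (1 - 2 powr - \<epsilon>)))"
          unfolding wt_def
        proof (intro mult_left_mono nn_integral_tail_weight)
          show "(\<integral>\<^sup>+ x. ennreal (F x) * indicator (cball a r) x \<partial>lebesgue) \<le> ennreal (m a l * 2 ^ n * r ^ CARD('n))" if "2 * rad l \<le> r" for r
            using avg[OF l that] unfolding n_def .
        qed (use radl eps_pos m0[OF l] in auto)
        also have "\<dots> = ennreal (c * D * m a l)"
          using c_nonneg by (simp add: D_def n_def ennreal_mult'[symmetric] mult_ac)
        finally have "(LINT y|lebesgue. lqn q N (\<lambda>j. (K x y - K a y) * f2 a l j y)) \<le> c * D * m a l"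
          using c_nonneg D m0[OF l] by (subst (asm) ennreal_le_iff) auto
        with 1 show ?thesis by linarith
      qed
      have "emeasure lebesgue {x \<in> hcube a l. w a l < \<bar>lqn q N (\<lambda>j. T (f j) x) - cc a l\<bar>} \<le> emeasure lebesgue {x. A1 * m a l < lqn q N (\<lambda>j. T (f1 a l j) x)}"
      proof (rule emeasure_mono_AE)
        show "AE x in lebesgue. x \<in> {x \<in> hcube a l. w a l < \<bar>lqn q N (\<lambda>j. T (f j) x) - cc a l\<bar>} \<longrightarrow> x \<in> {x. A1 * m a l < lqn q N (\<lambda>j. T (f1 a l j) x)}"
        proof (rule eventually_mono[OF eventually_conj[OF ae1 ae2]], intro impI, elim conjE)
          fix x assume 1: "\<forall>j\<in>{..<N}. x \<notin> S (RR j) \<longrightarrow> T (f2 a l j) x = (LINT y|lebesgue. K x y * f2 a l j y)"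
            and 2: "\<forall>j\<in>{..<N}. T (f j) x = T (f1 a l j) x + T (f2 a l j) x"
            and "x \<in> {x \<in> hcube a l. w a l < \<bar>lqn q N (\<lambda>j. T (f j) x) - cc a l\<bar>}"
          then have x: "x \<in> hcube a l" and big: "w a l < \<bar>lqn q N (\<lambda>j. T (f j) x) - cc a l\<bar>" by auto
          have "x \<notin> S R" for R using near[OF x] radl unfolding S_def by (auto simp: dist_norm norm_minus_commute)
          then have "lqn q N (\<lambda>j. T (f2 a l j) x) = lqn q N (\<lambda>j. LINT y|lebesgue. K x y * f2 a l j y)"
            using 1 by (intro lqn_cong) simp
          then have o: "\<bar>lqn q N (\<lambda>j. T (f2 a l j) x) - cc a l\<bar> \<le> c * D * m a l" using outer[OF x] by simp
          have "lqn q N (\<lambda>j. T (f j) x) = lqn q N (\<lambda>j. T (f1 a l j) x + T (f2 a l j) x)" using 2 by (intro lqn_cong) simp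
          then have "\<bar>lqn q N (\<lambda>j. T (f j) x) - lqn q N (\<lambda>j. T (f2 a l j) x)\<bar> \<le> lqn q N (\<lambda>j. T (f1 a l j) x)"
            using lqn_triangle_diff[OF q, of N "\<lambda>j. T (f1 a l j) x + T (f2 a l j) x" "\<lambda>j. T (f2 a l j) x"] by simp
          moreover have "w a l = A1 * m a l + c * D * m a l" unfolding w_def AA_def by (simp add: distrib_right)
          ultimately show "x \<in> {x. A1 * m a l < lqn q N (\<lambda>j. T (f1 a l j) x)}" using o big by auto
        qed
        note [measurable] = T_lqn_measurable[OF f1Bc]
        have "{x \<in> space lebesgue. A1 * m a l < lqn q N (\<lambda>j. T (f1 a l j) x)} \<in> sets lebesgue" by measurable
        then show "{x. A1 * m a l < lqn q N (\<lambda>j. T (f1 a l j) x)} \<in> sets lebesgue" by simp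
      qed
      then have "2 ^ (CARD('n) + 3) * emeasure lebesgue {x \<in> hcube a l. w a l < \<bar>lqn q N (\<lambda>j. T (f j) x) - cc a l\<bar>}
        \<le> 2 ^ (CARD('n) + 3) * emeasure lebesgue {x. A1 * m a l < lqn q N (\<lambda>j. T (f1 a l j) x)}" by (rule mult_left_mono) simp
      also have "\<dots> \<le> ennreal (l ^ n)" using inner unfolding n_def .
      also have "\<dots> = emeasure lebesgue (hcube a l)" unfolding n_def using l by (intro emeasure_hcube[symmetric]) simp
      finally show "2 ^ (CARD('n) + 3) * emeasure lebesgue {x \<in> hcube a l. w a l < \<bar>lqn q N (\<lambda>j. T (f j) x) - cc a l\<bar>} \<le> emeasure lebesgue (hcube a l)" .
    qed
    moreover have "cc a l = 0" if "0 < l" "\<forall>j<N. \<forall>x. x \<notin> cball a (2 * (real CARD('n) * l)) \<longrightarrow> f j x = 0" for a l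
    proof -
      have "f2 a l j y = 0" if "j < N" for j y
        using \<open>\<forall>j<N. \<forall>x. x \<notin> cball a (2 * (real CARD('n) * l)) \<longrightarrow> f j x = 0\<close> that
        unfolding f2_def rad_def n_def by (auto simp: indicator_def)
      then show ?thesis unfolding cc_def by (intro lqn_zero[OF q]) simp
    qed
    ultimately show "\<exists>cc w. local_oscillation (\<lambda>x. lqn q N (\<lambda>j. T (f j) x)) (\<lambda>x. AA * MFr (\<lambda>x. lqn q N (\<lambda>j. f j x)) x) cc w \<and>
       (\<forall>a l. 0 < l \<longrightarrow> (\<forall>j<N. \<forall>x. x \<notin> cball a (2 * (real CARD('n) * l)) \<longrightarrow> f j x = 0) \<longrightarrow> cc a l = 0)"
      unfolding F_def by blast
  qed
qed

end

section \<open>Strong type for all exponents\<close>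

lemma superlevel_sets:
  assumes "u \<in> borel_measurable lebesgue"
  shows "{x. t < (u x :: real)} \<in> sets lebesgue"
proof -
  have "{x \<in> space lebesgue. t < u x} \<in> sets lebesgue" using assms by measurable
  then show ?thesis by simp
qed

lemma distribution_function_measurable:
  fixes u :: "real ^ 'n \<Rightarrow> real"
  assumes [measurable]: "u \<in> borel_measurable lebesgue"
  shows "(\<lambda>t. emeasure lebesgue {x. t < u x}) \<in> borel_measurable lborel"
proof -
  interpret lebesgue: sigma_finite_measure "lebesgue :: (real ^ 'n) measure" by (rule sigma_finite_lebesgue)
  have "(\<lambda>t. \<integral>\<^sup>+x. indicator {x. t < u x} x \<partial>lebesgue) \<in> borel_measurable lborel"
    by measurable
  moreover have "(\<integral>\<^sup>+x. indicator {x. t < u x} x \<partial>lebesgue) = emeasure lebesgue {x. t < u x}" for t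
    using superlevel_sets[OF assms] by (rule nn_integral_indicator)
  ultimately show ?thesis by (simp only:)
qed

text \<open>Integrating the level inequality against \<open>q * t powr (q - 1)\<close> gives
  \<open>X \<le> X / 2 + 2 powr q * Y\<close>, with \<open>X\<close> and \<open>Y\<close> the
  integrals of the \<open>q\<close>-th powers of the truncated \<open>g\<close> and of
  \<open>(2 * k + 1) * W\<close>; the condition on \<open>k\<close> produces the factor
  \<open>1 / 2\<close>. Absorbing \<open>X / 2\<close> requires \<open>X\<close> to be finite, which
  is why \<open>g\<close> is truncated in height by \<open>L\<close> and in space by the
  cube.\<close>

lemma good_lambda_integral:
  fixes g W :: "real ^ 'n \<Rightarrow> real"
  assumes "local_oscillation g W cc w" and l: "0 < l" and cc0: "cc a l = 0" and g0: "\<And>x. 0 \<le> g x"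
    and W [measurable]: "W \<in> borel_measurable lebesgue" and q: "1 < q" and L: "0 < L"
    and k: "2 ^ (CARD('n) + 2) * (2 * 2 powr q) \<le> 2 ^ k"
  shows "(\<integral>\<^sup>+x. ennreal ((min (g x) L * indicator (hcube a l) x) powr q) \<partial>lebesgue)
    \<le> ennreal (2 * 2 powr q * real (2 * k + 1) powr q) * (\<integral>\<^sup>+x. ennreal (W x powr q) \<partial>lebesgue)"
proof -
  interpret local_oscillation g W cc w by fact
  define u where "u x = min (g x) L * indicator (hcube a l) x" for x
  have um [measurable]: "u \<in> borel_measurable lebesgue" unfolding u_def by measurable
  have u0: "0 \<le> u x" for x unfolding u_def using g0[of x] L by simp
  define \<theta> where "\<theta> = (2::real) ^ (CARD('n) + 2) / 2 ^ k"
  define V where "V x = real (2 * k + 1) * W x" for x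
  have Vm [measurable]: "V \<in> borel_measurable lebesgue" unfolding V_def by measurable
  have V0: "0 \<le> V x" for x unfolding V_def using W_nonneg[of x] by simp
  have level: "emeasure lebesgue {x. t < u x / 2} \<le> ennreal \<theta> * emeasure lebesgue {x. t < u x} + emeasure lebesgue {x. t < V x}"
    if t: "0 < t" for t
  proof (cases "2 * t < L")
    \<comment> \<open>For \<open>t\<close> at least half the truncation height the left set is
      empty. For smaller \<open>t\<close> the truncation does not alter the set in the cube where
      \<open>g\<close> exceeds \<open>t\<close>.\<close>
    case False
    then have "{x. t < u x / 2} = {}" using L t by (auto simp: u_def indicator_def)
    then show ?thesis by simp
  next
    case True
    define E where "E = {x \<in> hcube a l. 2 * t < \<bar>g x\<bar> \<and> W x \<le> t / real (2 * k + 1)}"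
    have Em: "E \<in> sets lebesgue"
    proof -
      have "E = hcube a l \<inter> ({x. 2 * t < \<bar>g x\<bar>} - {x. t / real (2 * k + 1) < W x})"
        unfolding E_def by auto
      also have "\<dots> \<in> sets lebesgue" by (intro sets.Int sets.Diff superlevel_sets) measurable
      finally show ?thesis .
    qed
    have "{x. t < u x / 2} \<subseteq> E \<union> {x. t < V x}"
    proof
      fix x assume "x \<in> {x. t < u x / 2}"
      then have x: "2 * t < u x" by simp
      then have "x \<in> hcube a l" using t by (cases "x \<in> hcube a l") (auto simp: u_def)
      moreover from this have "2 * t < \<bar>g x\<bar>" using x g0[of x] by (auto simp: u_def)
      ultimately show "x \<in> E \<union> {x. t < V x}"
        by (auto simp: E_def V_def not_le field_simps)
    qed
    then have "emeasure lebesgue {x. t < u x / 2} \<le> emeasure lebesgue (E \<union> {x. t < V x})"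
      using Em superlevel_sets[OF Vm] by (intro emeasure_mono sets.Un)
    also have "\<dots> \<le> emeasure lebesgue E + emeasure lebesgue {x. t < V x}"
      by (rule emeasure_subadditive[OF Em superlevel_sets[OF Vm]])
    also have "emeasure lebesgue E \<le> ennreal \<theta> * emeasure lebesgue {x. t < u x}"
    proof -
      have set_eq: "{x \<in> hcube a l. t < \<bar>g x\<bar>} = {x. t < u x}"
      proof (rule set_eqI)
        fix x show "x \<in> {x \<in> hcube a l. t < \<bar>g x\<bar>} \<longleftrightarrow> x \<in> {x. t < u x}"
          using True t g0[of x] by (cases "x \<in> hcube a l") (auto simp: u_def)
      qed
      have "2 ^ k * emeasure lebesgue E \<le> 2 ^ (CARD('n) + 2) * emeasure lebesgue {x. t < u x}"
        unfolding E_def set_eq[symmetric] by (rule good_lambda[OF l cc0 t])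
      then have "ennreal (1 / 2 ^ k) * (ennreal (2 ^ k) * emeasure lebesgue E) \<le> ennreal (1 / 2 ^ k) * (ennreal (2 ^ (CARD('n) + 2)) * emeasure lebesgue {x. t < u x})"
        unfolding two_power_ennreal by (rule mult_left_mono) simp
      moreover have "ennreal (1 / 2 ^ k) * ennreal (2 ^ k) = 1" by (subst ennreal_mult'[symmetric]) auto
      moreover have "ennreal (1 / 2 ^ k) * ennreal (2 ^ (CARD('n) + 2)) = ennreal \<theta>" unfolding \<theta>_def by (subst ennreal_mult'[symmetric]) auto
      ultimately show ?thesis by (simp only: mult.assoc[symmetric] mult_1)
    qed
    finally show ?thesis by (simp only: add_right_mono)
  qed
  define \<kappa> where "\<kappa> t = ennreal (indicator {0<..} t * (q * t powr (q - 1)))" for t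
  have \<kappa>m [measurable]: "\<kappa> \<in> borel_measurable borel" unfolding \<kappa>_def by measurable
  define X where "X = (\<integral>\<^sup>+x. ennreal (u x powr q) \<partial>lebesgue)"
  define Y where "Y = (\<integral>\<^sup>+x. ennreal (V x powr q) \<partial>lebesgue)"
  have q0: "0 < q" using q by simp
  have m1: "(\<lambda>t. emeasure lebesgue {x. t < u x}) \<in> borel_measurable lborel" by (rule distribution_function_measurable[OF um])
  have m2: "(\<lambda>t. emeasure lebesgue {x. t < V x}) \<in> borel_measurable lborel" by (rule distribution_function_measurable[OF Vm])
  have "(\<integral>\<^sup>+x. ennreal ((u x / 2) powr q) \<partial>lebesgue) = (\<integral>\<^sup>+t. \<kappa> t * emeasure lebesgue {x. t < u x / 2} \<partial>lborel)"
    unfolding \<kappa>_def using u0 by (intro layer_cake_measure q0) auto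
  also have "\<dots> \<le> (\<integral>\<^sup>+t. ennreal \<theta> * (\<kappa> t * emeasure lebesgue {x. t < u x}) + \<kappa> t * emeasure lebesgue {x. t < V x} \<partial>lborel)"
  proof (intro nn_integral_mono)
    fix t :: real
    show "\<kappa> t * emeasure lebesgue {x. t < u x / 2} \<le> ennreal \<theta> * (\<kappa> t * emeasure lebesgue {x. t < u x}) + \<kappa> t * emeasure lebesgue {x. t < V x}"
    proof (cases "0 < t")
      case True
      have "\<kappa> t * emeasure lebesgue {x. t < u x / 2} \<le> \<kappa> t * (ennreal \<theta> * emeasure lebesgue {x. t < u x} + emeasure lebesgue {x. t < V x})"
        by (intro mult_left_mono level True) simp
      then show ?thesis by (simp only: distrib_left mult.left_commute)
    qed (simp add: \<kappa>_def)
  qed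
  also have "\<dots> = (\<integral>\<^sup>+t. ennreal \<theta> * (\<kappa> t * emeasure lebesgue {x. t < u x}) \<partial>lborel) + (\<integral>\<^sup>+t. \<kappa> t * emeasure lebesgue {x. t < V x} \<partial>lborel)"
    using m1 m2 by (intro nn_integral_add borel_measurable_times_ennreal) (auto simp del: emeasure_completion)
  also have "(\<integral>\<^sup>+t. ennreal \<theta> * (\<kappa> t * emeasure lebesgue {x. t < u x}) \<partial>lborel) = ennreal \<theta> * (\<integral>\<^sup>+t. \<kappa> t * emeasure lebesgue {x. t < u x} \<partial>lborel)"
    using m1 by (intro nn_integral_cmult borel_measurable_times_ennreal) (auto simp del: emeasure_completion)
  also have "(\<integral>\<^sup>+t. \<kappa> t * emeasure lebesgue {x. t < u x} \<partial>lborel) = X"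
    unfolding X_def \<kappa>_def by (rule layer_cake_measure[OF q0 um u0, symmetric])
  also have "(\<integral>\<^sup>+t. \<kappa> t * emeasure lebesgue {x. t < V x} \<partial>lborel) = Y"
    unfolding Y_def \<kappa>_def by (rule layer_cake_measure[OF q0 Vm V0, symmetric])
  finally have half: "(\<integral>\<^sup>+x. ennreal ((u x / 2) powr q) \<partial>lebesgue) \<le> ennreal \<theta> * X + Y" .
  have "X = (\<integral>\<^sup>+x. ennreal (2 powr q) * ennreal ((u x / 2) powr q) \<partial>lebesgue)"
    unfolding X_def using u0 by (intro nn_integral_cong) (simp add: ennreal_mult[symmetric] powr_mult[symmetric])
  also have "\<dots> = ennreal (2 powr q) * (\<integral>\<^sup>+x. ennreal ((u x / 2) powr q) \<partial>lebesgue)"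
    by (rule nn_integral_cmult) measurable
  also have "\<dots> \<le> ennreal (2 powr q) * (ennreal \<theta> * X + Y)" by (intro mult_left_mono half) simp
  also have "\<dots> = ennreal (2 powr q * \<theta>) * X + ennreal (2 powr q) * Y"
    by (simp add: distrib_left ennreal_mult' mult.assoc)
  also have "\<dots> \<le> ennreal (1 / 2) * X + ennreal (2 powr q) * Y"
  proof (intro add_right_mono mult_right_mono ennreal_leI)
    have "2 powr q * \<theta> = (2 ^ (CARD('n) + 2) * (2 * 2 powr q)) / (2 * 2 ^ k)" unfolding \<theta>_def by simp
    also have "\<dots> \<le> 2 ^ k / (2 * 2 ^ k)" using k by (intro divide_right_mono) auto
    finally show "2 powr q * \<theta> \<le> 1 / 2" by simp
  qed simp
  finally have XY: "X \<le> ennreal (1 / 2) * X + ennreal (2 powr q) * Y" .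
  have Xfin: "X < top"
  proof -
    have "X \<le> (\<integral>\<^sup>+x. ennreal (L powr q) * indicator (hcube a l) x \<partial>lebesgue)"
      unfolding X_def
    proof (intro nn_integral_mono)
      fix x
      have "min (g x) L powr q \<le> L powr q" using g0[of x] L q by (intro powr_mono2) auto
      then show "ennreal (u x powr q) \<le> ennreal (L powr q) * indicator (hcube a l) x"
        using q by (auto simp: u_def indicator_def intro: ennreal_leI)
    qed
    also have "\<dots> = ennreal (L powr q) * ennreal (l ^ CARD('n))"
      using emeasure_hcube[of l a] l by (subst nn_integral_cmult_indicator) (auto simp del: emeasure_completion)
    also have "\<dots> < top" by (simp add: ennreal_mult_less_top)
    finally show ?thesis .
  qed
  have "X \<le> ennreal (2 * 2 powr q) * Y"
  proof (cases "Y = top")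
    case True
    then show ?thesis by (simp add: ennreal_mult_top)
  next
    case False
    then obtain y where y: "Y = ennreal y" "0 \<le> y" by (cases Y) auto
    obtain x where x: "X = ennreal x" "0 \<le> x" using Xfin unfolding less_top_ennreal by blast
    have "ennreal x \<le> ennreal (1 / 2 * x + 2 powr q * y)"
      using XY unfolding x(1) y(1) using x(2) y(2) by (simp only: ennreal_mult'[symmetric] ennreal_plus[symmetric] powr_ge_zero mult_nonneg_nonneg divide_nonneg_nonneg zero_le_one zero_le_numeral)
    then have "x \<le> 1 / 2 * x + 2 powr q * y" using x(2) y(2) by (subst (asm) ennreal_le_iff) auto
    then have "x \<le> 2 * 2 powr q * y" by simp
    then show ?thesis unfolding x(1) y(1) using y(2) by (simp add: ennreal_mult'[symmetric] ennreal_leI)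
  qed
  also have "Y = ennreal (real (2 * k + 1) powr q) * (\<integral>\<^sup>+x. ennreal (W x powr q) \<partial>lebesgue)"
  proof -
    have "Y = (\<integral>\<^sup>+x. ennreal (real (2 * k + 1) powr q) * ennreal (W x powr q) \<partial>lebesgue)"
      unfolding Y_def V_def using W_nonneg by (intro nn_integral_cong) (simp add: powr_mult ennreal_mult')
    also have "\<dots> = ennreal (real (2 * k + 1) powr q) * (\<integral>\<^sup>+x. ennreal (W x powr q) \<partial>lebesgue)"
      by (rule nn_integral_cmult) measurable
    finally show ?thesis .
  qed
  also have "ennreal (2 * 2 powr q) * (ennreal (real (2 * k + 1) powr q) * (\<integral>\<^sup>+x. ennreal (W x powr q) \<partial>lebesgue))
    = ennreal (2 * 2 powr q * real (2 * k + 1) powr q) * (\<integral>\<^sup>+x. ennreal (W x powr q) \<partial>lebesgue)"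
    by (subst ennreal_mult') (simp_all only: mult.assoc powr_ge_zero mult_nonneg_nonneg zero_le_numeral)
  finally show ?thesis unfolding X_def u_def .
qed

context cz_operator
begin

text \<open>For a single component the sequence norm is the modulus whatever \<open>q\<close> is, so
  the \<open>L^2\<close> bound enters with \<open>p = 2\<close> and arbitrary
  \<open>q\<close>.\<close>

lemma scalar_strong_type_L2:
  assumes "1 < q"
  shows "strong_type q (Suc 0) 2 A"
  unfolding strong_type_def
proof (intro allI impI)
  fix f :: "nat \<Rightarrow> real ^ 'n \<Rightarrow> complex" assume "\<forall>j<Suc 0. f j \<in> Bc"
  then have "f 0 \<in> L2" using Bc_L2 by blast
  from T_bound[OF this]
  show "(\<integral>\<^sup>+x. lqn q (Suc 0) (\<lambda>j. T (f j) x) powr 2 \<partial>lebesgue) \<le> ennreal A * (\<integral>\<^sup>+x. lqn q (Suc 0) (\<lambda>j. f j x) powr 2 \<partial>lebesgue)"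
    unfolding lqn_one[OF assms] by (simp add: powr_numeral)
qed

text \<open>The truncated estimate is applied on cubes exhausting the space with truncation heights
  tending to infinity. Its constant is the same for all of them, so Fatou's lemma removes both
  truncations.\<close>

lemma scalar_strong_type:
  assumes q: "1 < q"
  obtains B where "0 \<le> B" "strong_type q (Suc 0) q B"
proof -
  obtain C where C: "0 < C" "weak_type q (Suc 0) C"
    using weak_type_of_strong_type[OF q _ A_nonneg, of 2] scalar_strong_type_L2[OF q] by auto
  obtain AA where AA: "0 < AA" "\<And>N f. weak_type q N C \<Longrightarrow> (\<And>j. j < N \<Longrightarrow> f j \<in> Bc) \<Longrightarrow>
     \<exists>cc w. local_oscillation (\<lambda>x. lqn q N (\<lambda>j. T (f j) x)) (\<lambda>x. AA * MFr (\<lambda>x. lqn q N (\<lambda>j. f j x)) x) cc w \<and>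
       (\<forall>a l. 0 < l \<longrightarrow> (\<forall>j<N. \<forall>x. x \<notin> cball a (2 * (real CARD('n) * l)) \<longrightarrow> f j x = 0) \<longrightarrow> cc a l = 0)"
    using oscillation_of_weak_type[OF q C(1)] by blast
  obtain CM where CM: "0 < CM" "\<And>(F :: real ^ 'n \<Rightarrow> real) B. F \<in> borel_measurable lebesgue \<Longrightarrow> (\<And>x. 0 \<le> F x) \<Longrightarrow> (\<And>x. F x \<le> B) \<Longrightarrow>
    (\<integral>\<^sup>+x. ennreal (MFr F x powr q) \<partial>lebesgue) \<le> ennreal CM * (\<integral>\<^sup>+x. ennreal (F x powr q) \<partial>lebesgue)"
    using maximal_function_strong_type[OF q] by blast
  \<comment> \<open>The power of 2 has to beat the loss \<open>2^(n+2)\<close> of the good-\<lambda>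
    inequality times \<open>2 * 2 powr q\<close>; this is what makes half of the left-hand side
    absorbable.\<close>
  obtain k where k: "2 ^ (CARD('n) + 2) * (2 * 2 powr q) < (2::real) ^ k"
    using real_arch_pow[of 2 "2 ^ (CARD('n) + 2) * (2 * 2 powr q)"] by auto
  define E where "E = 2 * 2 powr q * real (2 * k + 1) powr q"
  have E: "0 \<le> E" unfolding E_def by simp
  define B where "B = E * (AA powr q * CM)"
  show ?thesis
  proof (rule that[of B])
    show "0 \<le> B" unfolding B_def using E CM(1) by simp
    show "strong_type q (Suc 0) q B"
      unfolding strong_type_def
    proof (intro allI impI)
      fix f :: "nat \<Rightarrow> real ^ 'n \<Rightarrow> complex" assume f: "\<forall>j<Suc 0. f j \<in> Bc"
      then have fB: "\<And>j. j < Suc 0 \<Longrightarrow> f j \<in> Bc" by blast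
      define F where "F = (\<lambda>x. lqn q (Suc 0) (\<lambda>j. f j x))"
      define g where "g = (\<lambda>x. lqn q (Suc 0) (\<lambda>j. T (f j) x))"
      define W where "W = (\<lambda>x. AA * MFr F x)"
      have gm [measurable]: "g \<in> borel_measurable lebesgue" unfolding g_def by (rule T_lqn_measurable[OF fB])
      have Fm [measurable]: "F \<in> borel_measurable lebesgue" unfolding F_def by (rule Bc_lqn(4)[OF q fB])
      have g0: "0 \<le> g x" for x unfolding g_def by simp
      have Wm [measurable]: "W \<in> borel_measurable lebesgue" unfolding W_def by measurable
      have "\<exists>cc w. local_oscillation g W cc w \<and>
          (\<forall>a l. 0 < l \<longrightarrow> (\<forall>j<Suc 0. \<forall>x. x \<notin> cball a (2 * (real CARD('n) * l)) \<longrightarrow> f j x = 0) \<longrightarrow> cc a l = 0)"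
        unfolding g_def W_def F_def by (rule AA(2)[OF C(2) fB])
      then obtain cc w where cw: "local_oscillation g W cc w \<and>
          (\<forall>a l. 0 < l \<longrightarrow> (\<forall>j<Suc 0. \<forall>x. x \<notin> cball a (2 * (real CARD('n) * l)) \<longrightarrow> f j x = 0) \<longrightarrow> cc a l = 0)"
        by (elim exE)
      note lo = cw[THEN conjunct1] and cc0 = cw[THEN conjunct2, THEN spec, THEN spec, THEN mp, THEN mp]
      have "\<exists>M>0. \<forall>x. lqn q (Suc 0) (\<lambda>j. f j x) \<le> M" by (rule Bc_lqn(2)[OF q fB])
      then obtain M where "M > 0 \<and> (\<forall>x. lqn q (Suc 0) (\<lambda>j. f j x) \<le> M)" ..
      then have FM: "F x \<le> M" for x by (simp add: F_def)
      have "bounded {x. f 0 x \<noteq> 0}" using f by (simp add: Bc_def)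
      then obtain R where R: "\<And>x. f 0 x \<noteq> 0 \<Longrightarrow> norm x \<le> R" unfolding bounded_iff by blast
      have WI: "(\<integral>\<^sup>+x. ennreal (W x powr q) \<partial>lebesgue) \<le> ennreal (AA powr q * CM) * (\<integral>\<^sup>+x. ennreal (F x powr q) \<partial>lebesgue)"
      proof -
        have "(\<integral>\<^sup>+x. ennreal (W x powr q) \<partial>lebesgue) = (\<integral>\<^sup>+x. ennreal (AA powr q) * ennreal (MFr F x powr q) \<partial>lebesgue)"
          unfolding W_def using AA(1) by (intro nn_integral_cong) (simp add: powr_mult ennreal_mult')
        also have "\<dots> = ennreal (AA powr q) * (\<integral>\<^sup>+x. ennreal (MFr F x powr q) \<partial>lebesgue)"
          by (rule nn_integral_cmult) measurable
        also have "\<dots> \<le> ennreal (AA powr q) * (ennreal CM * (\<integral>\<^sup>+x. ennreal (F x powr q) \<partial>lebesgue))"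
          using FM by (intro mult_left_mono CM(2)[OF Fm]) (auto simp: F_def)
        also have "\<dots> = ennreal (AA powr q * CM) * (\<integral>\<^sup>+x. ennreal (F x powr q) \<partial>lebesgue)"
          by (subst ennreal_mult') (simp_all only: mult.assoc powr_ge_zero)
        finally show ?thesis .
      qed
      \<comment> \<open>The corner of \<open>P i\<close> lies within \<open>n * i\<close> of the
        origin. Once \<open>R \<le> i\<close>, the ball of radius \<open>4 * n * i\<close> about it
        contains every point where \<open>f 0\<close> is nonzero, so the centre of
        \<open>P i\<close> is 0.\<close>
      define P :: "nat \<Rightarrow> (real ^ 'n) set" where "P i = hcube (- real i *\<^sub>R One) (2 * real i)" for i
      define u where "u i x = min (g x) (real i) * indicator (P i) x" for i and x :: "real ^ 'n"
      have bound: "(\<integral>\<^sup>+x. ennreal (u i x powr q) \<partial>lebesgue) \<le> ennreal B * (\<integral>\<^sup>+x. ennreal (F x powr q) \<partial>lebesgue)"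
        if i: "1 \<le> i" "R \<le> real i" for i
      proof -
        have "cc (- real i *\<^sub>R One) (2 * real i) = 0"
        proof (rule cc0)
          show "0 < 2 * real i" using i by simp
          show "\<forall>j<Suc 0. \<forall>x. x \<notin> cball (- real i *\<^sub>R One) (2 * (real CARD('n) * (2 * real i))) \<longrightarrow> f j x = 0"
          proof (intro allI impI, rule ccontr)
            fix j x assume j: "j < Suc 0" and x: "x \<notin> cball (- real i *\<^sub>R One) (2 * (real CARD('n) * (2 * real i)))" and "f j x \<noteq> 0"
            then have "norm x \<le> real i" using R[of x] i by simp
            moreover have "norm (real i *\<^sub>R One :: real ^ 'n) \<le> real CARD('n) * real i"
              by (rule norm_le_of_coords) simp
            moreover have "norm (- real i *\<^sub>R One - x) \<le> norm (real i *\<^sub>R One :: real ^ 'n) + norm x"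
              using norm_triangle_ineq4[of "- real i *\<^sub>R One :: real ^ 'n" x] by simp
            moreover have "real i \<le> real CARD('n) * real i"
            proof -
              have "1 * real i \<le> real CARD('n) * real i" by (intro mult_right_mono) auto
              then show ?thesis by simp
            qed
            moreover have "0 \<le> real CARD('n) * real i" by simp
            ultimately have "norm (- real i *\<^sub>R One - x) \<le> 4 * (real CARD('n) * real i)" by linarith
            then show False using x by (simp add: dist_norm)
          qed
        qed
        then have "(\<integral>\<^sup>+x. ennreal (u i x powr q) \<partial>lebesgue) \<le> ennreal E * (\<integral>\<^sup>+x. ennreal (W x powr q) \<partial>lebesgue)"
          unfolding u_def P_def E_def using i k
          by (intro good_lambda_integral[OF lo _ _ g0 Wm q]) auto
        also have "\<dots> \<le> ennreal E * (ennreal (AA powr q * CM) * (\<integral>\<^sup>+x. ennreal (F x powr q) \<partial>lebesgue))"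
          by (intro mult_left_mono WI) simp
        also have "\<dots> = ennreal B * (\<integral>\<^sup>+x. ennreal (F x powr q) \<partial>lebesgue)"
          unfolding B_def using E by (subst ennreal_mult') (simp_all only: mult.assoc)
        finally show ?thesis .
      qed
      have um: "(\<lambda>x. ennreal (u i x powr q)) \<in> borel_measurable lebesgue" for i
        unfolding u_def P_def by measurable
      have "(\<integral>\<^sup>+x. ennreal (g x powr q) \<partial>lebesgue) = (\<integral>\<^sup>+x. liminf (\<lambda>i. ennreal (u i x powr q)) \<partial>lebesgue)"
      proof (intro nn_integral_cong)
        fix x :: "real ^ 'n"
        have "\<forall>\<^sub>F i in sequentially. ennreal (u i x powr q) = ennreal (g x powr q)"
        proof -
          obtain i0 where i0: "norm x + g x < real i0" using reals_Archimedean2 by blast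
          show ?thesis
          proof (rule eventually_sequentiallyI[of i0])
            fix i assume "i0 \<le> i"
            then have i: "norm x + g x < real i" using i0 by (meson less_le_trans of_nat_le_iff)
            then have "norm x < real i" "g x < real i" using g0[of x] norm_ge_zero[of x] by linarith+
            have "x \<in> P i"
              unfolding P_def hcube_def mem_Collect_eq
            proof
              fix j
              have "\<bar>x $ j\<bar> < real i" using component_le_norm_cart[of x j] \<open>norm x < real i\<close> by linarith
              then show "(- real i *\<^sub>R One) $ j \<le> x $ j \<and> x $ j < (- real i *\<^sub>R One) $ j + 2 * real i" by (simp add: abs_less_iff)
            qed
            then show "ennreal (u i x powr q) = ennreal (g x powr q)" using \<open>g x < real i\<close> by (simp add: u_def)
          qed
        qed
        then have "(\<lambda>i. ennreal (u i x powr q)) \<longlonglongrightarrow> ennreal (g x powr q)" by (rule tendsto_eventually)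
        then show "ennreal (g x powr q) = liminf (\<lambda>i. ennreal (u i x powr q))"
          by (rule lim_imp_Liminf[OF sequentially_bot, symmetric])
      qed
      also have "\<dots> \<le> liminf (\<lambda>i. \<integral>\<^sup>+x. ennreal (u i x powr q) \<partial>lebesgue)" by (rule nn_integral_liminf[OF um])
      also have "\<dots> \<le> limsup (\<lambda>i. \<integral>\<^sup>+x. ennreal (u i x powr q) \<partial>lebesgue)" by (rule Liminf_le_Limsup) simp
      also have "\<dots> \<le> ennreal B * (\<integral>\<^sup>+x. ennreal (F x powr q) \<partial>lebesgue)"
      proof (rule Limsup_bounded)
        obtain i1 where i1: "R < real i1" using reals_Archimedean2 by blast
        show "\<forall>\<^sub>F i in sequentially. (\<integral>\<^sup>+x. ennreal (u i x powr q) \<partial>lebesgue) \<le> ennreal B * (\<integral>\<^sup>+x. ennreal (F x powr q) \<partial>lebesgue)"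
          using i1 by (intro eventually_sequentiallyI[of "max 1 i1"] bound) (auto simp: le_max_iff_disj)
      qed
      finally show "(\<integral>\<^sup>+x. lqn q (Suc 0) (\<lambda>j. T (f j) x) powr q \<partial>lebesgue) \<le> ennreal B * (\<integral>\<^sup>+x. lqn q (Suc 0) (\<lambda>j. f j x) powr q \<partial>lebesgue)"
        unfolding g_def F_def .
    qed
  qed
qed

text \<open>With equal inner and outer exponents the \<open>q\<close>-th power of the norm
  integrates to a sum over components, to each of which the scalar bound applies.\<close>

lemma vector_strong_type:
  assumes q: "1 < q"
  obtains B where "0 \<le> B" "\<And>N. strong_type q N q B"
proof -
  obtain B where B: "0 \<le> B" "strong_type q (Suc 0) q B" using scalar_strong_type[OF q] .
  show ?thesis
  proof (rule that[OF B(1)])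
    fix N
    show "strong_type q N q B"
      unfolding strong_type_def
    proof (intro allI impI)
      fix f :: "nat \<Rightarrow> real ^ 'n \<Rightarrow> complex" assume f: "\<forall>j<N. f j \<in> Bc"
      have sc: "(\<integral>\<^sup>+x. norm (T (f j) x) powr q \<partial>lebesgue) \<le> ennreal B * (\<integral>\<^sup>+x. norm (f j x) powr q \<partial>lebesgue)" if "j < N" for j
        using B(2)[unfolded strong_type_def, rule_format, of "\<lambda>_. f j"] f that by (simp add: lqn_one[OF q])
      have m: "(\<lambda>x. ennreal (norm (h x) powr q)) \<in> borel_measurable lebesgue" if "h \<in> borel_measurable lebesgue"
        for h :: "real ^ 'n \<Rightarrow> complex"
        using that by measurable
      have ex: "(\<integral>\<^sup>+x. lqn q N (\<lambda>j. h j x) powr q \<partial>lebesgue) = (\<Sum>j<N. \<integral>\<^sup>+x. norm (h j x) powr q \<partial>lebesgue)"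
        if "\<And>j. j < N \<Longrightarrow> h j \<in> borel_measurable lebesgue" for h :: "nat \<Rightarrow> real ^ 'n \<Rightarrow> complex"
      proof -
        have "(\<integral>\<^sup>+x. lqn q N (\<lambda>j. h j x) powr q \<partial>lebesgue) = (\<integral>\<^sup>+x. (\<Sum>j<N. ennreal (norm (h j x) powr q)) \<partial>lebesgue)"
          unfolding lqn_powr[OF q] by (simp add: sum_ennreal)
        also have "\<dots> = (\<Sum>j<N. \<integral>\<^sup>+x. norm (h j x) powr q \<partial>lebesgue)"
          using that by (intro nn_integral_sum m) auto
        finally show ?thesis .
      qed
      have "(\<integral>\<^sup>+x. lqn q N (\<lambda>j. T (f j) x) powr q \<partial>lebesgue) = (\<Sum>j<N. \<integral>\<^sup>+x. norm (T (f j) x) powr q \<partial>lebesgue)"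
        using f by (intro ex T_measurable) auto
      also have "\<dots> \<le> (\<Sum>j<N. ennreal B * (\<integral>\<^sup>+x. norm (f j x) powr q \<partial>lebesgue))"
        using sc by (intro sum_mono) auto
      also have "\<dots> = ennreal B * (\<integral>\<^sup>+x. lqn q N (\<lambda>j. f j x) powr q \<partial>lebesgue)"
        using f by (subst ex) (auto simp: sum_distrib_left Bc_measurable)
      finally show "(\<integral>\<^sup>+x. lqn q N (\<lambda>j. T (f j) x) powr q \<partial>lebesgue) \<le> ennreal B * (\<integral>\<^sup>+x. lqn q N (\<lambda>j. f j x) powr q \<partial>lebesgue)" .
    qed
  qed
qed

end

section \<open>The exponential decay estimate\<close>

text \<open>By Lindelof's theorem the union of all open sets on which \<open>f\<close> vanishes
  almost everywhere is already a countable union, so the exceptional null sets add up to a null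
  set.\<close>

lemma AE_outside_ess_supp: "AE x in lebesgue. x \<notin> ess_supp f \<longrightarrow> f x = 0"
proof -
  define \<F> where "\<F> = {U. open U \<and> (AE x in lebesgue. x \<in> U \<longrightarrow> f x = 0)}"
  obtain \<G> where G: "\<G> \<subseteq> \<F>" "countable \<G>" "\<Union>\<G> = \<Union>\<F>"
    by (rule Lindelof[of \<F>]) (auto simp: \<F>_def)
  have "AE x in lebesgue. \<forall>U\<in>\<G>. x \<in> U \<longrightarrow> f x = 0"
    using G(1) by (subst AE_ball_countable[OF G(2)]) (auto simp: \<F>_def)
  then show ?thesis
    by (rule eventually_mono) (use G(3) in \<open>auto simp: ess_supp_def \<F>_def\<close>)
qed

text \<open>\<open>f\<close> is set to 0 off \<open>Q\<close> and where it exceeds its essential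
  bound. That \<open>norm (h x) \<le> norm (f x)\<close> holds at every point makes the maximal
  function of \<open>f\<close> dominate that of \<open>h\<close> by plain monotonicity.\<close>

lemma L_infinity_c_representative:
  fixes f :: "real ^ 'n \<Rightarrow> complex"
  assumes f: "f \<in> L_infinity_c" and Q: "ess_supp f \<subseteq> Q" "Q \<in> sets lebesgue" "bounded Q"
  obtains h where "h \<in> Bc" "\<And>x. norm (h x) \<le> norm (f x)" "\<And>x. x \<notin> Q \<Longrightarrow> h x = 0"
    "AE x in lebesgue. f x = h x" "f \<in> L2"
proof -
  have fm [measurable]: "f \<in> borel_measurable lebesgue" using f by (simp add: L_infinity_c_def)
  obtain B where B: "AE x in lebesgue. norm (f x) \<le> B" using f unfolding L_infinity_c_def by blast
  define E where "E = {x \<in> space lebesgue. norm (f x) \<le> \<bar>B\<bar>} \<inter> Q"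
  have E: "E \<in> sets lebesgue" unfolding E_def using Q(2) by (intro sets.Int) measurable
  define h where "h x = of_real (indicator E x) * f x" for x
  have hm: "h \<in> borel_measurable lebesgue" unfolding h_def using E by measurable
  have "norm (h x) \<le> \<bar>B\<bar>" for x unfolding h_def by (auto simp: indicator_def E_def)
  moreover have "bounded {x. h x \<noteq> 0}"
    using Q(3) by (rule bounded_subset) (auto simp: h_def E_def indicator_def split: if_splits)
  ultimately have hBc: "h \<in> Bc" unfolding Bc_def using hm by blast
  have ae: "AE x in lebesgue. f x = h x"
    using B AE_outside_ess_supp[of f]
  proof eventually_elim
    case (elim x)
    then show ?case using Q(1) by (cases "x \<in> Q") (auto simp: h_def E_def indicator_def)
  qed
  have "integrable lebesgue (\<lambda>x. (norm (h x))\<^sup>2)" using Bc_L2[OF hBc] by (simp add: L2_def)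
  moreover have "integrable lebesgue (\<lambda>x. (norm (f x))\<^sup>2) \<longleftrightarrow> integrable lebesgue (\<lambda>x. (norm (h x))\<^sup>2)"
    using hm ae by (intro integrable_cong_AE) auto
  ultimately have "f \<in> L2" using fm by (simp add: L2_def)
  show ?thesis
  proof (rule that[OF hBc _ _ ae \<open>f \<in> L2\<close>])
    show "norm (h x) \<le> norm (f x)" for x by (auto simp: h_def indicator_def)
    show "h x = 0" if "x \<notin> Q" for x using that by (simp add: h_def E_def)
  qed
qed

context cz_operator
begin

text \<open>\<open>G\<close> is any majorant of the truncated norm. It lets the maximal function of
  the full \<open>\<ell>\<close>-norm appear for every \<open>N\<close>, so that the level sets of
  different truncations are nested. Replacing the components by representatives in \<open>Bc\<close>
  and the closed cube by the half-open one costs only null sets.\<close>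

lemma lqn_exponential_decay:
  assumes q: "1 < q"
  obtains \<alpha> where "0 < \<alpha>" "\<And>N (f :: nat \<Rightarrow> real ^ 'n \<Rightarrow> complex) a l (G :: real ^ 'n \<Rightarrow> ennreal) t. 0 < l \<Longrightarrow> 0 < t \<Longrightarrow>
     (\<And>j. j < N \<Longrightarrow> f j \<in> L_infinity_c) \<Longrightarrow> (\<And>j. j < N \<Longrightarrow> ess_supp (f j) \<subseteq> cbox a (a + l *\<^sub>R One)) \<Longrightarrow>
     (\<And>x. ennreal (lqn q N (\<lambda>j. f j x)) \<le> G x) \<Longrightarrow>
     emeasure lebesgue {x \<in> cbox a (a + l *\<^sub>R One). ennreal t * maximal_function G x < ennreal (lqn q N (\<lambda>j. T (f j) x))}
       \<le> ennreal (2 * exp (- \<alpha> * t)) * emeasure lebesgue (cbox a (a + l *\<^sub>R One))"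
proof -
  obtain B where B: "0 \<le> B" "\<And>N. strong_type q N q B" using vector_strong_type[OF q] by blast
  obtain C where C: "0 < C" "\<And>N. strong_type q N q B \<Longrightarrow> weak_type q N C"
    using weak_type_of_strong_type[OF q q B(1)] by blast
  obtain AA where AA: "0 < AA" "\<And>N f. weak_type q N C \<Longrightarrow> (\<And>j. j < N \<Longrightarrow> f j \<in> Bc) \<Longrightarrow>
     \<exists>cc w. local_oscillation (\<lambda>x. lqn q N (\<lambda>j. T (f j) x)) (\<lambda>x. AA * MFr (\<lambda>x. lqn q N (\<lambda>j. f j x)) x) cc w \<and>
       (\<forall>a l. 0 < l \<longrightarrow> (\<forall>j<N. \<forall>x. x \<notin> cball a (2 * (real CARD('n) * l)) \<longrightarrow> f j x = 0) \<longrightarrow> cc a l = 0)"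
    using oscillation_of_weak_type[OF q C(1)] by blast
  define \<alpha> where "\<alpha> = ln 2 / (2 * AA)"
  show ?thesis
  proof (rule that[of \<alpha>])
    show "0 < \<alpha>" unfolding \<alpha>_def using AA(1) by simp
    fix N and f :: "nat \<Rightarrow> real ^ 'n \<Rightarrow> complex" and a :: "real ^ 'n" and l :: real and G :: "real ^ 'n \<Rightarrow> ennreal" and t :: real
    assume l: "0 < l" and t: "0 < t" and f: "\<And>j. j < N \<Longrightarrow> f j \<in> L_infinity_c"
      and supp: "\<And>j. j < N \<Longrightarrow> ess_supp (f j) \<subseteq> cbox a (a + l *\<^sub>R One)"
      and G: "\<And>x. ennreal (lqn q N (\<lambda>j. f j x)) \<le> G x"
    define Q where "Q = cbox a (a + l *\<^sub>R One)"
    have Qs: "Q \<in> sets lebesgue" "bounded Q" unfolding Q_def by auto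
    have "\<forall>j\<in>{..<N}. \<exists>h. h \<in> Bc \<and> (\<forall>x. norm (h x) \<le> norm (f j x)) \<and> (\<forall>x. x \<notin> Q \<longrightarrow> h x = 0) \<and>
        (AE x in lebesgue. f j x = h x) \<and> f j \<in> L2"
    proof
      fix j assume "j \<in> {..<N}"
      then have j: "j < N" by simp
      show "\<exists>h. h \<in> Bc \<and> (\<forall>x. norm (h x) \<le> norm (f j x)) \<and> (\<forall>x. x \<notin> Q \<longrightarrow> h x = 0) \<and>
        (AE x in lebesgue. f j x = h x) \<and> f j \<in> L2"
        using L_infinity_c_representative[OF f[OF j] supp[OF j, folded Q_def] Qs] by metis
    qed
    from bchoice[OF this] obtain h where h: "\<forall>j\<in>{..<N}. h j \<in> Bc \<and> (\<forall>x. norm (h j x) \<le> norm (f j x)) \<and> (\<forall>x. x \<notin> Q \<longrightarrow> h j x = 0) \<and>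
        (AE x in lebesgue. f j x = h j x) \<and> f j \<in> L2" ..
    have hBc: "\<And>j. j < N \<Longrightarrow> h j \<in> Bc" and hle: "\<And>j x. j < N \<Longrightarrow> norm (h j x) \<le> norm (f j x)"
      and hQ: "\<And>j x. j < N \<Longrightarrow> x \<notin> Q \<Longrightarrow> h j x = 0" and hae: "\<And>j. j < N \<Longrightarrow> AE x in lebesgue. f j x = h j x"
      and fL2: "\<And>j. j < N \<Longrightarrow> f j \<in> L2" using h by auto
    define F where "F = (\<lambda>x. lqn q N (\<lambda>j. h j x))"
    define g where "g = (\<lambda>x. lqn q N (\<lambda>j. T (h j) x))"
    define W where "W = (\<lambda>x. AA * MFr F x)"
    have "\<exists>cc w. local_oscillation g W cc w \<and>
        (\<forall>a l. 0 < l \<longrightarrow> (\<forall>j<N. \<forall>x. x \<notin> cball a (2 * (real CARD('n) * l)) \<longrightarrow> h j x = 0) \<longrightarrow> cc a l = 0)"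
      unfolding g_def W_def F_def by (rule AA(2)[OF C(2)[OF B(2)] hBc])
    then obtain cc w where cw: "local_oscillation g W cc w \<and>
        (\<forall>a l. 0 < l \<longrightarrow> (\<forall>j<N. \<forall>x. x \<notin> cball a (2 * (real CARD('n) * l)) \<longrightarrow> h j x = 0) \<longrightarrow> cc a l = 0)"
      by (elim exE)
    note lo = cw[THEN conjunct1] and cc0' = cw[THEN conjunct2, THEN spec, THEN spec, THEN mp, THEN mp]
    interpret local_oscillation g W cc w by (rule lo)
    have cc0: "cc a l = 0"
    proof (rule cc0'[OF l], intro allI impI)
      fix j x assume j: "j < N" and x: "x \<notin> cball a (2 * (real CARD('n) * l))"
      have "x \<notin> Q"
      proof
        assume "x \<in> Q"
        then have xi: "a $ i \<le> x $ i \<and> x $ i \<le> a $ i + l" for i unfolding Q_def mem_cube_iff by blast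
        have "norm (a - x) \<le> real CARD('n) * l"
        proof (rule norm_le_of_coords)
          fix i show "\<bar>(a - x) $ i\<bar> \<le> l" using xi[of i] by (simp add: abs_le_iff)
        qed
        moreover have "0 \<le> real CARD('n) * l" using l by simp
        ultimately have "norm (a - x) \<le> 2 * (real CARD('n) * l)" by linarith
        then show False using x by (simp add: dist_norm)
      qed
      then show "h j x = 0" by (rule hQ[OF j])
    qed
    \<comment> \<open>The largest number of generations with \<open>2 * k * AA \<le> t\<close>.
      Rounding down loses less than one generation, whence the factor 2 in the bound;
      \<open>\<alpha>\<close> is chosen so that \<open>exp (- \<alpha> * t)\<close> equals
      \<open>2 powr (- (t / (2 * AA)))\<close>.\<close>
    define k where "k = nat \<lfloor>t / (2 * AA)\<rfloor>"
    have k: "real k \<le> t / (2 * AA)" "t / (2 * AA) < real k + 1"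
      unfolding k_def using t AA(1) by (simp_all add: of_nat_nat)
    obtain H where H: "H \<in> sets lebesgue" "{x \<in> hcube a l. 2 * real k * W x < \<bar>g x - cc a l\<bar>} \<subseteq> H"
      "2 ^ k * emeasure lebesgue H \<le> emeasure lebesgue (hcube a l)"
      using oscillation_decay[OF l, of a k] by blast
    have "\<exists>M>0. \<forall>x. lqn q N (\<lambda>j. h j x) \<le> M" by (rule Bc_lqn(2)[OF q hBc])
    then obtain M where "M > 0 \<and> (\<forall>x. lqn q N (\<lambda>j. h j x) \<le> M)" ..
    then have FM: "F x \<le> M" for x by (simp add: F_def)
    have "AE x in lebesgue. \<forall>j\<in>{..<N}. T (f j) x = T (h j) x"
    proof (subst AE_finite_all, simp, intro ballI)
      fix j assume "j \<in> {..<N}"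
      then have j: "j < N" by simp
      show "AE x in lebesgue. T (f j) x = T (h j) x"
        by (rule T_cong_AE[OF fL2[OF j] Bc_L2[OF hBc[OF j]] hae[OF j]])
    qed
    moreover have "AE x in lebesgue. x \<notin> Q - hcube a l"
      unfolding Q_def using hcube_null_diff[of l a] l by (intro AE_not_in) simp
    ultimately have ae: "AE x in lebesgue. (\<forall>j\<in>{..<N}. T (f j) x = T (h j) x) \<and> x \<notin> Q - hcube a l"
      by (rule eventually_conj)
    have "emeasure lebesgue {x \<in> Q. ennreal t * maximal_function G x < ennreal (lqn q N (\<lambda>j. T (f j) x))} \<le> emeasure lebesgue H"
    proof (rule emeasure_mono_AE[OF _ H(1)], rule eventually_mono[OF ae], intro impI)
      fix x assume x: "(\<forall>j\<in>{..<N}. T (f j) x = T (h j) x) \<and> x \<notin> Q - hcube a l"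
        and big: "x \<in> {x \<in> Q. ennreal t * maximal_function G x < ennreal (lqn q N (\<lambda>j. T (f j) x))}"
      have xP: "x \<in> hcube a l" using x big by blast
      have gx: "lqn q N (\<lambda>j. T (f j) x) = g x" unfolding g_def using x by (intro lqn_cong) simp
      have "ennreal (MFr F x) \<le> maximal_function G x"
        unfolding MFr_eq[OF FM]
      proof (rule maximal_function_mono)
        fix y
        have "F y \<le> lqn q N (\<lambda>j. f j y)" unfolding F_def by (intro lqn_mono q hle)
        then have "ennreal (F y) \<le> ennreal (lqn q N (\<lambda>j. f j y))" by (rule ennreal_leI)
        then show "ennreal (F y) \<le> G y" using G[of y] by (rule order_trans)
      qed
      then have "ennreal t * ennreal (MFr F x) \<le> ennreal t * maximal_function G x" by (rule mult_left_mono) simp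
      also have "\<dots> < ennreal (g x)" using big gx by simp
      finally have "ennreal (t * MFr F x) < ennreal (g x)" using t by (simp add: ennreal_mult')
      then have lt: "t * MFr F x < g x" using t by (subst (asm) ennreal_less_iff) auto
      have "2 * real k * AA \<le> t" using k(1) AA(1) by (simp add: pos_le_divide_eq mult_ac)
      then have "2 * real k * AA * MFr F x \<le> t * MFr F x" by (rule mult_right_mono) simp
      then have "2 * real k * W x < \<bar>g x - cc a l\<bar>" unfolding W_def cc0 using lt by (simp add: mult_ac)
      then show "x \<in> H" using H(2) xP by blast
    qed
    also have "emeasure lebesgue H \<le> ennreal (2 * exp (- \<alpha> * t)) * emeasure lebesgue (hcube a l)"
    proof -
      have "emeasure lebesgue H = ennreal (1 / 2 ^ k) * (ennreal (2 ^ k) * emeasure lebesgue H)"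
        unfolding mult.assoc[symmetric] by (subst ennreal_mult'[symmetric]) (simp_all del: emeasure_completion)
      also have "\<dots> \<le> ennreal (1 / 2 ^ k) * emeasure lebesgue (hcube a l)"
        using H(3) unfolding two_power_ennreal by (rule mult_left_mono) simp
      also have "\<dots> \<le> ennreal (2 * exp (- \<alpha> * t)) * emeasure lebesgue (hcube a l)"
      proof (intro mult_right_mono ennreal_leI)
        have "1 / 2 ^ k = 2 powr (- real k)" by (simp add: powr_minus powr_realpow divide_inverse)
        also have "\<dots> \<le> 2 powr (1 + - (t / (2 * AA)))" using k(2) by (intro powr_mono) auto
        also have "\<dots> = 2 * 2 powr (- (t / (2 * AA)))" by (simp only: powr_add powr_one zero_le_numeral)
        also have "2 powr (- (t / (2 * AA))) = exp (- \<alpha> * t)" unfolding \<alpha>_def by (simp add: powr_def)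
        finally show "1 / 2 ^ k \<le> 2 * exp (- \<alpha> * t)" .
      qed simp
      finally show ?thesis .
    qed
    also have "emeasure lebesgue (hcube a l) = emeasure lebesgue (cbox a (a + l *\<^sub>R One))"
      using emeasure_hcube[of l a] emeasure_cube[of l a] l by (simp only: less_imp_le)
    finally show "emeasure lebesgue {x \<in> cbox a (a + l *\<^sub>R One). ennreal t * maximal_function G x < ennreal (lqn q N (\<lambda>j. T (f j) x))}
       \<le> ennreal (2 * exp (- \<alpha> * t)) * emeasure lebesgue (cbox a (a + l *\<^sub>R One))" unfolding Q_def .
  qed
qed

end

text \<open>Bounded functions of compact support need not be test functions, so the operator acts on
  them through its extension \<open>T'\<close> to \<open>L2\<close>. The passage from truncations to
  full sequences is monotone.\<close>

theorem theorem2p4: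
  fixes q :: real
    and T T' :: "(real ^ 'n \<Rightarrow> complex) \<Rightarrow> real ^ 'n \<Rightarrow> complex"
  assumes "1 < q"
    and "calderon_zygmund T"
    and "L2_extension T T'"
  shows "\<exists>\<alpha> c. 0 < \<alpha> \<and> 0 < c \<and>
    (\<forall>(Q :: (real ^ 'n) set) (f :: nat \<Rightarrow> real ^ 'n \<Rightarrow> complex).
       cube Q \<and> (\<forall>j. f j \<in> L_infinity_c \<and> ess_supp (f j) \<subseteq> Q) \<longrightarrow>
       (\<forall>t>0. emeasure lebesgue
          {x \<in> Q. vector_extension q T' f x
                     > ennreal t * maximal_function (\<lambda>y. lq_norm q (\<lambda>j. f j y)) x}
        \<le> ennreal (c * exp (- \<alpha> * t)) * emeasure lebesgue Q))"
proof -
  note q = assms(1)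
  obtain K c \<epsilon> A where "cz_operator T' K c \<epsilon> A" using cz_operator_L2_extension[OF assms(2,3)] by blast
  then interpret cz_operator T' K c \<epsilon> A .
  obtain \<alpha> where \<alpha>: "0 < \<alpha>" and decay: "\<And>N (f :: nat \<Rightarrow> real ^ 'n \<Rightarrow> complex) a l (G :: real ^ 'n \<Rightarrow> ennreal) t. 0 < l \<Longrightarrow> 0 < t \<Longrightarrow>
     (\<And>j. j < N \<Longrightarrow> f j \<in> L_infinity_c) \<Longrightarrow> (\<And>j. j < N \<Longrightarrow> ess_supp (f j) \<subseteq> cbox a (a + l *\<^sub>R One)) \<Longrightarrow>
     (\<And>x. ennreal (lqn q N (\<lambda>j. f j x)) \<le> G x) \<Longrightarrow>
     emeasure lebesgue {x \<in> cbox a (a + l *\<^sub>R One). ennreal t * maximal_function G x < ennreal (lqn q N (\<lambda>j. T' (f j) x))}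
       \<le> ennreal (2 * exp (- \<alpha> * t)) * emeasure lebesgue (cbox a (a + l *\<^sub>R One))"
    using lqn_exponential_decay[OF q] by blast
  show ?thesis
  proof (rule exI[of _ \<alpha>], rule exI[of _ 2], intro conjI allI impI \<alpha>)
    fix Q and f :: "nat \<Rightarrow> real ^ 'n \<Rightarrow> complex" and t :: real
    assume Qf: "cube Q \<and> (\<forall>j. f j \<in> L_infinity_c \<and> ess_supp (f j) \<subseteq> Q)" and t: "0 < t"
    then obtain a l where al: "0 < l" "Q = cbox a (a + l *\<^sub>R One)" unfolding cube_def by blast
    define G where "G = (\<lambda>y. lq_norm q (\<lambda>j. f j y))"
    \<comment> \<open>The superlevel set of the full norm is the increasing union of these
      measurable sets, so it is measurable itself and continuity from below applies; the bound for
      \<open>E N\<close> does not involve \<open>N\<close>.\<close>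
    define E where "E N = {x \<in> Q. ennreal t * maximal_function G x < ennreal (lqn q N (\<lambda>j. T' (f j) x))}" for N
    have [measurable]: "T' (f j) \<in> borel_measurable lebesgue" for j
    proof -
      have "ess_supp (f j) \<subseteq> Q" "Q \<in> sets lebesgue" "bounded Q" "f j \<in> L_infinity_c" using Qf al(2) by auto
      then have "f j \<in> L2" using L_infinity_c_representative[of "f j" Q] by blast
      then show ?thesis using T_L2 by (simp add: L2_def)
    qed
    have Es: "E N \<in> sets lebesgue" for N
    proof -
      have lm: "(\<lambda>x. lqn q N (\<lambda>j. T' (f j) x)) \<in> borel_measurable lebesgue" by (rule lqn_measurable) simp
      have "E N = Q \<inter> {x \<in> space lebesgue. ennreal t * maximal_function G x < ennreal (lqn q N (\<lambda>j. T' (f j) x))}"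
        unfolding E_def by auto
      also have "\<dots> \<in> sets lebesgue"
        using lm al(2) by (intro sets.Int) (simp, measurable)
      finally show ?thesis .
    qed
    have "incseq E"
    proof (rule incseq_SucI, rule subsetI)
      fix N x assume "x \<in> E N"
      then have x: "x \<in> Q" "ennreal t * maximal_function G x < ennreal (lqn q N (\<lambda>j. T' (f j) x))" by (auto simp: E_def)
      have "lqn q N (\<lambda>j. T' (f j) x) \<le> lqn q (Suc N) (\<lambda>j. T' (f j) x)" by (intro lqn_mono_N q) simp
      then have "ennreal (lqn q N (\<lambda>j. T' (f j) x)) \<le> ennreal (lqn q (Suc N) (\<lambda>j. T' (f j) x))" by (rule ennreal_leI)
      with x(2) have "ennreal t * maximal_function G x < ennreal (lqn q (Suc N) (\<lambda>j. T' (f j) x))" by (rule less_le_trans)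
      with x(1) show "x \<in> E (Suc N)" by (simp add: E_def)
    qed
    have "{x \<in> Q. vector_extension q T' f x > ennreal t * maximal_function (\<lambda>y. lq_norm q (\<lambda>j. f j y)) x} = (\<Union>N. E N)"
      unfolding E_def vector_extension_def lq_norm_less_iff[OF q] G_def by blast
    then have "emeasure lebesgue {x \<in> Q. vector_extension q T' f x > ennreal t * maximal_function (\<lambda>y. lq_norm q (\<lambda>j. f j y)) x}
      = emeasure lebesgue (\<Union>N. E N)" by (simp only:)
    also have "\<dots> = (SUP N. emeasure lebesgue (E N))"
      using Es \<open>incseq E\<close> by (intro SUP_emeasure_incseq[symmetric]) auto
    also have "\<dots> \<le> ennreal (2 * exp (- \<alpha> * t)) * emeasure lebesgue Q"
    proof (rule SUP_least)
      fix N
      show "emeasure lebesgue (E N) \<le> ennreal (2 * exp (- \<alpha> * t)) * emeasure lebesgue Q"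
        unfolding E_def al(2)
      proof (rule decay[OF al(1) t])
        show "f j \<in> L_infinity_c" "ess_supp (f j) \<subseteq> cbox a (a + l *\<^sub>R One)" for j using Qf al(2) by auto
        show "ennreal (lqn q N (\<lambda>j. f j x)) \<le> G x" for x
          unfolding G_def lq_norm_eq_SUP[OF q] by (rule SUP_upper) simp
      qed
    qed
    finally show "emeasure lebesgue {x \<in> Q. vector_extension q T' f x > ennreal t * maximal_function (\<lambda>y. lq_norm q (\<lambda>j. f j y)) x}
      \<le> ennreal (2 * exp (- \<alpha> * t)) * emeasure lebesgue Q" .
  qed simp
qed

end
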